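(* Let $(\tau_e)$ be i.i.d. nonnegative continuous passage times on the edges of $\mathbb Z^\ell$ satisfying $\mathbb E e^{\alpha\tau_e}<\infty$ for some $\alpha>0$. For $t>0$ let $B(t)=\{y\in\mathbb Z^\ell:T(0,y)<t\}$, $d_t(x/t,y/t)=t^{-1}T(x,y)$ for $x,y\in B(t)$, $\mu_t$ the uniform probability measure on $B(t)/t$, and let $b_t$ be the Fréchet mean of $(B(t)/t,d_t,\mu_t)$. Let $\mathcal B_0$ be the limit shape, $d$ the distance induced by the norm $\|\cdot\|_\tau$, $\mu$ the uniform probability measure on $\mathcal B_0$, and $\mathcal S_{\mathcal X}(1)\subset\mathcal B_0$ the set of Fréchet means of $\mathcal X=(\mathcal B_0,d,\mu)$. Then, as $t\to\infty$, $$\mathrm{dist}(b_t,\mathcal S_{\mathcal X}(1))\to0\qquad\text{almost surely},$$ where $\mathrm{dist}$ is the distance from a point to a set induced by $d$ (equivalently, by the Euclidean distance).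
   Context: First passage percolation: points $x,y\in\mathbb Z^\ell$ are joined by an edge iff $|x-y|_1=1$. The common law of the passage times $\tau_e\ge0$ has a density with respect to Lebesgue measure. $T(x,y)$ is the infimum over all paths of edges from $x$ to $y$ of the sum of the $\tau_e$ along the path ($T(x,x)=0$). The norm $\|x\|_\tau=\lim_{n\to\infty}\frac1nT(0,nx)$ (almost sure deterministic limit for $x\in\mathbb Z^\ell$, uniquely extended to a norm on $\mathbb R^\ell$) defines $d(s,s')=\|s-s'\|_\tau$ and $\mathcal B_0=\{x\in\mathbb R^\ell:\|x\|_\tau\le1\}$; the uniform measure on $\mathcal B_0$ is normalized Lebesgue measure. A Fréchet mean of a compact metric space with probability measure $(\mathbb Y,\rho,\nu)$ is a minimizer over $x\in\mathbb Y$ of $\int_{\mathbb Y}\rho(x,y)^2\,\nu(dy)$. The Fréchet mean $b_t$ of $(B(t)/t,d_t,\mu_t)$ is a point of $B(t)/t\subset\mathbb R^\ell$; if it is not unique, $b_t$ denotes a minimizer. *)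

theory Defs
  imports "HOL-Probability.Probability"
begin

definition lattice :: "(real^'n) set" where
  "lattice = {x. \<forall>i. x $ i \<in> \<int>}"

text \<open>Undirected edges are two-element sets, so that one passage time is attached to each edge.\<close>

definition edges :: "(real^'n) set set" where
  "edges = {{x, y} | x y. x \<in> lattice \<and> y \<in> lattice \<and> (\<Sum>i\<in>UNIV. \<bar>x $ i - y $ i\<bar>) = 1}"

text \<open>A path is given by the nonempty list of its vertices; the one-vertex path has no edges.\<close>

definition lattice_path :: "(real^'n) list \<Rightarrow> bool" where
  "lattice_path xs \<longleftrightarrow>
     xs \<noteq> [] \<and> set xs \<subseteq> lattice \<and> successively (\<lambda>x y. {x, y} \<in> edges) xs"

definition path_time :: "((real^'n) set \<Rightarrow> real) \<Rightarrow> (real^'n) list \<Rightarrow> real" where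
  "path_time w xs = (\<Sum>i<length xs - 1. w {xs ! i, xs ! Suc i})"

definition passage_time :: "((real^'n) set \<Rightarrow> real) \<Rightarrow> real^'n \<Rightarrow> real^'n \<Rightarrow> real" where
  "passage_time w x y = Inf {path_time w xs | xs. lattice_path xs \<and> hd xs = x \<and> last xs = y}"

definition passage_ball :: "((real^'n) set \<Rightarrow> real) \<Rightarrow> real \<Rightarrow> (real^'n) set" where
  "passage_ball w t = {y \<in> lattice. passage_time w 0 y < t}"

definition scaled_ball :: "((real^'n) set \<Rightarrow> real) \<Rightarrow> real \<Rightarrow> (real^'n) set" where
  "scaled_ball w t = (\<lambda>y. y /\<^sub>R t) ` passage_ball w t"

text \<open>For \<open>t > 0\<close> this gives \<open>scaled_dist w t (x /\<^sub>R t) (y /\<^sub>R t) = passage_time w x y / t\<close>.\<close>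

definition scaled_dist :: "((real^'n) set \<Rightarrow> real) \<Rightarrow> real \<Rightarrow> real^'n \<Rightarrow> real^'n \<Rightarrow> real" where
  "scaled_dist w t u v = passage_time w (t *\<^sub>R u) (t *\<^sub>R v) / t"

definition is_norm :: "('v::real_vector \<Rightarrow> real) \<Rightarrow> bool" where
  "is_norm N \<longleftrightarrow>
     (\<forall>x. N x = 0 \<longleftrightarrow> x = 0) \<and>
     (\<forall>x y. N (x + y) \<le> N x + N y) \<and>
     (\<forall>c x. N (c *\<^sub>R x) = \<bar>c\<bar> * N x)"

text \<open>The norm on the whole space that extends the almost sure limits at lattice points.
  It is unique, because a norm is determined by its values on the lattice.\<close>

definition time_norm :: "'w measure \<Rightarrow> ((real^'n) set \<Rightarrow> 'w \<Rightarrow> real) \<Rightarrow> real^'n \<Rightarrow> real" where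
  "time_norm M \<tau> = (THE N. is_norm N \<and>
     (\<forall>x\<in>lattice. AE \<omega> in M.
        (\<lambda>n::nat. passage_time (\<lambda>e. \<tau> e \<omega>) 0 (real n *\<^sub>R x) / real n) \<longlonglongrightarrow> N x))"

definition limit_shape :: "'w measure \<Rightarrow> ((real^'n) set \<Rightarrow> 'w \<Rightarrow> real) \<Rightarrow> (real^'n) set" where
  "limit_shape M \<tau> = {x. time_norm M \<tau> x \<le> 1}"

definition limit_dist :: "'w measure \<Rightarrow> ((real^'n) set \<Rightarrow> 'w \<Rightarrow> real) \<Rightarrow> real^'n \<Rightarrow> real^'n \<Rightarrow> real" where
  "limit_dist M \<tau> s s' = time_norm M \<tau> (s - s')"

definition frechet_means :: "'a set \<Rightarrow> ('a \<Rightarrow> 'a \<Rightarrow> real) \<Rightarrow> 'a measure \<Rightarrow> 'a set" where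
  "frechet_means Y \<rho> \<nu> =
     {x \<in> Y. \<forall>z\<in>Y. (LINT y:Y|\<nu>. (\<rho> x y)\<^sup>2) \<le> (LINT y:Y|\<nu>. (\<rho> z y)\<^sup>2)}"

definition ball_frechet_means :: "((real^'n) set \<Rightarrow> real) \<Rightarrow> real \<Rightarrow> (real^'n) set" where
  "ball_frechet_means w t =
     frechet_means (scaled_ball w t) (scaled_dist w t) (uniform_count_measure (scaled_ball w t))"

definition limit_frechet_means :: "'w measure \<Rightarrow> ((real^'n) set \<Rightarrow> 'w \<Rightarrow> real) \<Rightarrow> (real^'n) set" where
  "limit_frechet_means M \<tau> =
     frechet_means (limit_shape M \<tau>) (limit_dist M \<tau>) (uniform_measure lborel (limit_shape M \<tau>))"

end

theory Submission
  imports Defs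
begin

text \<open>
  Paths with at most \<open>k\<close> edges suffice at scale \<open>k\<close>: by a Chernoff bound and path counting, all
  simple paths with \<open>m\<close> edges take time at least \<open>\<delta> m\<close> (this uses \<open>P(\<tau> = 0) = 0\<close>), while points at
  distance \<open>m\<close> are joined within time \<open>C m\<close>. The passage time restricted to such paths is a minimum
  of finitely many sums, so the Efron--Stein inequality bounds its variance by \<open>k E \<tau>\<^sup>2\<close>: resampling
  one edge can increase the minimum only if the edge lies on the minimizing path. Along the scales
  \<open>2^j\<close>, Chebyshev's inequality and Borel--Cantelli give almost sure convergence of
  \<open>T(2^j z, 2^j z') / 2^j\<close> for all lattice points \<open>z, z'\<close> simultaneously. The rest is deterministic:
  these limits together with the linear upper bound give \<open>T(x, y) = \<parallel>x - y\<parallel> + o(t)\<close> uniformly for \<open>x, y\<close>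
  of size \<open>O(t)\<close>. Hence the discrete energies converge, as Riemann sums, to the energy on the limit
  shape along convergent sequences of base points, and every limit point of the means
  minimizes the limit energy.
\<close>

section \<open>The Efron--Stein inequality\<close>

text \<open>The two linear bounds play against each other: a path with more than \<open>L\<close>
  times as many edges as the distance scale, where \<open>L\<close> is at least
  \<open>C / \<delta>\<close>, costs at least as much as the upper bound for short paths, so
  restricting the number of edges changes nothing at large scales. At scale \<open>2 ^ j\<close> the
  variance is of order \<open>2 ^ j\<close> and Chebyshev's bound of order \<open>2 ^ -j\<close>;
  this summability dictates geometric scales. The means need no ergodic theorem: concatenation and
  translation invariance give \<open>e (j + 1) \<le> 2 * e j\<close>. The price is that the limit on
  lattice points is at first known to respect only doubling; full homogeneity, the extension to the
  whole space and limits along all integers are recovered afterwards. Almost sure facts are packed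
  into the locale \<open>good_weights\<close>, inside which one outcome is fixed. In the last part
  the boundary is the obstacle: membership of rounded points in the scaled ball is decided in the
  limit only off the unit sphere, which is null, and only points of norm less than 1 are sure to be
  admissible competitors.\<close>

lemma (in prob_space) integrable_bounded:
  fixes f :: "'a \<Rightarrow> real"
  assumes "f \<in> borel_measurable M" "\<And>x. \<bar>f x\<bar> \<le> B"
  shows "integrable M f"
  by (rule integrable_const_bound[where B=B]) (use assms in auto)

text \<open>With an independent copy \<open>y\<close> of \<open>x\<close>, twice the variance is the
  mean of \<open>(g y - g x)^2\<close>. Increases and decreases contribute equally, by exchanging
  the copies, so the increases alone carry exactly the variance.\<close>

lemma (in prob_space) variance_eq_pos_increments:
  fixes g :: "'a \<Rightarrow> real"
  assumes [measurable]: "g \<in> borel_measurable M" and B: "\<And>x. \<bar>g x\<bar> \<le> B"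
  shows "ennreal ((\<integral>x. (g x)^2 \<partial>M) - (\<integral>x. g x \<partial>M)^2) =
    (\<integral>\<^sup>+x. \<integral>\<^sup>+y. ennreal ((max 0 (g y - g x))^2) \<partial>M \<partial>M)" (is "ennreal ?V = ?I")
proof -
  interpret pair_sigma_finite M M ..
  have B2: "\<bar>(g x)^2\<bar> \<le> B^2" for x
    using B[of x] by (metis abs_ge_zero power2_abs power_mono abs_power2)
  have ig[simp]: "integrable M g" "integrable M (\<lambda>x. (g x)^2)"
    by (rule integrable_bounded[OF _ B] integrable_bounded[OF _ B2]; simp)+
  have "(\<integral>\<^sup>+x. \<integral>\<^sup>+y. ennreal ((g y - g x)^2) \<partial>M \<partial>M) =
      (\<integral>\<^sup>+x. ennreal ((\<integral>y. (g y)^2 \<partial>M) - 2 * g x * (\<integral>y. g y \<partial>M) + (g x)^2) \<partial>M)"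
  proof (rule nn_integral_cong)
    fix x
    have "(\<integral>\<^sup>+y. ennreal ((g y - g x)^2) \<partial>M) = ennreal (\<integral>y. (g y - g x)^2 \<partial>M)"
      proof (rule nn_integral_eq_integral)
        show "integrable M (\<lambda>y. (g y - g x)^2)" by (simp add: power2_diff)
      qed simp
    also have "(\<integral>y. (g y - g x)^2 \<partial>M) = (\<integral>y. (g y)^2 \<partial>M) - 2 * g x * (\<integral>y. g y \<partial>M) + (g x)^2"
      by (simp add: power2_diff prob_space mult_ac)
    finally show "(\<integral>\<^sup>+y. ennreal ((g y - g x)^2) \<partial>M) =
      ennreal ((\<integral>y. (g y)^2 \<partial>M) - 2 * g x * (\<integral>y. g y \<partial>M) + (g x)^2)" .
  qed
  also have "\<dots> = ennreal (\<integral>x. (\<integral>y. (g y)^2 \<partial>M) - 2 * g x * (\<integral>y. g y \<partial>M) + (g x)^2 \<partial>M)"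
  proof (rule nn_integral_eq_integral)
    have "0 \<le> (\<integral>y. (g y - g x)^2 \<partial>M)" for x by simp
    also have "(\<integral>y. (g y - g x)^2 \<partial>M) = (\<integral>y. (g y)^2 \<partial>M) - 2 * g x * (\<integral>y. g y \<partial>M) + (g x)^2" for x
      by (simp add: power2_diff prob_space mult_ac)
    finally show "AE x in M. 0 \<le> (\<integral>y. (g y)^2 \<partial>M) - 2 * g x * (\<integral>y. g y \<partial>M) + (g x)^2" by simp
  qed auto
  also have "(\<integral>x. (\<integral>y. (g y)^2 \<partial>M) - 2 * g x * (\<integral>y. g y \<partial>M) + (g x)^2 \<partial>M) = 2 * ?V"
    by (simp add: prob_space) (simp add: power2_eq_square)
  also have "ennreal (2 * ?V) = 2 * ennreal ?V"
    by (subst ennreal_mult') auto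
  finally have 1: "(\<integral>\<^sup>+x. \<integral>\<^sup>+y. ennreal ((g y - g x)^2) \<partial>M \<partial>M) = 2 * ennreal ?V" .
  have "ennreal ((g y - g x)^2) = ennreal ((max 0 (g y - g x))^2) + ennreal ((max 0 (g x - g y))^2)" for x y
    by (subst ennreal_plus[symmetric]) (auto simp: max_def power2_commute)
  then have "(\<integral>\<^sup>+x. \<integral>\<^sup>+y. ennreal ((g y - g x)^2) \<partial>M \<partial>M) =
      ?I + (\<integral>\<^sup>+x. \<integral>\<^sup>+y. ennreal ((max 0 (g x - g y))^2) \<partial>M \<partial>M)"
    by (simp add: nn_integral_add)
  also have "(\<integral>\<^sup>+x. \<integral>\<^sup>+y. ennreal ((max 0 (g x - g y))^2) \<partial>M \<partial>M) = ?I"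
    by (rule Fubini') measurable
  finally have "2 * ennreal ?V = ?I * 2"
    using 1 by (simp add: mult_2_right)
  then show ?thesis
    by (simp add: mult.commute[of _ 2] ennreal_mult_cancel_left)
qed

lemma (in prob_space) square_expectation_le:
  fixes f :: "'a \<Rightarrow> real"
  assumes "integrable M f" "integrable M (\<lambda>x. (f x)^2)"
  shows "(expectation f)^2 \<le> expectation (\<lambda>x. (f x)^2)"
  using variance_eq[OF assms] variance_positive[of f] by linarith

text \<open>Only increases count on the right: for a minimum of sums, an increase after resampling \<open>i\<close> forces \<open>i\<close>
  to lie in the minimizing sum, whereas a decrease does not.\<close>

lemma (in product_prob_space) efron_stein:
  fixes f :: "('i \<Rightarrow> 'a) \<Rightarrow> real"
  assumes "finite J" "f \<in> borel_measurable (PiM J M)" "\<And>x. \<bar>f x\<bar> \<le> B"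
  shows "ennreal ((\<integral>x. (f x)^2 \<partial>PiM J M) - (\<integral>x. f x \<partial>PiM J M)^2)
    \<le> (\<Sum>i\<in>J. \<integral>\<^sup>+x. \<integral>\<^sup>+y. ennreal ((max 0 (f (x(i:=y)) - f x))^2) \<partial>M i \<partial>PiM J M)"
  using assms
proof (induction J arbitrary: f rule: finite_induct)
  case empty
  then show ?case
    by (simp add: PiM_empty lebesgue_integral_count_space_finite)
next
  case (insert i J)
  note [measurable] = insert.prems(1)
  note fin = insert.hyps(1) and iJ = insert.hyps(2)
  have fB: "\<And>x. \<bar>f x\<bar> \<le> B" by fact
  have pi: "prob_space (M i)" by (rule prob_space)
  interpret PJ: prob_space "PiM J M" by (rule prob_space_PiM) (rule prob_space)
  interpret PI: prob_space "PiM (insert i J) M" by (rule prob_space_PiM) (rule prob_space)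
  have fB2: "\<bar>(f x)^2\<bar> \<le> B^2" for x
    using fB[of x] by (metis abs_ge_zero power2_abs power_mono abs_power2)
  have upd[measurable]: "(\<lambda>(x,y). x(i:=y)) \<in> measurable (PiM J M \<Otimes>\<^sub>M M i) (PiM (insert i J) M)"
    by (rule measurable_add_dim)
  have f1[measurable]: "(\<lambda>(x,y). f (x(i:=y))) \<in> borel_measurable (PiM J M \<Otimes>\<^sub>M M i)"
    using measurable_compose[OF upd insert.prems(1)] by (simp add: case_prod_beta')
  have f2[measurable]: "(\<lambda>y. f (x(i:=y))) \<in> borel_measurable (M i)" if "x \<in> space (PiM J M)" for x
    using measurable_compose[OF measurable_Pair1'[OF that] f1] by simp
  \<comment> \<open>Averaging out the new coordinate splits the variance of \<open>f\<close> into
    the mean of \<open>q - g^2\<close>, which is the summand for \<open>i\<close>, and the variance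
    of \<open>g\<close>, which the induction hypothesis controls.\<close>
  define g where "g x = (\<integral>y. f (x(i:=y)) \<partial>M i)" for x
  have [measurable]: "g \<in> borel_measurable (PiM J M)"
    unfolding g_def by measurable
  have gB: "\<bar>g x\<bar> \<le> B" for x
  \<comment> \<open>The induction hypothesis asks for the bound at every argument, also outside the
    product space, where the section may fail to be integrable; the integral is then 0 by
    convention.\<close>
  proof (cases "integrable (M i) (\<lambda>y. f (x(i:=y)))")
    case True
    have "\<bar>g x\<bar> \<le> (\<integral>y. \<bar>f (x(i:=y))\<bar> \<partial>M i)" unfolding g_def by (rule integral_abs_bound)
    also have "\<dots> \<le> (\<integral>y. B \<partial>M i)" using True fB by (intro integral_mono) auto
    finally show ?thesis by (simp add: prob_space.prob_space[OF pi])
  next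
    case False
    then show ?thesis using fB[of x] by (simp add: g_def not_integrable_integral_eq)
  qed
  have gB2: "\<bar>(g x)^2\<bar> \<le> B^2" for x
    using gB[of x] by (metis abs_ge_zero power2_abs power_mono abs_power2)
  have if1: "integrable (PiM (insert i J) M) f" "integrable (PiM (insert i J) M) (\<lambda>x. (f x)^2)"
    by (rule PI.integrable_bounded[OF _ fB] PI.integrable_bounded[OF _ fB2]; measurable)+
  have ig: "integrable (PiM J M) g" "integrable (PiM J M) (\<lambda>x. (g x)^2)"
    by (rule PJ.integrable_bounded[OF _ gB] PJ.integrable_bounded[OF _ gB2]; measurable)+
  define q where "q x = (\<integral>y. (f (x(i:=y)))^2 \<partial>M i)" for x
  have [measurable]: "q \<in> borel_measurable (PiM J M)"
    unfolding q_def by measurable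
  have ify: "integrable (M i) (\<lambda>y. f (x(i:=y)))" "integrable (M i) (\<lambda>y. (f (x(i:=y)))^2)"
    if "x \<in> space (PiM J M)" for x
    by (rule prob_space.integrable_bounded[OF pi _ fB] prob_space.integrable_bounded[OF pi _ fB2]; use that in measurable)+
  have qB: "\<bar>q x\<bar> \<le> B^2" if "x \<in> space (PiM J M)" for x
  proof -
    have "\<bar>q x\<bar> \<le> (\<integral>y. \<bar>(f (x(i:=y)))^2\<bar> \<partial>M i)" unfolding q_def by (rule integral_abs_bound)
    also have "\<dots> \<le> (\<integral>y. B^2 \<partial>M i)" using ify[OF that] fB2 by (intro integral_mono) auto
    finally show ?thesis by (simp add: prob_space.prob_space[OF pi])
  qed
  have iq: "integrable (PiM J M) q"
    by (rule PJ.integrable_const_bound[where B="B^2"]) (use qB in auto)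
  have gq: "(g x)^2 \<le> q x" if "x \<in> space (PiM J M)" for x
    unfolding g_def q_def by (rule prob_space.square_expectation_le[OF pi]) (use ify that in auto)
  have If: "(\<integral>x. f x \<partial>PiM (insert i J) M) = (\<integral>x. g x \<partial>PiM J M)"
    unfolding g_def by (rule product_integral_insert[OF fin iJ if1(1)])
  have If2: "(\<integral>x. (f x)^2 \<partial>PiM (insert i J) M) = (\<integral>x. q x \<partial>PiM J M)"
    unfolding q_def by (rule product_integral_insert[OF fin iJ if1(2)])
  let ?F = "\<lambda>j z y. ennreal ((max 0 (f (z(j:=y)) - f z))^2)"
  have upd'[measurable]: "(\<lambda>(x,y). x(j:=y)) \<in> measurable (PiM K M \<Otimes>\<^sub>M M j) (PiM K M)"
    if "j \<in> K" for j K
    using measurable_add_dim[of j K M] that by (simp add: insert_absorb)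
  have Fm[measurable]: "(\<lambda>(x,y). ?F j x y) \<in> borel_measurable (PiM (insert i J) M \<Otimes>\<^sub>M M j)"
    if "j \<in> insert i J" for j
  proof -
    have [measurable]: "(\<lambda>(x,y). f (x(j:=y))) \<in> borel_measurable (PiM (insert i J) M \<Otimes>\<^sub>M M j)"
      using measurable_compose[OF upd'[OF that] insert.prems(1)] by (simp add: case_prod_beta' fun_upd_def)
    then show ?thesis by (simp add: case_prod_beta')
  qed
  have "ennreal ((\<integral>x. q x \<partial>PiM J M) - (\<integral>x. (g x)^2 \<partial>PiM J M)) = ennreal (\<integral>x. q x - (g x)^2 \<partial>PiM J M)"
    using iq ig by simp
  also have "\<dots> = (\<integral>\<^sup>+x. ennreal (q x - (g x)^2) \<partial>PiM J M)"
    by (rule nn_integral_eq_integral[symmetric]) (use iq ig gq in auto)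
  also have "\<dots> = (\<integral>\<^sup>+x. \<integral>\<^sup>+y. \<integral>\<^sup>+y'. ?F i (x(i:=y)) y' \<partial>M i \<partial>M i \<partial>PiM J M)"
  proof (rule nn_integral_cong)
    fix x assume "x \<in> space (PiM J M)"
    then show "ennreal (q x - (g x)^2) = (\<integral>\<^sup>+y. \<integral>\<^sup>+y'. ?F i (x(i:=y)) y' \<partial>M i \<partial>M i)"
      unfolding q_def g_def by (subst prob_space.variance_eq_pos_increments[OF pi _ fB]) auto
  qed
  also have "\<dots> = (\<integral>\<^sup>+z. \<integral>\<^sup>+y'. ?F i z y' \<partial>M i \<partial>PiM (insert i J) M)"
    by (rule product_nn_integral_insert[symmetric, OF fin iJ]) measurable
  finally have A: "ennreal ((\<integral>x. q x \<partial>PiM J M) - (\<integral>x. (g x)^2 \<partial>PiM J M)) =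
    (\<integral>\<^sup>+z. \<integral>\<^sup>+y'. ?F i z y' \<partial>M i \<partial>PiM (insert i J) M)" .
  \<comment> \<open>The increment of \<open>g\<close> is the mean over coordinate \<open>i\<close>
    of the increments of \<open>f\<close>. Taking positive parts and then Jensen for the square
    shows that averaging can only lower the contribution of \<open>j\<close>.\<close>
  have B': "(\<integral>\<^sup>+x. \<integral>\<^sup>+z. ennreal ((max 0 (g (x(j:=z)) - g x))^2) \<partial>M j \<partial>PiM J M)
      \<le> (\<integral>\<^sup>+x. \<integral>\<^sup>+z. ?F j x z \<partial>M j \<partial>PiM (insert i J) M)" if j: "j \<in> J" for j
  proof -
    have ji: "j \<noteq> i" using j iJ by auto
    interpret ij: pair_sigma_finite "M i" "M j" ..
    have "(\<integral>\<^sup>+x. \<integral>\<^sup>+z. ennreal ((max 0 (g (x(j:=z)) - g x))^2) \<partial>M j \<partial>PiM J M)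
      \<le> (\<integral>\<^sup>+x. \<integral>\<^sup>+z. \<integral>\<^sup>+y. ?F j (x(i:=y)) z \<partial>M i \<partial>M j \<partial>PiM J M)"
    proof (intro nn_integral_mono)
      fix x z assume x: "x \<in> space (PiM J M)" and z: "z \<in> space (M j)"
      have xz: "x(j:=z) \<in> space (PiM J M)"
        using x z j by (auto simp: space_PiM PiE_iff extensional_def)
      let ?a = "\<lambda>y. f ((x(j:=z))(i:=y)) - f (x(i:=y))"
      have aB: "\<bar>?a y\<bar> \<le> 2 * B" for y
        using fB[of "(x(j:=z))(i:=y)"] fB[of "x(i:=y)"] by linarith
      have ia: "integrable (M i) ?a" using ify[OF x] ify[OF xz] by auto
      have im: "integrable (M i) (\<lambda>y. max 0 (?a y))" using ia by auto
      have im2: "integrable (M i) (\<lambda>y. (max 0 (?a y))^2)"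
      proof (rule prob_space.integrable_bounded[OF pi, where B="(2*B)^2"])
        fix y
        have "(max 0 (?a y))^2 \<le> (2*B)^2"
          using aB[of y] by (intro power_mono) auto
        then show "\<bar>(max 0 (?a y))^2\<bar> \<le> (2*B)^2" by simp
      qed (use im in auto)
      have "g (x(j:=z)) - g x = (\<integral>y. ?a y \<partial>M i)"
        unfolding g_def using ify[OF x] ify[OF xz] by simp
      also have "\<dots> \<le> (\<integral>y. max 0 (?a y) \<partial>M i)"
        by (rule integral_mono[OF ia im]) auto
      finally have "max 0 (g (x(j:=z)) - g x) \<le> (\<integral>y. max 0 (?a y) \<partial>M i)"
        by (auto intro: integral_nonneg)
      then have "(max 0 (g (x(j:=z)) - g x))^2 \<le> (\<integral>y. max 0 (?a y) \<partial>M i)^2"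
        by (rule power_mono) auto
      also have "\<dots> \<le> (\<integral>y. (max 0 (?a y))^2 \<partial>M i)"
        by (rule prob_space.square_expectation_le[OF pi im im2])
      finally have "ennreal ((max 0 (g (x(j:=z)) - g x))^2) \<le> ennreal (\<integral>y. (max 0 (?a y))^2 \<partial>M i)"
        by (rule ennreal_leI)
      also have "\<dots> = (\<integral>\<^sup>+y. ennreal ((max 0 (?a y))^2) \<partial>M i)"
        by (rule nn_integral_eq_integral[symmetric, OF im2]) auto
      also have "\<dots> = (\<integral>\<^sup>+y. ?F j (x(i:=y)) z \<partial>M i)"
        using ji by (simp add: fun_upd_twist)
      finally show "ennreal ((max 0 (g (x(j:=z)) - g x))^2) \<le> (\<integral>\<^sup>+y. ?F j (x(i:=y)) z \<partial>M i)" .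
    qed
    also have "\<dots> = (\<integral>\<^sup>+x. \<integral>\<^sup>+y. \<integral>\<^sup>+z. ?F j (x(i:=y)) z \<partial>M j \<partial>M i \<partial>PiM J M)"
    proof (rule nn_integral_cong)
      fix x assume x: "x \<in> space (PiM J M)"
      have [measurable]: "(\<lambda>y. x(i:=y)) \<in> measurable (M i) (PiM (insert i J) M)"
        using measurable_compose[OF measurable_Pair1'[OF x] upd] by simp
      have "(\<lambda>(y,z). (x(i:=y), z)) \<in> measurable (M i \<Otimes>\<^sub>M M j) (PiM (insert i J) M \<Otimes>\<^sub>M M j)"
        by measurable
      from measurable_compose[OF this Fm] j
      have "(\<lambda>(y,z). ?F j (x(i:=y)) z) \<in> borel_measurable (M i \<Otimes>\<^sub>M M j)"
        by (simp add: case_prod_beta')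
      from ij.Fubini'[OF this]
      show "(\<integral>\<^sup>+z. \<integral>\<^sup>+y. ?F j (x(i:=y)) z \<partial>M i \<partial>M j) = (\<integral>\<^sup>+y. \<integral>\<^sup>+z. ?F j (x(i:=y)) z \<partial>M j \<partial>M i)" .
    qed
    also have "\<dots> = (\<integral>\<^sup>+x. \<integral>\<^sup>+z. ?F j x z \<partial>M j \<partial>PiM (insert i J) M)"
    proof (rule product_nn_integral_insert[symmetric, OF fin iJ])
      show "(\<lambda>x. \<integral>\<^sup>+z. ?F j x z \<partial>M j) \<in> borel_measurable (PiM (insert i J) M)"
        by (rule sigma_finite_measure.borel_measurable_nn_integral[OF prob_space_imp_sigma_finite[OF prob_space] Fm])
          (use j in simp)
    qed
    finally show ?thesis .
  qed
  have "ennreal ((\<integral>x. (f x)^2 \<partial>PiM (insert i J) M) - (\<integral>x. f x \<partial>PiM (insert i J) M)^2) =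
    ennreal (((\<integral>x. q x \<partial>PiM J M) - (\<integral>x. (g x)^2 \<partial>PiM J M)) + ((\<integral>x. (g x)^2 \<partial>PiM J M) - (\<integral>x. g x \<partial>PiM J M)^2))"
    unfolding If If2 by simp
  also have "\<dots> = ennreal ((\<integral>x. q x \<partial>PiM J M) - (\<integral>x. (g x)^2 \<partial>PiM J M)) + ennreal ((\<integral>x. (g x)^2 \<partial>PiM J M) - (\<integral>x. g x \<partial>PiM J M)^2)"
    using PJ.square_expectation_le[OF ig] integral_mono[OF ig(2) iq gq]
    by (intro ennreal_plus) auto
  also have "\<dots> \<le> (\<integral>\<^sup>+z. \<integral>\<^sup>+y'. ?F i z y' \<partial>M i \<partial>PiM (insert i J) M) +
     (\<Sum>j\<in>J. \<integral>\<^sup>+x. \<integral>\<^sup>+y. ?F j x y \<partial>M j \<partial>PiM (insert i J) M)"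
    unfolding A
    by (intro add_mono order_refl order_trans[OF insert.IH] sum_mono B' gB) auto
  finally show ?case unfolding sum.insert[OF fin iJ] .
qed

section \<open>Variance of a minimum of sums over small index sets\<close>

lemma borel_measurable_Min_image:
  fixes g :: "'b \<Rightarrow> 'a \<Rightarrow> real"
  assumes "finite A" "A \<noteq> {}" "\<And>a. a \<in> A \<Longrightarrow> g a \<in> borel_measurable M"
  shows "(\<lambda>x. Min ((\<lambda>a. g a x) ` A)) \<in> borel_measurable M"
  using assms
proof (induction A rule: finite_ne_induct)
  case (insert a A)
  then have "(\<lambda>x. min (g a x) (Min ((\<lambda>a. g a x) ` A))) \<in> borel_measurable M"
    by (intro borel_measurable_min) auto
  then show ?case using insert.hyps by simp
qed auto

text \<open>For each \<open>w\<close> fix a set \<open>P\<close> attaining the minimum. Its sum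
  still bounds the minimum after resampling, so only the at most \<open>k\<close> indices in
  \<open>P\<close> can cause an increase, each by at most the new value. Neither the size of
  \<open>J\<close> nor the number of sets enters.\<close>

lemma variance_Min_sum_le:
  fixes M :: "real measure" and \<P> :: "'i set set" and k :: nat
  assumes "prob_space M" and sets[measurable_cong]: "sets M = sets borel"
    and J: "finite J" and P: "finite \<P>" "\<P> \<noteq> {}" "\<And>P. P \<in> \<P> \<Longrightarrow> P \<subseteq> J" "\<And>P. P \<in> \<P> \<Longrightarrow> card P \<le> k"
    and int: "integrable M (\<lambda>x. x^2)"
  defines "f \<equiv> \<lambda>w. Min ((\<lambda>P. \<Sum>i\<in>P. max 0 (w i)) ` \<P>)"
  shows "integrable (PiM J (\<lambda>_. M)) f" "integrable (PiM J (\<lambda>_. M)) (\<lambda>w. (f w)^2)"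
    "(\<integral>w. (f w)^2 \<partial>PiM J (\<lambda>_. M)) - (\<integral>w. f w \<partial>PiM J (\<lambda>_. M))^2 \<le> k * (\<integral>x. x^2 \<partial>M)"
proof -
  interpret prob_space M by fact
  interpret P: product_prob_space "\<lambda>_. M" J ..
  have PJ: "prob_space (PiM J (\<lambda>_. M))" by (rule prob_space_PiM) (rule prob_space_axioms)
  have fin: "finite P" if "P \<in> \<P>" for P using P(3)[OF that] J finite_subset by blast
  have f_nonneg: "0 \<le> f w" for w
    unfolding f_def using P by (subst Min_ge_iff) (auto intro!: sum_nonneg)
  have f_le: "f w \<le> (\<Sum>i\<in>P. max 0 (w i))" if "P \<in> \<P>" for P w
    unfolding f_def using P that by (intro Min_le) auto
  have f_meas[measurable]: "f \<in> borel_measurable (PiM J (\<lambda>_. M))"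
  proof -
    have "(\<lambda>w. \<Sum>i\<in>P. max 0 (w i)) \<in> borel_measurable (PiM J (\<lambda>_. M))" if "P \<in> \<P>" for P
    proof (rule borel_measurable_sum)
      fix i assume "i \<in> P"
      then have "(\<lambda>w. w i) \<in> measurable (PiM J (\<lambda>_. M)) M"
        using P(3)[OF that] by (intro measurable_component_singleton) auto
      then have "(\<lambda>w. w i) \<in> borel_measurable (PiM J (\<lambda>_. M))"
        by (simp add: measurable_cong_sets[OF refl sets])
      then show "(\<lambda>w. max 0 (w i)) \<in> borel_measurable (PiM J (\<lambda>_. M))" by measurable
    qed
    then show ?thesis unfolding f_def by (rule borel_measurable_Min_image[OF P(1,2)])
  qed
  \<comment> \<open>\<open>efron_stein\<close> needs a bounded function. Truncation at
    \<open>L\<close> keeps the estimate on increases, with a bound free of \<open>L\<close>, and is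
    removed at the end by dominated convergence.\<close>
  define fL where "fL L w = min (real L) (f w)" for L w
  have fL_meas[measurable]: "fL L \<in> borel_measurable (PiM J (\<lambda>_. M))" for L
    unfolding fL_def by measurable
  have fL_bound: "\<bar>fL L w\<bar> \<le> real L" for L w
    unfolding fL_def using f_nonneg[of w] by auto
  have fL_le: "\<bar>fL L w\<bar> \<le> f w" for L w
    unfolding fL_def using f_nonneg[of w] by auto
  have incr: "(max 0 (fL L (w(i:=y)) - fL L w))^2 \<le> (if i \<in> P then y^2 else 0)"
    if "P \<in> \<P>" "f w = (\<Sum>i\<in>P. max 0 (w i))" for L w i y P
  proof -
    have "f (w(i:=y)) \<le> (\<Sum>j\<in>P. max 0 ((w(i:=y)) j))" by (rule f_le[OF that(1)])
    also have "\<dots> \<le> (\<Sum>j\<in>P. max 0 (w j) + (if j = i then max 0 y else 0))"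
      by (intro sum_mono) auto
    also have "\<dots> = f w + (if i \<in> P then max 0 y else 0)"
      using fin[OF that(1)] that(2) by (simp add: sum.distrib)
    finally have "max 0 (fL L (w(i:=y)) - fL L w) \<le> (if i \<in> P then max 0 y else 0)"
      unfolding fL_def by (auto split: if_splits)
    then have "(max 0 (fL L (w(i:=y)) - fL L w))^2 \<le> (if i \<in> P then max 0 y else 0)^2"
      by (intro power_mono) auto
    also have "\<dots> \<le> (if i \<in> P then y^2 else 0)" by (auto simp: max_def)
    finally show ?thesis .
  qed
  have varL: "(\<integral>w. (fL L w)^2 \<partial>PiM J (\<lambda>_. M)) - (\<integral>w. fL L w \<partial>PiM J (\<lambda>_. M))^2 \<le> k * (\<integral>x. x^2 \<partial>M)" for L
  proof -
    have m: "(\<lambda>w. \<integral>\<^sup>+y. ennreal ((max 0 (fL L (w(i:=y)) - fL L w))^2) \<partial>M) \<in> borel_measurable (PiM J (\<lambda>_. M))"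
      if "i \<in> J" for i
    proof -
      have "(\<lambda>(x,y). x(i:=y)) \<in> measurable (PiM J (\<lambda>_. M) \<Otimes>\<^sub>M M) (PiM J (\<lambda>_. M))"
        using measurable_add_dim[of i J "\<lambda>_. M"] that by (simp add: insert_absorb)
      from measurable_compose[OF this fL_meas]
      have [measurable]: "(\<lambda>(x,y). fL L (x(i:=y))) \<in> borel_measurable (PiM J (\<lambda>_. M) \<Otimes>\<^sub>M M)"
        by (simp add: case_prod_beta' fun_upd_def)
      show ?thesis by measurable
    qed
    have "ennreal ((\<integral>w. (fL L w)^2 \<partial>PiM J (\<lambda>_. M)) - (\<integral>w. fL L w \<partial>PiM J (\<lambda>_. M))^2)
      \<le> (\<Sum>i\<in>J. \<integral>\<^sup>+w. \<integral>\<^sup>+y. ennreal ((max 0 (fL L (w(i:=y)) - fL L w))^2) \<partial>M \<partial>PiM J (\<lambda>_. M))"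
      by (rule P.efron_stein[OF J fL_meas fL_bound])
    also have "\<dots> = (\<integral>\<^sup>+w. (\<Sum>i\<in>J. \<integral>\<^sup>+y. ennreal ((max 0 (fL L (w(i:=y)) - fL L w))^2) \<partial>M) \<partial>PiM J (\<lambda>_. M))"
      by (rule nn_integral_sum[symmetric]) (rule m)
    also have "\<dots> \<le> (\<integral>\<^sup>+w. ennreal (k * (\<integral>x. x^2 \<partial>M)) \<partial>PiM J (\<lambda>_. M))"
    proof (rule nn_integral_mono)
      fix w
      have "f w \<in> (\<lambda>P. \<Sum>i\<in>P. max 0 (w i)) ` \<P>"
        unfolding f_def using P by (intro Min_in) auto
      then obtain P where PP: "P \<in> \<P>" "f w = (\<Sum>i\<in>P. max 0 (w i))" by auto
      have "(\<Sum>i\<in>J. \<integral>\<^sup>+y. ennreal ((max 0 (fL L (w(i:=y)) - fL L w))^2) \<partial>M)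
         \<le> (\<Sum>i\<in>J. if i \<in> P then ennreal (\<integral>x. x^2 \<partial>M) else 0)"
      proof (rule sum_mono)
        fix i
        have "(\<integral>\<^sup>+y. ennreal ((max 0 (fL L (w(i:=y)) - fL L w))^2) \<partial>M) \<le>
            (\<integral>\<^sup>+y. ennreal (if i \<in> P then y^2 else 0) \<partial>M)"
          by (intro nn_integral_mono ennreal_leI incr[OF PP])
        also have "\<dots> = (if i \<in> P then ennreal (\<integral>x. x^2 \<partial>M) else 0)"
          using nn_integral_eq_integral[OF int] by simp
        finally show "(\<integral>\<^sup>+y. ennreal ((max 0 (fL L (w(i:=y)) - fL L w))^2) \<partial>M) \<le>
            (if i \<in> P then ennreal (\<integral>x. x^2 \<partial>M) else 0)" .
      qed
      also have "\<dots> = of_nat (card P) * ennreal (\<integral>x. x^2 \<partial>M)"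
        using J P(3)[OF PP(1)] by (simp add: sum.If_cases Int_absorb1)
      also have "\<dots> \<le> of_nat k * ennreal (\<integral>x. x^2 \<partial>M)"
        using P(4)[OF PP(1)] by (intro mult_right_mono) auto
      also have "\<dots> = ennreal (k * (\<integral>x. x^2 \<partial>M))"
        by (simp add: ennreal_mult' ennreal_of_nat_eq_real_of_nat)
      finally show "(\<Sum>i\<in>J. \<integral>\<^sup>+y. ennreal ((max 0 (fL L (w(i:=y)) - fL L w))^2) \<partial>M) \<le> ennreal (k * (\<integral>x. x^2 \<partial>M))" .
    qed
    also have "\<dots> = ennreal (k * (\<integral>x. x^2 \<partial>M))" by (simp add: prob_space.emeasure_space_1[OF PJ])
    finally show ?thesis by (subst (asm) ennreal_le_iff) (auto intro!: mult_nonneg_nonneg integral_nonneg)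
  qed
  obtain P0 where P0: "P0 \<in> \<P>" using P(2) by auto
  have comp: "integrable (PiM J (\<lambda>_. M)) (\<lambda>w. (w i)^2)" if "i \<in> J" for i
  proof -
    have d: "distr (PiM J (\<lambda>_. M)) M (\<lambda>w. w i) = M"
      using distr_PiM_component[of J "\<lambda>_. M" i] J that prob_space_axioms by auto
    have "integrable (distr (PiM J (\<lambda>_. M)) M (\<lambda>w. w i)) (\<lambda>x. x^2)" unfolding d by (rule int)
    then show ?thesis
      by (subst (asm) integrable_distr_eq) (use that in auto)
  qed
  have sq: "(f w)^2 \<le> card P0 * (\<Sum>i\<in>P0. (w i)^2)" for w :: "'i \<Rightarrow> real"
  proof -
    have "(f w)^2 \<le> (\<Sum>i\<in>P0. max 0 (w i))^2" by (rule power_mono[OF f_le[OF P0] f_nonneg])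
    also have "\<dots> \<le> card P0 * (\<Sum>i\<in>P0. (max 0 (w i))^2)"
      using sum_squared_le_sum_of_squares[of "\<lambda>i. max 0 (w i)" P0] by (simp add: mult.commute)
    also have "\<dots> \<le> card P0 * (\<Sum>i\<in>P0. (w i)^2)"
      by (intro mult_left_mono sum_mono) (auto simp: max_def)
    finally show ?thesis .
  qed
  show f2: "integrable (PiM J (\<lambda>_. M)) (\<lambda>w. (f w)^2)"
  proof (rule Bochner_Integration.integrable_bound)
    show "integrable (PiM J (\<lambda>_. M)) (\<lambda>w. card P0 * (\<Sum>i\<in>P0. (w i)^2))"
      using P(3)[OF P0] by (intro integrable_mult_right Bochner_Integration.integrable_sum comp) auto
  qed (use sq in \<open>auto intro!: AE_I2 order_trans[OF _ abs_ge_self]\<close>)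
  show f1: "integrable (PiM J (\<lambda>_. M)) f"
    by (rule finite_measure.square_integrable_imp_integrable[OF prob_space.finite_measure[OF PJ] f_meas f2])
  have lim: "(\<lambda>L. fL L w) \<longlonglongrightarrow> f w" for w
  proof (rule tendsto_eventually)
    show "\<forall>\<^sub>F L in sequentially. fL L w = f w"
      using eventually_ge_at_top[of "nat \<lceil>f w\<rceil>"]
      by eventually_elim (auto simp: fL_def min_def)
  qed
  have l1: "(\<lambda>L. \<integral>w. fL L w \<partial>PiM J (\<lambda>_. M)) \<longlonglongrightarrow> (\<integral>w. f w \<partial>PiM J (\<lambda>_. M))"
    by (rule integral_dominated_convergence[OF _ _ f1]) (use lim fL_le in auto)
  have l2: "(\<lambda>L. \<integral>w. (fL L w)^2 \<partial>PiM J (\<lambda>_. M)) \<longlonglongrightarrow> (\<integral>w. (f w)^2 \<partial>PiM J (\<lambda>_. M))"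
  proof (rule integral_dominated_convergence[OF _ _ f2])
    have "(fL L w)^2 \<le> (f w)^2" for L w
      using power_mono[OF fL_le, of L w 2] by simp
    then show "AE w in PiM J (\<lambda>_. M). norm ((fL L w)^2) \<le> (f w)^2" for L by auto
  qed (use lim in \<open>auto intro!: tendsto_intros\<close>)
  show "(\<integral>w. (f w)^2 \<partial>PiM J (\<lambda>_. M)) - (\<integral>w. f w \<partial>PiM J (\<lambda>_. M))^2 \<le> k * (\<integral>x. x^2 \<partial>M)"
    by (rule LIMSEQ_le_const2[OF tendsto_diff[OF l2 tendsto_power[OF l1]]]) (use varL in auto)
qed

section \<open>Lattice paths and passage times\<close>

definition l1 :: "real^'n \<Rightarrow> real" where
  "l1 x = (\<Sum>i\<in>UNIV. \<bar>x $ i\<bar>)"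

lemma l1_nonneg [simp]: "0 \<le> l1 x"
  by (simp add: l1_def sum_nonneg)

lemma l1_zero [simp]: "l1 0 = 0"
  by (simp add: l1_def)

lemma l1_eq_0_iff [simp]: "l1 x = 0 \<longleftrightarrow> x = 0"
  by (simp add: l1_def sum_nonneg_eq_0_iff vec_eq_iff)

lemma l1_uminus [simp]: "l1 (- x) = l1 x"
  by (simp add: l1_def)

lemma l1_minus_commute: "l1 (x - y) = l1 (y - x)"
  by (simp add: l1_def abs_minus_commute)

lemma l1_triangle: "l1 (x + y) \<le> l1 x + l1 y"
  unfolding l1_def sum.distrib[symmetric] by (intro sum_mono) (simp add: abs_triangle_ineq)

lemma l1_triangle_diff: "l1 (x - z) \<le> l1 (x - y) + l1 (y - z)"
  using l1_triangle[of "x - y" "y - z"] by simp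

lemma l1_scaleR [simp]: "l1 (c *\<^sub>R x) = \<bar>c\<bar> * l1 x"
  by (simp add: l1_def abs_mult sum_distrib_left)

lemma component_le_l1: "\<bar>x $ i\<bar> \<le> l1 x"
  unfolding l1_def by (intro member_le_sum) auto

lemma continuous_on_l1 [continuous_intros]:
  "continuous_on S f \<Longrightarrow> continuous_on S (\<lambda>x. l1 (f x :: real^'n))"
  unfolding l1_def by (intro continuous_intros)

lemma lattice_0 [simp]: "0 \<in> lattice"
  by (simp add: lattice_def)

lemma lattice_add: "x \<in> lattice \<Longrightarrow> y \<in> lattice \<Longrightarrow> x + y \<in> lattice"
  by (simp add: lattice_def)

lemma lattice_uminus: "x \<in> lattice \<Longrightarrow> - x \<in> lattice"
  by (simp add: lattice_def)

lemma lattice_diff: "x \<in> lattice \<Longrightarrow> y \<in> lattice \<Longrightarrow> x - y \<in> lattice"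
  by (simp add: lattice_def)

lemma lattice_scaleR: "x \<in> lattice \<Longrightarrow> c \<in> \<int> \<Longrightarrow> c *\<^sub>R x \<in> lattice"
  by (simp add: lattice_def)

lemma lattice_axis: "c \<in> \<int> \<Longrightarrow> axis i c \<in> lattice"
  by (simp add: lattice_def axis_def)

lemma lattice_add_iff: "v \<in> lattice \<Longrightarrow> v + x \<in> lattice \<longleftrightarrow> x \<in> lattice"
  using lattice_add[of v x] lattice_diff[of "v + x" v] by auto

lemma l1_lattice: "x \<in> lattice \<Longrightarrow> \<exists>d::nat. l1 x = real d"
proof -
  assume x: "x \<in> lattice"
  have "l1 x \<in> \<int>" unfolding l1_def using x by (intro Ints_sum Ints_abs) (auto simp: lattice_def)
  then show ?thesis using l1_nonneg[of x] by (metis Ints_cases of_int_0_le_iff of_int_of_nat_eq zero_le_imp_eq_int)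
qed

lemma finite_lattice_l1: "finite {x::real^'n. x \<in> lattice \<and> l1 x \<le> r}"
  and card_lattice_l1: "card {x::real^'n. x \<in> lattice \<and> l1 x \<le> real m} \<le> (2 * m + 1) ^ CARD('n)"
proof -
  have *: "{x::real^'n. x \<in> lattice \<and> l1 x \<le> real m} \<subseteq>
      (\<lambda>f. \<chi> i. real_of_int (f i)) ` (PiE UNIV (\<lambda>_. {- int m .. int m}))" (is "?A m \<subseteq> ?B m") for m
  proof
    fix x assume x: "x \<in> ?A m"
    have lattice_floor: "real_of_int \<lfloor>x $ i\<rfloor> = x $ i" for i using x by (auto simp: lattice_def elim: Ints_cases)
    have "- int m \<le> \<lfloor>x $ i\<rfloor> \<and> \<lfloor>x $ i\<rfloor> \<le> int m" for i
      using component_le_l1[of x i] x lattice_floor[of i] by (auto simp: abs_le_iff)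
    then show "x \<in> ?B m"
      by (intro image_eqI[of _ _ "\<lambda>i. \<lfloor>x $ i\<rfloor>"]) (auto simp: vec_eq_iff lattice_floor)
  qed
  have fin: "finite (?B m)" for m by (intro finite_imageI finite_PiE) auto
  have "{x::real^'n. x \<in> lattice \<and> l1 x \<le> r} \<subseteq> ?A (nat \<lceil>r\<rceil>)" by auto linarith
  then show "finite {x::real^'n. x \<in> lattice \<and> l1 x \<le> r}" using * fin by (meson finite_subset)
  have "card (?A m) \<le> card (?B m)" by (rule card_mono[OF fin *])
  also have "\<dots> \<le> card (PiE (UNIV::'n set) (\<lambda>_. {- int m .. int m}))" by (intro card_image_le finite_PiE) auto
  also have "\<dots> = (2 * m + 1) ^ CARD('n)"
  proof -
    have "card {- int m .. int m} = 2 * m + 1" by simp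
    then show ?thesis unfolding card_PiE[OF finite] by (simp only: prod_constant)
  qed
  finally show "card (?A m) \<le> (2 * m + 1) ^ CARD('n)" .
qed

lemma edge_iff: "{x, y} \<in> edges \<longleftrightarrow> x \<in> lattice \<and> y \<in> lattice \<and> l1 (x - y) = 1"
  unfolding edges_def l1_def[symmetric] vector_minus_component[symmetric]
  by (auto simp: doubleton_eq_iff l1_minus_commute)

lemma lattice_path_Cons:
  "lattice_path (x # y # zs) \<longleftrightarrow> {x, y} \<in> edges \<and> lattice_path (y # zs)"
  by (auto simp: lattice_path_def edge_iff)

lemma lattice_path_single [simp]: "lattice_path [x] \<longleftrightarrow> x \<in> lattice"
  by (simp add: lattice_path_def)

lemma lattice_path_append:
  assumes "lattice_path (xs @ [v])" "lattice_path (v # ys)"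
  shows "lattice_path (xs @ v # ys)"
  using assms by (auto simp: lattice_path_def successively_append_iff successively_Cons)

lemma lattice_path_appendD:
  assumes "lattice_path (xs @ v # ys)"
  shows "lattice_path (xs @ [v])" "lattice_path (v # ys)"
  using assms by (auto simp: lattice_path_def successively_append_iff successively_Cons)

lemma path_time_single [simp]: "path_time w [x] = 0"
  by (simp add: path_time_def)

lemma path_time_Cons: "path_time w (x # y # zs) = w {x, y} + path_time w (y # zs)"
  unfolding path_time_def by (simp add: sum.lessThan_Suc_shift del: sum.lessThan_Suc)

lemma path_time_append: "path_time w (xs @ v # ys) = path_time w (xs @ [v]) + path_time w (v # ys)"
proof (induction xs)
  case (Cons a xs)
  then show ?case by (cases xs) (auto simp: path_time_Cons)
qed simp

definition path_edges :: "(real^'n) list \<Rightarrow> (real^'n) set set" where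
  "path_edges xs = (\<lambda>i. {xs ! i, xs ! Suc i}) ` {..<length xs - 1}"

lemma path_edges_subset: "lattice_path xs \<Longrightarrow> path_edges xs \<subseteq> edges"
  by (auto simp: path_edges_def lattice_path_def intro: successively_nth)

lemma finite_path_edges [simp]: "finite (path_edges xs)"
  by (simp add: path_edges_def)

text \<open>A simple path uses no edge twice, so its time is a sum over a set of distinct edges, to
  which independence applies.\<close>

lemma inj_on_path_edges:
  assumes "distinct xs"
  shows "inj_on (\<lambda>i. {xs ! i, xs ! Suc i}) {..<length xs - 1}"
  using assms by (auto simp: inj_on_def doubleton_eq_iff nth_eq_iff_index_eq)

lemma path_time_eq_sum: "distinct xs \<Longrightarrow> path_time w xs = (\<Sum>e\<in>path_edges xs. w e)"
  unfolding path_edges_def path_time_def by (simp only: sum.reindex[OF inj_on_path_edges] comp_def)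

lemma card_path_edges: "distinct xs \<Longrightarrow> card (path_edges xs) = length xs - 1"
  unfolding path_edges_def by (simp only: card_image[OF inj_on_path_edges] card_lessThan)

lemma path_time_nonneg:
  assumes "\<forall>e\<in>edges. 0 \<le> w e" "lattice_path xs"
  shows "0 \<le> path_time w xs"
  using assms unfolding path_time_def lattice_path_def
  by (auto intro!: sum_nonneg assms(1)[rule_format] successively_nth[where P="\<lambda>x y. {x, y} \<in> edges"])

lemma path_time_rev: "path_time w (rev xs) = path_time w xs"
proof (induction xs)
  case (Cons x xs)
  show ?case
  proof (cases xs)
    case (Cons y ys)
    then have "path_time w (rev (x # xs)) = path_time w (rev ys @ y # [x])" by simp
    also have "\<dots> = path_time w (rev xs) + w {y, x}"
      using path_time_append[of w "rev ys" y "[x]"] by (simp add: Cons path_time_Cons)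
    also have "\<dots> = path_time w (x # xs)"
      unfolding Cons.IH unfolding Cons by (simp add: path_time_Cons insert_commute)
    finally show ?thesis .
  qed simp
qed simp

lemma lattice_path_rev: "lattice_path xs \<Longrightarrow> lattice_path (rev xs)"
  by (auto simp: lattice_path_def insert_commute)

lemma l1_lattice_path: "lattice_path xs \<Longrightarrow> l1 (hd xs - last xs) \<le> real (length xs - 1)"
proof (induction xs)
  case (Cons x xs)
  show ?case
  proof (cases xs)
    case (Cons y ys)
    then have "l1 (x - y) = 1" "lattice_path xs" using Cons.prems by (auto simp: lattice_path_Cons edge_iff)
    then show ?thesis using Cons.IH l1_triangle_diff[of x "last xs" y] unfolding Cons by auto
  qed simp
qed (simp add: lattice_path_def)

text \<open>Cutting out the stretch between two visits to one vertex removes a closed path of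
  nonnegative time and shortens the list. Simple paths therefore suffice for all passage times, at
  no cost in edges.\<close>

lemma loop_erasure:
  assumes w: "\<forall>e\<in>edges. 0 \<le> w e" and "lattice_path xs"
  shows "\<exists>ys. lattice_path ys \<and> distinct ys \<and> hd ys = hd xs \<and> last ys = last xs \<and>
    length ys \<le> length xs \<and> path_time w ys \<le> path_time w xs"
  using assms(2)
proof (induction "length xs" arbitrary: xs rule: less_induct)
  case less
  show ?case
  proof (cases "distinct xs")
    case False
    then obtain as bs cs v where xs: "xs = as @ [v] @ bs @ [v] @ cs"
      using not_distinct_decomp by blast
    let ?ys = "as @ v # cs"
    have 1: "lattice_path (as @ [v])" "lattice_path (v # bs @ v # cs)"
      using lattice_path_appendD[of as v "bs @ v # cs"] less.prems xs by auto
    have 2: "lattice_path (v # bs @ [v])" "lattice_path (v # cs)"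
      using lattice_path_appendD[of "v # bs" v cs] 1(2) by auto
    have "lattice_path ?ys" by (rule lattice_path_append[OF 1(1) 2(2)])
    moreover have "path_time w ?ys \<le> path_time w xs"
    proof -
      have "path_time w xs = path_time w (as @ [v]) + (path_time w (v # bs @ [v]) + path_time w (v # cs))"
        unfolding xs using path_time_append[of w as v "bs @ v # cs"] path_time_append[of w "v # bs" v cs] by simp
      moreover have "path_time w ?ys = path_time w (as @ [v]) + path_time w (v # cs)"
        by (rule path_time_append)
      ultimately show ?thesis using path_time_nonneg[OF w 2(1)] by simp
    qed
    moreover have "length ?ys < length xs" "hd ?ys = hd xs" "last ?ys = last xs"
      unfolding xs by (auto simp: hd_append)
    ultimately obtain zs where "lattice_path zs" "distinct zs" "hd zs = hd xs" "last zs = last xs"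
      "length zs \<le> length ?ys" "path_time w zs \<le> path_time w ?ys" "length ?ys < length xs"
      "path_time w ?ys \<le> path_time w xs"
      using less.hyps[of ?ys] by auto
    then show ?thesis by (intro exI[of _ zs]) auto
  qed (use less.prems in blast)
qed

text \<open>Each step moves one coordinate by one unit towards \<open>y\<close>. The bound on the
  distances to \<open>y\<close> is carried along to show that the new first vertex, which is farther
  away, does not recur.\<close>

lemma l1_path_exists:
  assumes "x \<in> lattice" "y \<in> lattice" "l1 (x - y) = real d"
  shows "\<exists>xs. lattice_path xs \<and> distinct xs \<and> hd xs = x \<and> last xs = y \<and> length xs = Suc d
    \<and> (\<forall>z\<in>set xs. l1 (z - y) \<le> real d)"
  using assms
proof (induction d arbitrary: x)
  case 0
  then show ?case by (intro exI[of _ "[x]"]) auto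
next
  case (Suc d)
  then have "x \<noteq> y" by auto
  then obtain i where i: "x $ i \<noteq> y $ i" by (auto simp: vec_eq_iff)
  define s where "s = sgn (y $ i - x $ i)"
  have s: "s \<in> \<int>" "\<bar>s\<bar> = 1" using i by (auto simp: s_def sgn_if)
  define x' where "x' = x + axis i s"
  have x': "x' \<in> lattice" unfolding x'_def using s Suc.prems by (intro lattice_add lattice_axis) auto
  \<comment> \<open>Distinct integers differ by at least 1, so the unit step does not overshoot and
    lowers the distance by exactly 1.\<close>
  have 1: "\<bar>x $ i - y $ i\<bar> \<ge> 1"
    using i Suc.prems(1,2) Ints_nonzero_abs_ge1[of "x $ i - y $ i"] by (auto simp: lattice_def)
  have "l1 (x' - y) + 1 = l1 (x - y)"
  proof -
    have "l1 (x - y) = (\<Sum>j\<in>UNIV. \<bar>(x' - y) $ j\<bar> + (if j = i then 1 else 0))"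
      unfolding l1_def
      by (rule sum.cong) (use 1 in \<open>auto simp: x'_def axis_def s_def sgn_if\<close>)
    also have "\<dots> = l1 (x' - y) + 1" unfolding l1_def by (simp add: sum.distrib)
    finally show ?thesis by simp
  qed
  then have d: "l1 (x' - y) = real d" using Suc.prems by simp
  from Suc.IH[OF x' Suc.prems(2) d] obtain xs where xs: "lattice_path xs" "distinct xs" "hd xs = x'" "last xs = y"
    "length xs = Suc d" "\<forall>z\<in>set xs. l1 (z - y) \<le> real d" by blast
  then obtain zs where zs: "xs = x' # zs" by (cases xs) auto
  have "l1 (x - x') = 1"
    unfolding x'_def using s by (simp add: l1_def axis_def if_distrib cong: if_cong)
  then have "lattice_path (x # xs)"
    unfolding zs using xs(1) x' Suc.prems by (simp add: lattice_path_Cons edge_iff zs)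
  moreover have "x \<notin> set xs" using xs(6) Suc.prems(3) by auto
  ultimately show ?case
    using xs Suc.prems by (intro exI[of _ "x # xs"]) (auto simp: zs)
qed

section \<open>Counting simple paths\<close>

definition paths_from :: "nat \<Rightarrow> real^'n \<Rightarrow> (real^'n) list set" where
  "paths_from m x = {xs. lattice_path xs \<and> distinct xs \<and> hd xs = x \<and> length xs = Suc m}"

text \<open>Every step is a lattice vector of \<open>l1\<close> norm at most 1, one of at most
  \<open>3 ^ CARD('n)\<close>. The count is crude, but any exponential bound serves the union
  bound.\<close>

lemma
  fixes x :: "real^'n"
  shows finite_paths_from: "finite (paths_from m x)"
    and card_paths_from: "card (paths_from m x) \<le> (3 ^ CARD('n)) ^ m"
proof -
  define W :: "nat \<Rightarrow> real^'n \<Rightarrow> (real^'n) list set"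
    where "W m x = {xs. lattice_path xs \<and> hd xs = x \<and> length xs = Suc m}" for m x
  define U where "U = {u::real^'n. u \<in> lattice \<and> l1 u \<le> real 1}"
  have fU: "finite U" unfolding U_def by (rule finite_lattice_l1)
  have cU: "card U \<le> 3 ^ CARD('n)"
    using card_lattice_l1[where 'n='n, of 1] unfolding U_def by simp
  have sub: "W (Suc m) x \<subseteq> (\<Union>u\<in>U. (#) x ` W m (x + u))" for m x
  proof
    fix xs assume a: "xs \<in> W (Suc m) x"
    then obtain y zs where xs: "xs = x # y # zs" by (auto simp: W_def length_Suc_conv)
    have e: "{x, y} \<in> edges" "lattice_path (y # zs)" "length zs = m"
      using a by (simp_all add: W_def xs lattice_path_Cons)
    have u: "y - x \<in> U"
      using e(1) lattice_diff[of y x] l1_minus_commute[of x y] by (simp add: edge_iff U_def)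
    have "xs \<in> (#) x ` W m (x + (y - x))"
      unfolding xs by (rule imageI) (use e in \<open>simp add: W_def\<close>)
    then show "xs \<in> (\<Union>u\<in>U. (#) x ` W m (x + u))" by (rule UN_I[OF u])
  qed
  have W: "finite (W m x) \<and> card (W m x) \<le> (3 ^ CARD('n)) ^ m" for m and x :: "real^'n"
  proof (induction m arbitrary: x)
    case 0
    have sub0: "W 0 x \<subseteq> {[x]}" by (auto simp: W_def length_Suc_conv)
    then have "finite (W 0 x)" by (rule finite_subset) simp
    moreover have "card (W 0 x) \<le> card {[x]}" by (rule card_mono[OF _ sub0]) simp
    ultimately show ?case by simp
  next
    case (Suc m)
    let ?S = "\<Union>u\<in>U. (#) x ` W m (x + u)"
    have fS: "finite ?S" using Suc.IH fU by (intro finite_UN_I finite_imageI) auto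
    have "card ?S \<le> (\<Sum>u\<in>U. card ((#) x ` W m (x + u)))" by (rule card_UN_le[OF fU])
    also have "\<dots> \<le> (\<Sum>u\<in>U. (3 ^ CARD('n)) ^ m)"
      by (rule sum_mono) (rule order_trans[OF card_image_le[OF conjunct1[OF Suc.IH]] conjunct2[OF Suc.IH]])
    also have "\<dots> = card U * (3 ^ CARD('n)) ^ m" by simp
    also have "\<dots> \<le> 3 ^ CARD('n) * (3 ^ CARD('n)) ^ m"
      using cU by (rule mult_right_mono) simp
    finally have "card ?S \<le> (3 ^ CARD('n)) ^ Suc m" by simp
    then show ?case using card_mono[OF fS sub] finite_subset[OF sub fS] order_trans by blast
  qed
  have s: "paths_from m x \<subseteq> W m x" by (auto simp: paths_from_def W_def)
  show "finite (paths_from m x)"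
    by (rule finite_subset[OF s]) (rule W[THEN conjunct1])
  show "card (paths_from m x) \<le> (3 ^ CARD('n)) ^ m"
    by (rule order_trans[OF card_mono[OF W[THEN conjunct1] s] W[THEN conjunct2]])
qed

section \<open>Passage times over paths with boundedly many edges\<close>

definition simple_paths :: "nat \<Rightarrow> real^'n \<Rightarrow> real^'n \<Rightarrow> (real^'n) list set" where
  "simple_paths k x y = {xs. lattice_path xs \<and> distinct xs \<and> hd xs = x \<and> last xs = y \<and> length xs \<le> Suc k}"

lemma simple_pathsD:
  assumes "xs \<in> simple_paths k x y"
  shows "lattice_path xs" "distinct xs" "hd xs = x" "last xs = y" "length xs \<le> Suc k" "xs \<noteq> []"
  using assms by (auto simp: simple_paths_def lattice_path_def)

text \<open>A minimum over a finite set, hence attained and depending on finitely many edges. If the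
  distance of \<open>x\<close> and \<open>y\<close> exceeds \<open>k\<close>, there is no such path
  and \<open>Min {}\<close> is unspecified, which is why the distance hypothesis recurs.\<close>

definition passage_time_upto :: "((real^'n) set \<Rightarrow> real) \<Rightarrow> nat \<Rightarrow> real^'n \<Rightarrow> real^'n \<Rightarrow> real" where
  "passage_time_upto w k x y = Min (path_time w ` simple_paths k x y)"

lemma finite_simple_paths: "finite (simple_paths k x y)"
proof (rule finite_subset)
  show "simple_paths k x y \<subseteq> (\<Union>m\<le>k. paths_from m x)"
  proof
    fix xs assume a: "xs \<in> simple_paths k x y"
    then have "xs \<noteq> []" by (auto simp: simple_paths_def lattice_path_def)
    then have "xs \<in> paths_from (length xs - 1) x" "length xs - 1 \<le> k"
      using a by (auto simp: simple_paths_def paths_from_def)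
    then show "xs \<in> (\<Union>m\<le>k. paths_from m x)" by blast
  qed
qed (auto simp: finite_paths_from)

lemma simple_paths_nonempty:
  assumes "x \<in> lattice" "y \<in> lattice" "l1 (x - y) \<le> real k"
  shows "simple_paths k x y \<noteq> {}"
proof -
  obtain d where d: "l1 (x - y) = real d" using l1_lattice[OF lattice_diff[OF assms(1,2)]] by blast
  from l1_path_exists[OF assms(1,2) d] d assms(3) show ?thesis
    by (force simp: simple_paths_def)
qed

lemma passage_time_le:
  assumes "\<forall>e\<in>edges. 0 \<le> w e" "lattice_path xs"
  shows "passage_time w (hd xs) (last xs) \<le> path_time w xs"
  unfolding passage_time_def
  by (rule cInf_lower) (use assms in \<open>auto intro!: bdd_belowI[of _ 0] path_time_nonneg[OF assms(1)]\<close>)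

lemma lattice_path_exists:
  assumes "x \<in> lattice" "y \<in> lattice"
  shows "\<exists>xs. lattice_path xs \<and> hd xs = x \<and> last xs = y"
  using l1_path_exists[OF assms] l1_lattice[OF lattice_diff[OF assms]] by blast

lemma passage_time_greatest:
  assumes "x \<in> lattice" "y \<in> lattice"
    and "\<And>xs. lattice_path xs \<Longrightarrow> hd xs = x \<Longrightarrow> last xs = y \<Longrightarrow> a \<le> path_time w xs"
  shows "a \<le> passage_time w x y"
  unfolding passage_time_def
  by (rule cInf_greatest) (use assms lattice_path_exists[OF assms(1,2)] in auto)

lemma passage_time_nonneg:
  assumes "\<forall>e\<in>edges. 0 \<le> w e" "x \<in> lattice" "y \<in> lattice"
  shows "0 \<le> passage_time w x y"
  by (rule passage_time_greatest[OF assms(2,3)]) (rule path_time_nonneg[OF assms(1)])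

lemma passage_time_commute:
  fixes x y :: "real^'n"
  shows "passage_time w x y = passage_time w y x"
proof -
  have "{path_time w xs | xs. lattice_path xs \<and> hd xs = x \<and> last xs = y} \<subseteq>
    {path_time w xs | xs. lattice_path xs \<and> hd xs = y \<and> last xs = x}" for x y :: "real^'n"
  proof clarify
    fix xs assume "lattice_path xs" "x = hd xs" "y = last xs"
    then show "\<exists>ys. path_time w xs = path_time w ys \<and> lattice_path ys \<and> hd ys = last xs \<and> last ys = hd xs"
      by (intro exI[of _ "rev xs"]) (auto simp: path_time_rev lattice_path_rev hd_rev last_rev)
  qed
  note s = this
  show ?thesis unfolding passage_time_def by (intro arg_cong[where f=Inf] subset_antisym s)
qed

lemma passage_time_triangle:
  assumes w: "\<forall>e\<in>edges. 0 \<le> w e" and "x \<in> lattice" "y \<in> lattice" "z \<in> lattice"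
  shows "passage_time w x z \<le> passage_time w x y + passage_time w y z"
proof -
  have "passage_time w x z - path_time w ys \<le> passage_time w x y"
    if ys: "lattice_path ys" "hd ys = y" "last ys = z" for ys
  proof (rule passage_time_greatest[OF assms(2,3)])
    fix xs assume xs: "lattice_path xs" "hd xs = x" "last xs = y"
    have ne: "xs \<noteq> []" "ys \<noteq> []" using xs(1) ys(1) by (simp_all add: lattice_path_def)
    obtain as where as: "xs = as @ [y]"
      using append_butlast_last_id[OF ne(1)] xs(3) by metis
    obtain bs where bs: "ys = y # bs"
      using list.collapse[OF ne(2)] ys(2) by metis
    have p: "lattice_path (as @ y # bs)" using xs(1) ys(1) unfolding as bs by (rule lattice_path_append)
    have "hd (as @ y # bs) = x" using xs(2) by (cases as) (simp_all add: as)
    moreover have "last (as @ y # bs) = z" using ys(3) by (simp add: bs)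
    ultimately have "passage_time w x z \<le> path_time w (as @ y # bs)"
      using passage_time_le[OF w p] by simp
    also have "\<dots> = path_time w xs + path_time w ys" using path_time_append[of w as y bs] by (simp add: as bs)
    finally show "passage_time w x z - path_time w ys \<le> path_time w xs" by simp
  qed
  then have "passage_time w x z - passage_time w x y \<le> passage_time w y z"
    by (intro passage_time_greatest[OF assms(3,4)]) (simp add: algebra_simps)
  then show ?thesis by simp
qed

lemma passage_time_upto_le: "xs \<in> simple_paths k x y \<Longrightarrow> passage_time_upto w k x y \<le> path_time w xs"
  unfolding passage_time_upto_def by (intro Min_le) (auto simp: finite_simple_paths)

lemma passage_time_upto_attained:
  assumes "x \<in> lattice" "y \<in> lattice" "l1 (x - y) \<le> real k"
  obtains xs where "xs \<in> simple_paths k x y" "passage_time_upto w k x y = path_time w xs"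
proof -
  have "passage_time_upto w k x y \<in> path_time w ` simple_paths k x y"
    unfolding passage_time_upto_def
    by (rule Min_in) (simp_all add: finite_simple_paths simple_paths_nonempty[OF assms])
  then show thesis using that by blast
qed

lemma passage_time_upto_nonneg:
  assumes "\<forall>e\<in>edges. 0 \<le> w e" "x \<in> lattice" "y \<in> lattice" "l1 (x - y) \<le> real k"
  shows "0 \<le> passage_time_upto w k x y"
proof -
  obtain xs where "xs \<in> simple_paths k x y" "passage_time_upto w k x y = path_time w xs"
    by (rule passage_time_upto_attained[OF assms(2-4)])
  then show ?thesis using path_time_nonneg[OF assms(1), where xs=xs] by (auto simp: simple_paths_def)
qed

lemma passage_time_le_upto:
  assumes "\<forall>e\<in>edges. 0 \<le> w e" "x \<in> lattice" "y \<in> lattice" "l1 (x - y) \<le> real k"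
  shows "passage_time w x y \<le> passage_time_upto w k x y"
proof -
  obtain xs where "xs \<in> simple_paths k x y" "passage_time_upto w k x y = path_time w xs"
    by (rule passage_time_upto_attained[OF assms(2-4)])
  then show ?thesis using passage_time_le[OF assms(1), where xs=xs] by (auto simp: simple_paths_def)
qed

lemma passage_time_upto_antimono:
  assumes "x \<in> lattice" "y \<in> lattice" "l1 (x - y) \<le> real j" "j \<le> k"
  shows "passage_time_upto w k x y \<le> passage_time_upto w j x y"
proof -
  have "simple_paths j x y \<subseteq> simple_paths k x y" using assms(4) by (auto simp: simple_paths_def)
  then show ?thesis
    unfolding passage_time_upto_def
    by (intro Min_antimono image_mono) (simp_all add: finite_simple_paths simple_paths_nonempty[OF assms(1-3)])
qed

lemma path_time_take_le:
  assumes "\<forall>e\<in>edges. 0 \<le> w e" "lattice_path xs" "Suc k < length xs"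
  shows "path_time w (take (Suc k) xs) \<le> path_time w xs"
proof -
  have "path_time w (take (Suc k) xs) = (\<Sum>i<k. w {xs ! i, xs ! Suc i})"
    using assms(3) by (auto simp: path_time_def min_def intro!: sum.cong)
  also have "\<dots> \<le> path_time w xs"
    unfolding path_time_def
  proof (rule sum_mono2)
    fix i assume "i \<in> {..<length xs - 1} - {..<k}"
    then have "{xs ! i, xs ! Suc i} \<in> edges"
      using assms(2) unfolding lattice_path_def by (auto intro: successively_nth[where P="\<lambda>x y. {x, y} \<in> edges"])
    then show "0 \<le> w {xs ! i, xs ! Suc i}" by (rule assms(1)[rule_format])
  qed (use assms(3) in auto)
  finally show ?thesis .
qed

lemma take_paths_from:
  assumes "lattice_path xs" "distinct xs" "Suc k \<le> length xs"
  shows "take (Suc k) xs \<in> paths_from k (hd xs)"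
proof -
  have "lattice_path (take (Suc k) xs)"
  proof (cases "length xs = Suc k")
    case False
    then have l: "Suc k < length xs" using assms(3) by simp
    have "lattice_path (take k xs @ xs ! k # drop (Suc k) xs)"
      using assms(1) l by (simp add: id_take_nth_drop[symmetric])
    from lattice_path_appendD(1)[OF this] l show ?thesis
      by (simp add: take_Suc_conv_app_nth)
  qed (use assms(1) in simp)
  then show ?thesis using assms by (auto simp: paths_from_def)
qed

text \<open>The counting estimate concerns paths with exactly \<open>k\<close> edges; a longer
  simple path inherits the bound from its initial segment of that length.\<close>

lemma path_time_ge_of_paths_from:
  assumes w: "\<forall>e\<in>edges. 0 \<le> w e" and long: "\<And>xs. xs \<in> paths_from k x \<Longrightarrow> a \<le> path_time w xs"
    and xs: "lattice_path xs" "distinct xs" "hd xs = x" "Suc k \<le> length xs"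
  shows "a \<le> path_time w xs"
proof -
  have "a \<le> path_time w (take (Suc k) xs)"
    using take_paths_from[OF xs(1,2,4)] xs(3) by (intro long) auto
  also have "\<dots> \<le> path_time w xs"
    using path_time_take_le[OF w xs(1), where k=k] xs(4) by (cases "Suc k = length xs") auto
  finally show ?thesis .
qed

text \<open>The level \<open>a\<close> separates the two kinds of simple paths: those with more than
  \<open>k\<close> edges cost at least \<open>a\<close>, while the minimum over the others is at
  most \<open>a\<close>. Loop erasure disposes of paths that are not simple.\<close>

lemma passage_time_eq_upto:
  assumes w: "\<forall>e\<in>edges. 0 \<le> w e" and xy: "x \<in> lattice" "y \<in> lattice" "l1 (x - y) \<le> real k"
    and long: "\<And>xs. xs \<in> paths_from k x \<Longrightarrow> a \<le> path_time w xs"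
    and short: "passage_time_upto w k x y \<le> a"
  shows "passage_time w x y = passage_time_upto w k x y"
proof (rule antisym[OF passage_time_le_upto[OF w xy]])
  show "passage_time_upto w k x y \<le> passage_time w x y"
  proof (rule passage_time_greatest[OF xy(1,2)])
    fix xs assume xs: "lattice_path xs" "hd xs = x" "last xs = y"
    obtain ys where ys: "lattice_path ys" "distinct ys" "hd ys = x" "last ys = y"
      "path_time w ys \<le> path_time w xs"
      using loop_erasure[OF w xs(1)] unfolding xs(2,3) by blast
    have "passage_time_upto w k x y \<le> path_time w ys"
    proof (cases "length ys \<le> Suc k")
      case True
      then show ?thesis using ys by (intro passage_time_upto_le) (simp add: simple_paths_def)
    next
      case False
      then have "a \<le> path_time w ys" using ys by (intro path_time_ge_of_paths_from[OF w long]) auto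
      then show ?thesis using short by simp
    qed
    then show "passage_time_upto w k x y \<le> path_time w xs" using ys by simp
  qed
qed

lemma passage_time_ge_of_far:
  assumes w: "\<forall>e\<in>edges. 0 \<le> w e" and xy: "x \<in> lattice" "y \<in> lattice" "real k \<le> l1 (x - y)"
    and long: "\<And>xs. xs \<in> paths_from k x \<Longrightarrow> a \<le> path_time w xs"
  shows "a \<le> passage_time w x y"
proof (rule passage_time_greatest[OF xy(1,2)])
  fix xs assume xs: "lattice_path xs" "hd xs = x" "last xs = y"
  obtain ys where ys: "lattice_path ys" "distinct ys" "hd ys = x" "last ys = y"
    "path_time w ys \<le> path_time w xs"
    using loop_erasure[OF w xs(1)] unfolding xs(2,3) by blast
  have "real k \<le> real (length ys - 1)" "ys \<noteq> []" using l1_lattice_path[OF ys(1)] xy(3) ys by (auto simp: lattice_path_def)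
  then have "Suc k \<le> length ys" by (cases ys) auto
  then have "a \<le> path_time w ys" using ys by (intro path_time_ge_of_paths_from[OF w long]) auto
  then show "a \<le> path_time w xs" using ys by simp
qed

text \<open>The concatenated path may revisit vertices, so it is loop-erased before it competes.
  Edge budgets add, which makes restricted times subadditive when scale and budget double
  together.\<close>

lemma passage_time_upto_triangle:
  assumes w: "\<forall>e\<in>edges. 0 \<le> w e" and "x \<in> lattice" "y \<in> lattice" "z \<in> lattice"
    and "l1 (x - y) \<le> real j" "l1 (y - z) \<le> real k"
  shows "passage_time_upto w (j + k) x z \<le> passage_time_upto w j x y + passage_time_upto w k y z"
proof -
  obtain xs where xs: "xs \<in> simple_paths j x y" "passage_time_upto w j x y = path_time w xs"
    by (rule passage_time_upto_attained[OF assms(2,3,5)])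
  obtain ys where ys: "ys \<in> simple_paths k y z" "passage_time_upto w k y z = path_time w ys"
    by (rule passage_time_upto_attained[OF assms(3,4,6)])
  note xs' = simple_pathsD[OF xs(1)] and ys' = simple_pathsD[OF ys(1)]
  obtain as where as: "xs = as @ [y]"
    using append_butlast_last_id[OF xs'(6)] xs'(4) by metis
  obtain bs where bs: "ys = y # bs"
    using list.collapse[OF ys'(6)] ys'(3) by metis
  have p: "lattice_path (as @ y # bs)"
    using xs'(1) ys'(1) unfolding as bs by (rule lattice_path_append)
  obtain zs where zs: "lattice_path zs" "distinct zs" "hd zs = hd (as @ y # bs)" "last zs = last (as @ y # bs)"
    "length zs \<le> length (as @ y # bs)" "path_time w zs \<le> path_time w (as @ y # bs)"
    using loop_erasure[OF w p] by blast
  have "zs \<in> simple_paths (j + k) x z"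
    using zs xs'(2-5) ys'(2-5) by (cases as; cases "bs = []") (simp_all add: simple_paths_def as bs)
  then have "passage_time_upto w (j + k) x z \<le> path_time w zs" by (rule passage_time_upto_le)
  also have "\<dots> \<le> path_time w xs + path_time w ys"
    using zs(6) path_time_append[of w as y bs] by (simp add: as bs)
  finally show ?thesis using xs ys by simp
qed

section \<open>Translation covariance\<close>

lemma shift_edge_iff: "v \<in> lattice \<Longrightarrow> {v + x, v + y} \<in> edges \<longleftrightarrow> {x, y} \<in> edges"
  by (auto simp: edge_iff lattice_add_iff)

lemma lattice_path_shift: "v \<in> lattice \<Longrightarrow> lattice_path (map ((+) v) xs) \<longleftrightarrow> lattice_path xs"
  by (auto simp: lattice_path_def successively_map shift_edge_iff lattice_add_iff image_subset_iff)

lemma path_time_shift: "path_time w (map ((+) v) xs) = path_time (\<lambda>e. w ((+) v ` e)) xs"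
  unfolding path_time_def by (intro sum.cong) auto

lemma map_shift_simple_paths:
  assumes v: "v \<in> lattice" and xs: "xs \<in> simple_paths k x y"
  shows "map ((+) v) xs \<in> simple_paths k (v + x) (v + y)"
  using simple_pathsD[OF xs]
  by (simp add: simple_paths_def hd_map last_map distinct_map lattice_path_shift[OF v])

lemma simple_paths_shift:
  assumes v: "v \<in> lattice"
  shows "simple_paths k (v + x) (v + y) = map ((+) v) ` simple_paths k x y"
proof (intro set_eqI iffI)
  fix xs assume a: "xs \<in> simple_paths k (v + x) (v + y)"
  have "map ((+) (-v)) xs \<in> simple_paths k x y"
    using map_shift_simple_paths[OF lattice_uminus[OF v] a] by simp
  moreover have "xs = map ((+) v) (map ((+) (-v)) xs)" by (simp add: comp_def)
  ultimately show "xs \<in> map ((+) v) ` simple_paths k x y" by (rule rev_image_eqI)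
next
  fix xs assume "xs \<in> map ((+) v) ` simple_paths k x y"
  then show "xs \<in> simple_paths k (v + x) (v + y)"
    using map_shift_simple_paths[OF v] by blast
qed

lemma passage_time_upto_shift:
  assumes "v \<in> lattice"
  shows "passage_time_upto w k (v + x) (v + y) = passage_time_upto (\<lambda>e. w ((+) v ` e)) k x y"
proof -
  have "path_time w ` simple_paths k (v + x) (v + y) =
      (\<lambda>xs. path_time w (map ((+) v) xs)) ` simple_paths k x y"
    unfolding simple_paths_shift[OF assms] by (rule image_image)
  also have "\<dots> = path_time (\<lambda>e. w ((+) v ` e)) ` simple_paths k x y"
    by (rule image_cong[OF refl path_time_shift])
  finally show ?thesis by (simp only: passage_time_upto_def)
qed

section \<open>Tail and variance bounds\<close>

lemma edge_exists: "{0, axis undefined 1} \<in> (edges :: (real^'n) set set)"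
  by (simp add: edge_iff lattice_def l1_def axis_def if_distrib cong: if_cong)

text \<open>The density enters as \<open>no_atom\<close>. Nonnegativity is required for every
  outcome, so that path estimates hold without exceptional sets; the main theorem arranges this by
  passing to positive parts.\<close>

locale first_passage = prob_space M for M :: "'w measure" +
  fixes \<tau> :: "(real^'n) set \<Rightarrow> 'w \<Rightarrow> real" and \<nu> :: "real measure"
  assumes indep: "indep_vars (\<lambda>_. borel) \<tau> edges"
    and law: "e \<in> edges \<Longrightarrow> distr M borel (\<tau> e) = \<nu>"
    and nonneg: "0 \<le> \<tau> e \<omega>"
    and no_atom: "measure \<nu> {0} = 0"
    and exp_moment: "\<exists>\<alpha>>0. integrable \<nu> (\<lambda>x. exp (\<alpha> * x))"
begin

lemma measurable_passage [measurable]: "e \<in> edges \<Longrightarrow> \<tau> e \<in> borel_measurable M"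
  using indep by (auto simp: indep_vars_def)

lemma prob_space_law: "prob_space \<nu>"
  using prob_space_distr[OF measurable_passage[OF edge_exists]] law[OF edge_exists] by simp

lemma sets_law [measurable_cong]: "sets \<nu> = sets borel"
  using law[OF edge_exists] by (metis sets_distr)

lemma AE_law_pos: "AE x in \<nu>. 0 < x"
proof -
  interpret \<nu>: prob_space \<nu> by (rule prob_space_law)
  have "AE x in distr M borel (\<tau> {0, axis undefined 1}). 0 \<le> x"
    using measurable_passage[OF edge_exists] by (subst AE_distr_iff) (auto simp: nonneg)
  then have "AE x in \<nu>. 0 \<le> x" unfolding law[OF edge_exists] .
  moreover have "AE x in \<nu>. x \<notin> {0}"
    by (rule AE_not_in) (simp add: null_sets_def \<nu>.emeasure_eq_measure no_atom sets_law)
  ultimately show ?thesis by eventually_elim auto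
qed

section \<open>Exponential tail bounds\<close>

lemma nn_integral_exp_sum:
  assumes "finite P" "P \<subseteq> edges"
  shows "(\<integral>\<^sup>+\<omega>. ennreal (exp (c * (\<Sum>e\<in>P. \<tau> e \<omega>))) \<partial>M) = (\<integral>\<^sup>+x. ennreal (exp (c * x)) \<partial>\<nu>) ^ card P"
proof -
  have "(\<integral>\<^sup>+\<omega>. ennreal (exp (c * (\<Sum>e\<in>P. \<tau> e \<omega>))) \<partial>M) = (\<integral>\<^sup>+\<omega>. (\<Prod>e\<in>P. ennreal (exp (c * \<tau> e \<omega>))) \<partial>M)"
    by (simp add: sum_distrib_left exp_sum[OF assms(1)] prod_ennreal)
  also have "\<dots> = (\<Prod>e\<in>P. \<integral>\<^sup>+\<omega>. ennreal (exp (c * \<tau> e \<omega>)) \<partial>M)"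
    by (rule indep_vars_nn_integral[OF assms(1)])
      (auto intro!: indep_vars_compose2[OF indep_vars_subset[OF indep assms(2)], where Y="\<lambda>_ x. ennreal (exp (c * x))"])
  also have "\<dots> = (\<Prod>e\<in>P. \<integral>\<^sup>+x. ennreal (exp (c * x)) \<partial>\<nu>)"
  proof (rule prod.cong[OF refl])
    fix e assume "e \<in> P"
    then have e: "e \<in> edges" using assms by auto
    show "(\<integral>\<^sup>+\<omega>. ennreal (exp (c * \<tau> e \<omega>)) \<partial>M) = (\<integral>\<^sup>+x. ennreal (exp (c * x)) \<partial>\<nu>)"
      unfolding law[OF e, symmetric] using measurable_passage[OF e] by (subst nn_integral_distr) auto
  qed
  finally show ?thesis by simp
qed

text \<open>Markov's inequality for the exponential of \<open>c\<close> times the sum. The sign of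
  \<open>c\<close> is left open: negative \<open>c\<close> bounds the lower tail in
  \<open>long_paths_slow\<close>, positive \<open>c\<close> the upper tail in
  \<open>short_paths_fast\<close>.\<close>

lemma chernoff:
  assumes "finite P" "P \<subseteq> edges" "(\<integral>\<^sup>+x. ennreal (exp (c * x)) \<partial>\<nu>) \<le> ennreal r"
  shows "prob {\<omega>\<in>space M. a \<le> c * (\<Sum>e\<in>P. \<tau> e \<omega>)} \<le> exp (- a) * r ^ card P"
proof -
  let ?u = "\<lambda>\<omega>. ennreal (exp (c * (\<Sum>e\<in>P. \<tau> e \<omega>)))"
  have [measurable]: "(\<lambda>\<omega>. \<Sum>e\<in>P. \<tau> e \<omega>) \<in> borel_measurable M"
    using assms(2) by (intro borel_measurable_sum measurable_passage) auto
  \<comment> \<open>For negative \<open>r\<close> the number \<open>ennreal r\<close> is 0, and a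
    positive function would have integral 0 over a probability space.\<close>
  have r0: "0 \<le> r"
  proof (rule ccontr)
    assume "\<not> 0 \<le> r"
    then have "(\<integral>\<^sup>+x. ennreal (exp (c * x)) \<partial>\<nu>) = 0" using assms(3) by (simp add: ennreal_neg)
    then have "AE x in \<nu>. False" by (subst (asm) nn_integral_0_iff_AE) auto
    then show False using prob_space.AE_False[OF prob_space_law] by simp
  qed
  have "emeasure M {\<omega>\<in>space M. a \<le> c * (\<Sum>e\<in>P. \<tau> e \<omega>)} \<le> emeasure M {\<omega>\<in>space M. 1 \<le> ennreal (exp (- a)) * ?u \<omega>}"
  proof (rule emeasure_mono)
    show "{\<omega>\<in>space M. a \<le> c * (\<Sum>e\<in>P. \<tau> e \<omega>)} \<subseteq> {\<omega>\<in>space M. 1 \<le> ennreal (exp (- a)) * ?u \<omega>}"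
      by (auto simp: ennreal_mult'[symmetric] exp_add[symmetric])
  qed measurable
  also have "\<dots> \<le> ennreal (exp (- a)) * (\<integral>\<^sup>+\<omega>. ?u \<omega> * indicator (space M) \<omega> \<partial>M)"
    by (rule nn_integral_Markov_inequality) auto
  also have "(\<integral>\<^sup>+\<omega>. ?u \<omega> * indicator (space M) \<omega> \<partial>M) = (\<integral>\<^sup>+\<omega>. ?u \<omega> \<partial>M)"
    by (rule nn_integral_cong) simp
  also have "\<dots> = (\<integral>\<^sup>+x. ennreal (exp (c * x)) \<partial>\<nu>) ^ card P"
    by (rule nn_integral_exp_sum[OF assms(1,2)])
  also have "ennreal (exp (- a)) * \<dots> \<le> ennreal (exp (- a)) * ennreal r ^ card P"
    by (intro mult_left_mono power_mono assms(3)) auto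
  also have "\<dots> = ennreal (exp (- a) * r ^ card P)"
    using r0 by (simp add: ennreal_mult' ennreal_power)
  finally show ?thesis
    using r0 by (simp add: emeasure_eq_measure)
qed

text \<open>\<open>exp (- n * x)\<close> tends to 0 for \<open>x > 0\<close>, which is almost every
  \<open>x\<close> because there is no atom at 0; dominated convergence does the rest. This
  smallness has to beat the number of paths.\<close>

lemma laplace_small:
  assumes "0 < q"
  shows "\<exists>c>0. (\<integral>\<^sup>+x. ennreal (exp (- c * x)) \<partial>\<nu>) \<le> ennreal q"
proof -
  interpret \<nu>: prob_space \<nu> by (rule prob_space_law)
  have "(\<lambda>n. \<integral>x. exp (- real n * x) \<partial>\<nu>) \<longlonglongrightarrow> (\<integral>x. 0 \<partial>\<nu>)"
  proof (rule integral_dominated_convergence[where w="\<lambda>_. 1"])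
    show "AE x in \<nu>. (\<lambda>n. exp (- real n * x)) \<longlonglongrightarrow> 0"
      using AE_law_pos
    proof eventually_elim
      case (elim x)
      have "(\<lambda>n. exp (- x) ^ n) \<longlonglongrightarrow> 0" by (rule LIMSEQ_power_zero) (use elim in simp)
      then show ?case by (simp add: exp_of_nat_mult[symmetric])
    qed
    show "AE x in \<nu>. norm (exp (- real n * x)) \<le> 1" for n
      using AE_law_pos by eventually_elim auto
  qed auto
  then have "\<forall>\<^sub>F n in sequentially. (\<integral>x. exp (- real n * x) \<partial>\<nu>) < q"
    using assms by (simp add: order_tendsto_iff)
  with eventually_gt_at_top[of 0] have "\<forall>\<^sub>F n in sequentially. 0 < n \<and> (\<integral>x. exp (- real n * x) \<partial>\<nu>) < q"
    by eventually_elim simp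
  then obtain n where n: "0 < n" "(\<integral>x. exp (- real n * x) \<partial>\<nu>) < q"
    by (auto simp: eventually_sequentially)
  have "integrable \<nu> (\<lambda>x. exp (- real n * x))"
    by (rule \<nu>.integrable_const_bound[where B=1]) (use AE_law_pos in auto)
  then have "(\<integral>\<^sup>+x. ennreal (exp (- real n * x)) \<partial>\<nu>) = ennreal (\<integral>x. exp (- real n * x) \<partial>\<nu>)"
    by (rule nn_integral_eq_integral) auto
  then show ?thesis using n by (intro exI[of _ "real n"]) (auto intro!: ennreal_leI)
qed

abbreviation T_upto :: "nat \<Rightarrow> real^'n \<Rightarrow> real^'n \<Rightarrow> 'w \<Rightarrow> real" where
  "T_upto k p q \<omega> \<equiv> passage_time_upto (\<lambda>e. \<tau> e \<omega>) k p q"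

lemma measurable_path_time [measurable]:
  assumes "lattice_path xs"
  shows "(\<lambda>\<omega>. path_time (\<lambda>e. \<tau> e \<omega>) xs) \<in> borel_measurable M"
  unfolding path_time_def
proof (rule borel_measurable_sum)
  fix i assume "i \<in> {..<length xs - 1}"
  then show "\<tau> {xs ! i, xs ! Suc i} \<in> borel_measurable M"
    using assms by (intro measurable_passage)
      (auto simp: lattice_path_def intro: successively_nth[where P="\<lambda>x y. {x, y} \<in> edges"])
qed

lemma measurable_T_upto [measurable]:
  assumes "p \<in> lattice" "q \<in> lattice" "l1 (p - q) \<le> real k"
  shows "T_upto k p q \<in> borel_measurable M"
  unfolding passage_time_upto_def
  by (rule borel_measurable_Min_image[OF finite_simple_paths simple_paths_nonempty[OF assms]])
    (rule measurable_path_time, rule simple_pathsD(1))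

lemma path_event:
  assumes "lattice_path xs"
  shows "{\<omega>\<in>space M. path_time (\<lambda>e. \<tau> e \<omega>) xs < a} \<in> events"
proof -
  note [measurable] = measurable_path_time[OF assms]
  show ?thesis by measurable
qed

lemma slow_event_eq:
  "{\<omega>\<in>space M. \<exists>xs\<in>paths_from m p. path_time (\<lambda>e. \<tau> e \<omega>) xs < a} =
    (\<Union>xs\<in>paths_from m p. {\<omega>\<in>space M. path_time (\<lambda>e. \<tau> e \<omega>) xs < a})"
  by auto

lemma slow_event: "{\<omega>\<in>space M. \<exists>xs\<in>paths_from m p. path_time (\<lambda>e. \<tau> e \<omega>) xs < a} \<in> events"
  unfolding slow_event_eq
  by (intro sets.finite_UN finite_paths_from path_event) (simp add: paths_from_def)

lemma long_paths_slow:
  "\<exists>\<delta>>0. \<forall>p m. prob {\<omega>\<in>space M. \<exists>xs\<in>paths_from m p. path_time (\<lambda>e. \<tau> e \<omega>) xs < \<delta> * real m} \<le> (1/2) ^ m"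
proof -
  define D :: real where "D = 3 ^ CARD('n)"
  have D: "D > 0" by (simp add: D_def)
  \<comment> \<open>In the target value the factor \<open>D\<close> pays for the number of paths,
    \<open>exp 1\<close> for the factor \<open>exp m\<close> of the Chernoff bound, and 2 is the
    decay that remains. The witness for \<open>\<delta>\<close> will be
    \<open>1 / c\<close>.\<close>
  obtain c where c: "c > 0" "(\<integral>\<^sup>+x. ennreal (exp (- c * x)) \<partial>\<nu>) \<le> ennreal (1 / (2 * D * exp 1))"
    using laplace_small[of "1 / (2 * D * exp 1)"] D by auto
  have "prob {\<omega>\<in>space M. \<exists>xs\<in>paths_from m p. path_time (\<lambda>e. \<tau> e \<omega>) xs < 1 / c * real m} \<le> (1/2) ^ m" for p m
  proof -
    have "prob {\<omega>\<in>space M. path_time (\<lambda>e. \<tau> e \<omega>) xs < 1 / c * real m} \<le> (1 / (2 * D)) ^ m"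
      if xs: "xs \<in> paths_from m p" for xs
    proof -
      have x: "lattice_path xs" "distinct xs" "length xs = Suc m" using xs by (auto simp: paths_from_def)
      have "prob {\<omega>\<in>space M. path_time (\<lambda>e. \<tau> e \<omega>) xs < 1 / c * real m}
        \<le> prob {\<omega>\<in>space M. - real m \<le> - c * (\<Sum>e\<in>path_edges xs. \<tau> e \<omega>)}"
      proof (rule finite_measure_mono)
        show "{\<omega>\<in>space M. path_time (\<lambda>e. \<tau> e \<omega>) xs < 1 / c * real m} \<subseteq>
          {\<omega>\<in>space M. - real m \<le> - c * (\<Sum>e\<in>path_edges xs. \<tau> e \<omega>)}"
          using c(1) by (auto simp: path_time_eq_sum[OF x(2)] field_simps)
        have [measurable]: "(\<lambda>\<omega>. \<Sum>e\<in>path_edges xs. \<tau> e \<omega>) \<in> borel_measurable M"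
          using path_edges_subset[OF x(1)] by (intro borel_measurable_sum measurable_passage) auto
        show "{\<omega>\<in>space M. - real m \<le> - c * (\<Sum>e\<in>path_edges xs. \<tau> e \<omega>)} \<in> events" by measurable
      qed
      also have "\<dots> \<le> exp (- (- real m)) * (1 / (2 * D * exp 1)) ^ card (path_edges xs)"
        by (rule chernoff[OF finite_path_edges path_edges_subset[OF x(1)] c(2)])
      also have "\<dots> = (1 / (2 * D)) ^ m"
        using D by (simp add: card_path_edges[OF x(2)] x(3) power_divide power_mult_distrib exp_of_nat_mult[symmetric])
      finally show ?thesis .
    qed
    note 1 = this
    have "prob {\<omega>\<in>space M. \<exists>xs\<in>paths_from m p. path_time (\<lambda>e. \<tau> e \<omega>) xs < 1 / c * real m}
      \<le> (\<Sum>xs\<in>paths_from m p. prob {\<omega>\<in>space M. path_time (\<lambda>e. \<tau> e \<omega>) xs < 1 / c * real m})"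
      unfolding slow_event_eq
      by (rule finite_measure_subadditive_finite[OF finite_paths_from])
        (use path_event in \<open>auto simp: paths_from_def\<close>)
    also have "\<dots> \<le> (\<Sum>xs\<in>paths_from m p. (1 / (2 * D)) ^ m)"
      by (rule sum_mono) (rule 1)
    also have "\<dots> = real (card (paths_from m p)) * (1 / (2 * D)) ^ m" by simp
    also have "\<dots> \<le> D ^ m * (1 / (2 * D)) ^ m"
    proof (rule mult_right_mono)
      have "real (card (paths_from m p)) \<le> real ((3 ^ CARD('n)) ^ m)"
        using card_paths_from[of m p] by (rule of_nat_mono)
      then show "real (card (paths_from m p)) \<le> D ^ m" by (simp add: D_def)
    qed (use D in simp)
    also have "\<dots> = (1/2) ^ m" using D by (simp add: power_mult_distrib[symmetric])
    finally show ?thesis .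
  qed
  then show ?thesis using c(1) by (intro exI[of _ "1 / c"]) auto
qed

text \<open>For each target one fixed path with at most \<open>m\<close> edges suffices: the
  exponential moment lets its time exceed \<open>C * m\<close> with probability at most
  \<open>(1 / (2 * D)) ^ m\<close>. The union bound runs over at most \<open>D ^ m\<close>
  targets.\<close>

lemma short_paths_fast:
  "\<exists>C>0. \<forall>p\<in>lattice. \<forall>m. prob {\<omega>\<in>space M. \<exists>x\<in>lattice. l1 (x - p) \<le> real m \<and> C * real m < T_upto m p x \<omega>} \<le> (1/2) ^ m"
proof -
  define D :: real where "D = 3 ^ CARD('n)"
  have D: "D > 0" by (simp add: D_def)
  obtain \<alpha> where \<alpha>: "\<alpha> > 0" "integrable \<nu> (\<lambda>x. exp (\<alpha> * x))" using exp_moment by auto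
  \<comment> \<open>With \<open>A\<close> at least 1, the power \<open>A ^ card\<close> may be
    raised to \<open>A ^ m\<close> for a path with fewer than \<open>m\<close> edges.\<close>
  define A where "A = max 1 (\<integral>x. exp (\<alpha> * x) \<partial>\<nu>)"
  have A: "(\<integral>\<^sup>+x. ennreal (exp (\<alpha> * x)) \<partial>\<nu>) \<le> ennreal A" "1 \<le> A"
    by (auto simp: nn_integral_eq_integral[OF \<alpha>(2)] A_def intro!: ennreal_leI)
  \<comment> \<open>Solves \<open>exp (- \<alpha> * C) * A \<le> 1 / (2 * D)\<close> for
    \<open>C\<close>; the maximum with 1 keeps \<open>C\<close> positive.\<close>
  define C where "C = max 1 (ln (2 * D * A) / \<alpha>)"
  have C: "exp (- (\<alpha> * C)) * A \<le> 1 / (2 * D)"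
  proof -
    have "ln (2 * D * A) \<le> \<alpha> * C" using \<alpha>(1) by (simp add: C_def field_simps max_def)
    then have "2 * D * A \<le> exp (\<alpha> * C)" using D A(2) exp_le_cancel_iff[of "ln (2 * D * A)" "\<alpha> * C"] by simp
    then show ?thesis using D by (simp add: exp_minus field_simps)
  qed
  have "prob {\<omega>\<in>space M. \<exists>x\<in>lattice. l1 (x - p) \<le> real m \<and> C * real m < T_upto m p x \<omega>} \<le> (1/2) ^ m"
    if p: "p \<in> lattice" for p m
  proof -
    define B where "B = {x::real^'n. x \<in> lattice \<and> l1 x \<le> real m}"
    have fB: "finite B" unfolding B_def by (rule finite_lattice_l1)
    have cB: "real (card B) \<le> D ^ m"
    proof -
      have 3: "2 * m + 1 \<le> 3 ^ m" by (induction m) auto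
      have "card B \<le> (2 * m + 1) ^ CARD('n)" unfolding B_def by (rule card_lattice_l1)
      also have "\<dots> \<le> (3 ^ m) ^ CARD('n)" by (rule power_mono[OF 3]) simp
      finally have "real (card B) \<le> real ((3 ^ m) ^ CARD('n))" by (rule of_nat_mono)
      then show ?thesis by (simp add: D_def power_mult[symmetric] mult.commute)
    qed
    have 1: "{\<omega>\<in>space M. C * real m < T_upto m p (p + x) \<omega>} \<in> events"
      "prob {\<omega>\<in>space M. C * real m < T_upto m p (p + x) \<omega>} \<le> (1 / (2 * D)) ^ m"
      if x: "x \<in> B" for x
    proof -
      have px: "p + x \<in> lattice" "l1 (p - (p + x)) \<le> real m"
        using x p by (auto simp: B_def intro: lattice_add)
      note [measurable] = measurable_T_upto[OF p px]
      show "{\<omega>\<in>space M. C * real m < T_upto m p (p + x) \<omega>} \<in> events" by measurable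
      obtain xs where xs: "xs \<in> simple_paths m p (p + x)"
        using simple_paths_nonempty[OF p px] by auto
      note xs' = simple_pathsD[OF xs]
      have "prob {\<omega>\<in>space M. C * real m < T_upto m p (p + x) \<omega>}
        \<le> prob {\<omega>\<in>space M. \<alpha> * (C * real m) \<le> \<alpha> * (\<Sum>e\<in>path_edges xs. \<tau> e \<omega>)}"
      proof (rule finite_measure_mono)
        have "T_upto m p (p + x) \<omega> \<le> (\<Sum>e\<in>path_edges xs. \<tau> e \<omega>)" for \<omega>
          using passage_time_upto_le[OF xs] path_time_eq_sum[OF xs'(2)] by simp
        then show "{\<omega>\<in>space M. C * real m < T_upto m p (p + x) \<omega>} \<subseteq>
          {\<omega>\<in>space M. \<alpha> * (C * real m) \<le> \<alpha> * (\<Sum>e\<in>path_edges xs. \<tau> e \<omega>)}"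
          using \<alpha>(1) by (auto intro: less_imp_le less_le_trans)
        have [measurable]: "(\<lambda>\<omega>. \<Sum>e\<in>path_edges xs. \<tau> e \<omega>) \<in> borel_measurable M"
          using path_edges_subset[OF xs'(1)] by (intro borel_measurable_sum measurable_passage) auto
        show "{\<omega>\<in>space M. \<alpha> * (C * real m) \<le> \<alpha> * (\<Sum>e\<in>path_edges xs. \<tau> e \<omega>)} \<in> events" by measurable
      qed
      also have "\<dots> \<le> exp (- (\<alpha> * (C * real m))) * A ^ card (path_edges xs)"
        by (rule chernoff[OF finite_path_edges path_edges_subset[OF xs'(1)] A(1)])
      also have "\<dots> \<le> exp (- (\<alpha> * (C * real m))) * A ^ m"
        using card_path_edges[OF xs'(2)] xs'(5) A(2) by (intro mult_left_mono power_increasing) auto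
      also have "\<dots> = (exp (- (\<alpha> * C)) * A) ^ m"
        by (simp add: power_mult_distrib exp_of_nat_mult[symmetric] mult_ac)
      also have "\<dots> \<le> (1 / (2 * D)) ^ m" using C A(2) by (intro power_mono) auto
      finally show "prob {\<omega>\<in>space M. C * real m < T_upto m p (p + x) \<omega>} \<le> (1 / (2 * D)) ^ m" .
    qed
    have sub: "{\<omega>\<in>space M. \<exists>x\<in>lattice. l1 (x - p) \<le> real m \<and> C * real m < T_upto m p x \<omega>}
        \<subseteq> (\<Union>x\<in>B. {\<omega>\<in>space M. C * real m < T_upto m p (p + x) \<omega>})"
    proof clarify
      fix \<omega> x assume "\<omega> \<in> space M" "x \<in> lattice" "l1 (x - p) \<le> real m" "C * real m < T_upto m p x \<omega>"
      then show "\<omega> \<in> (\<Union>x\<in>B. {\<omega>\<in>space M. C * real m < T_upto m p (p + x) \<omega>})"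
        using p by (intro UN_I[of "x - p"]) (auto simp: B_def lattice_diff)
    qed
    have "prob {\<omega>\<in>space M. \<exists>x\<in>lattice. l1 (x - p) \<le> real m \<and> C * real m < T_upto m p x \<omega>}
      \<le> prob (\<Union>x\<in>B. {\<omega>\<in>space M. C * real m < T_upto m p (p + x) \<omega>})"
      by (rule finite_measure_mono[OF sub]) (intro sets.finite_UN fB 1(1))
    also have "\<dots> \<le> (\<Sum>x\<in>B. prob {\<omega>\<in>space M. C * real m < T_upto m p (p + x) \<omega>})"
      by (rule finite_measure_subadditive_finite[OF fB]) (use 1(1) in auto)
    also have "\<dots> \<le> (\<Sum>x\<in>B. (1 / (2 * D)) ^ m)" by (rule sum_mono) (rule 1(2))
    also have "\<dots> = real (card B) * (1 / (2 * D)) ^ m" by simp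
    also have "\<dots> \<le> D ^ m * (1 / (2 * D)) ^ m" using cB D by (intro mult_right_mono) auto
    also have "\<dots> = (1/2) ^ m" using D by (simp add: power_mult_distrib[symmetric])
    finally show ?thesis .
  qed
  then show ?thesis by (intro exI[of _ C]) (auto simp: C_def)
qed

text \<open>Along any injective relabelling \<open>\<sigma>\<close> of edges the family has the same
  product law. It is used for the identity and for a lattice translation; comparing the two gives
  stationarity.\<close>

lemma distr_family:
  assumes "finite J" "J \<noteq> {}" "\<sigma> ` J \<subseteq> edges" "inj_on \<sigma> J"
  shows "distr M (\<Pi>\<^sub>M e\<in>J. borel) (\<lambda>\<omega>. \<lambda>e\<in>J. \<tau> (\<sigma> e) \<omega>) = (\<Pi>\<^sub>M e\<in>J. \<nu>)"
proof -
  let ?K = "\<sigma> ` J"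
  have rv: "\<tau> e \<in> borel_measurable M" if "e \<in> ?K" for e
    using that assms(3) by (intro measurable_passage) auto
  have "indep_vars (\<lambda>_. borel) \<tau> ?K" by (rule indep_vars_subset[OF indep assms(3)])
  then have d: "distr M (\<Pi>\<^sub>M e\<in>?K. borel) (\<lambda>\<omega>. \<lambda>e\<in>?K. \<tau> e \<omega>) = (\<Pi>\<^sub>M e\<in>?K. distr M borel (\<tau> e))"
    using assms(2) by (subst (asm) indep_vars_iff_distr_eq_PiM') (auto intro: rv)
  also have "\<dots> = (\<Pi>\<^sub>M e\<in>?K. \<nu>)"
    using assms(3) by (intro PiM_cong refl law) auto
  finally have d: "distr M (\<Pi>\<^sub>M e\<in>?K. borel) (\<lambda>\<omega>. \<lambda>e\<in>?K. \<tau> e \<omega>) = (\<Pi>\<^sub>M e\<in>?K. \<nu>)" .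
  have m1: "(\<lambda>\<omega>. \<lambda>e\<in>?K. \<tau> e \<omega>) \<in> measurable M (\<Pi>\<^sub>M e\<in>?K. borel)"
    by (rule measurable_restrict) (rule rv)
  have m2: "(\<lambda>w. \<lambda>e\<in>J. w (\<sigma> e)) \<in> measurable (\<Pi>\<^sub>M e\<in>?K. borel) (\<Pi>\<^sub>M e\<in>J. borel :: real measure)"
    by (rule measurable_restrict) (rule measurable_component_singleton, auto)
  have "(\<Pi>\<^sub>M e\<in>J. \<nu>) = distr (\<Pi>\<^sub>M e\<in>?K. \<nu>) (\<Pi>\<^sub>M e\<in>J. \<nu>) (\<lambda>w. \<lambda>e\<in>J. w (\<sigma> e))"
    by (rule distr_PiM_reindex[symmetric]) (use assms prob_space_law in auto)
  also have "\<dots> = distr (\<Pi>\<^sub>M e\<in>?K. \<nu>) (\<Pi>\<^sub>M e\<in>J. borel) (\<lambda>w. \<lambda>e\<in>J. w (\<sigma> e))"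
    by (intro distr_cong refl sets_PiM_cong sets_law)
  also have "\<dots> = distr M (\<Pi>\<^sub>M e\<in>J. borel) ((\<lambda>w. \<lambda>e\<in>J. w (\<sigma> e)) \<circ> (\<lambda>\<omega>. \<lambda>e\<in>?K. \<tau> e \<omega>))"
    unfolding d[symmetric] by (rule distr_distr[OF m2 m1])
  also have "(\<lambda>w. \<lambda>e\<in>J. w (\<sigma> e)) \<circ> (\<lambda>\<omega>. \<lambda>e\<in>?K. \<tau> e \<omega>) = (\<lambda>\<omega>. \<lambda>e\<in>J. \<tau> (\<sigma> e) \<omega>)"
    by (auto simp: fun_eq_iff restrict_def)
  finally show ?thesis ..
qed

lemma integrable_law_square: "integrable \<nu> (\<lambda>x. x^2)"
proof -
  obtain \<alpha> where \<alpha>: "\<alpha> > 0" "integrable \<nu> (\<lambda>x. exp (\<alpha> * x))" using exp_moment by auto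
  show ?thesis
  proof (rule Bochner_Integration.integrable_bound)
    show "integrable \<nu> (\<lambda>x. 2 / \<alpha>^2 * exp (\<alpha> * x))" using \<alpha>(2) by simp
    show "AE x in \<nu>. norm (x^2) \<le> norm (2 / \<alpha>^2 * exp (\<alpha> * x))"
      using AE_law_pos
    proof eventually_elim
      case (elim x)
      have "0 \<le> \<alpha> * x" using elim \<alpha>(1) by simp
      then have "(\<alpha> * x)^2 / 2 \<le> exp (\<alpha> * x)"
        using exp_lower_Taylor_quadratic[of "\<alpha> * x"] by linarith
      then show ?case using \<alpha>(1) by (simp add: field_simps power_mult_distrib)
    qed
  qed simp
qed

definition min_path_sum :: "nat \<Rightarrow> real^'n \<Rightarrow> real^'n \<Rightarrow> ((real^'n) set \<Rightarrow> real) \<Rightarrow> real" where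
  "min_path_sum k p q = (\<lambda>w. Min ((\<lambda>P. \<Sum>e\<in>P. max 0 (w e)) ` path_edges ` simple_paths k p q))"

text \<open>The extra edge keeps the index set nonempty, as \<open>distr_family\<close> demands: for
  \<open>p = q\<close> the only simple path has one vertex and no edges.\<close>

definition support_edges :: "nat \<Rightarrow> real^'n \<Rightarrow> real^'n \<Rightarrow> (real^'n) set set" where
  "support_edges k p q = insert {0, axis undefined 1} (\<Union> (path_edges ` simple_paths k p q))"

lemma passage_time_upto_eq_min_path_sum:
  assumes "\<And>e. 0 \<le> w e"
  shows "passage_time_upto w k p q = min_path_sum k p q (\<lambda>e\<in>support_edges k p q. w e)"
proof -
  have "path_time w xs = (\<Sum>e\<in>path_edges xs. max 0 ((\<lambda>e\<in>support_edges k p q. w e) e))" if "xs \<in> simple_paths k p q" for xs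
    unfolding path_time_eq_sum[OF simple_pathsD(2)[OF that]]
    by (rule sum.cong) (use that assms in \<open>auto simp: support_edges_def\<close>)
  then show ?thesis unfolding passage_time_upto_def min_path_sum_def image_image by (intro arg_cong[where f=Min] image_cong) auto
qed

lemma support_edges: "finite (support_edges k p q)" "support_edges k p q \<noteq> {}" "support_edges k p q \<subseteq> edges"
proof -
  show "finite (support_edges k p q)" by (simp add: support_edges_def finite_simple_paths)
  show "support_edges k p q \<noteq> {}" by (simp add: support_edges_def)
  show "support_edges k p q \<subseteq> edges"
    unfolding support_edges_def by (rule insert_subsetI[OF edge_exists UN_least[OF path_edges_subset[OF simple_pathsD(1)]]])
qed

lemma T_upto_moments:
  assumes pq: "p \<in> lattice" "q \<in> lattice" "l1 (p - q) \<le> real k"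
  shows "integrable M (T_upto k p q)" "integrable M (\<lambda>\<omega>. (T_upto k p q \<omega>)^2)"
    "variance (T_upto k p q) \<le> real k * (\<integral>x. x^2 \<partial>\<nu>)"
    "v \<in> lattice \<Longrightarrow> expectation (T_upto k (v + p) (v + q)) = expectation (T_upto k p q)"
proof -
  let ?J = "support_edges k p q" and ?f = "min_path_sum k p q"
  let ?N = "\<Pi>\<^sub>M e\<in>?J. \<nu>"
  have P: "finite (path_edges ` simple_paths k p q)" "path_edges ` simple_paths k p q \<noteq> {}"
    "P \<in> path_edges ` simple_paths k p q \<Longrightarrow> P \<subseteq> support_edges k p q"
    "P \<in> path_edges ` simple_paths k p q \<Longrightarrow> card P \<le> k" for P
  proof -
    assume "P \<in> path_edges ` simple_paths k p q"
    then obtain xs where xs: "xs \<in> simple_paths k p q" "P = path_edges xs" by blast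
    show "P \<subseteq> support_edges k p q" unfolding support_edges_def xs(2) using xs(1) by blast
    show "card P \<le> k" unfolding xs(2) card_path_edges[OF simple_pathsD(2)[OF xs(1)]]
      using simple_pathsD(5)[OF xs(1)] by linarith
  qed (simp_all add: finite_simple_paths simple_paths_nonempty[OF pq])
  have V: "integrable ?N ?f" "integrable ?N (\<lambda>w. (?f w)^2)"
    "(\<integral>w. (?f w)^2 \<partial>?N) - (\<integral>w. ?f w \<partial>?N)^2 \<le> real k * (\<integral>x. x^2 \<partial>\<nu>)"
    unfolding min_path_sum_def
    by (rule variance_Min_sum_le[OF prob_space_law sets_law support_edges(1) P integrable_law_square]; assumption)+
  have sN: "sets ?N = sets (\<Pi>\<^sub>M e\<in>?J. borel)" by (intro sets_PiM_cong refl sets_law)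
  have fm: "?f \<in> borel_measurable (\<Pi>\<^sub>M e\<in>?J. borel)" "(\<lambda>w. (?f w)^2) \<in> borel_measurable (\<Pi>\<^sub>M e\<in>?J. borel)"
    using borel_measurable_integrable[OF V(1)] borel_measurable_integrable[OF V(2)]
    by (simp_all add: measurable_cong_sets[OF sN refl])
  \<comment> \<open>The identity as \<open>\<sigma>\<close> gives the time from \<open>p\<close> to
    \<open>q\<close>, translation by \<open>v\<close> the time between the shifted points; both
    expectations become the same integral over the product space.\<close>
  have transfer: "integrable M (\<lambda>\<omega>. g (\<lambda>e\<in>?J. \<tau> (\<sigma> e) \<omega>)) \<longleftrightarrow> integrable ?N g"
     "(\<integral>\<omega>. g (\<lambda>e\<in>?J. \<tau> (\<sigma> e) \<omega>) \<partial>M) = (\<integral>w. g w \<partial>?N)"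
    if "\<sigma> ` ?J \<subseteq> edges" "inj_on \<sigma> ?J" "g \<in> borel_measurable (\<Pi>\<^sub>M e\<in>?J. borel)"
    for \<sigma> and g :: "_ \<Rightarrow> real"
  proof -
    have m: "(\<lambda>\<omega>. \<lambda>e\<in>?J. \<tau> (\<sigma> e) \<omega>) \<in> measurable M (\<Pi>\<^sub>M e\<in>?J. borel)"
      by (rule measurable_restrict) (use that(1) in \<open>auto intro!: measurable_passage\<close>)
    note d = distr_family[OF support_edges(1,2) that(1,2), symmetric]
    show "integrable M (\<lambda>\<omega>. g (\<lambda>e\<in>?J. \<tau> (\<sigma> e) \<omega>)) \<longleftrightarrow> integrable ?N g"
      unfolding d by (rule integrable_distr_eq[OF m that(3), symmetric])
    show "(\<integral>\<omega>. g (\<lambda>e\<in>?J. \<tau> (\<sigma> e) \<omega>) \<partial>M) = (\<integral>w. g w \<partial>?N)"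
      unfolding d by (rule integral_distr[OF m that(3), symmetric])
  qed
  have T: "T_upto k p q \<omega> = ?f (\<lambda>e\<in>?J. \<tau> e \<omega>)" for \<omega>
    by (rule passage_time_upto_eq_min_path_sum[OF nonneg])
  have id: "(\<lambda>e. e) ` ?J \<subseteq> edges" "inj_on (\<lambda>e. e) ?J" using support_edges(3) by (auto simp: inj_on_def)
  note t1 = transfer[OF id fm(1)] and t2 = transfer[OF id fm(2)]
  show i1: "integrable M (T_upto k p q)" unfolding T using t1(1) V(1) by simp
  show i2: "integrable M (\<lambda>\<omega>. (T_upto k p q \<omega>)^2)" unfolding T using t2(1) V(2) by simp
  show "variance (T_upto k p q) \<le> real k * (\<integral>x. x^2 \<partial>\<nu>)"
    unfolding variance_eq[OF i1 i2] unfolding T using t1(2) t2(2) V(3) by simp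
  assume v: "v \<in> lattice"
  have s: "(`) ((+) v) ` ?J \<subseteq> edges"
  proof
    fix e assume "e \<in> (`) ((+) v) ` ?J"
    then obtain e' where e': "e' \<in> edges" "e = (+) v ` e'" using support_edges(3) by blast
    then obtain x y where "e' = {x, y}" by (auto simp: edges_def)
    then show "e \<in> edges" using e' shift_edge_iff[OF v, of x y] by simp
  qed
  have inj: "inj_on ((`) ((+) v)) ?J" by (rule inj_on_image) simp
  have "T_upto k (v + p) (v + q) \<omega> = ?f (\<lambda>e\<in>?J. \<tau> ((+) v ` e) \<omega>)" for \<omega>
    unfolding passage_time_upto_shift[OF v] by (rule passage_time_upto_eq_min_path_sum[OF nonneg])
  then show "expectation (T_upto k (v + p) (v + q)) = expectation (T_upto k p q)"
    using transfer(2)[OF s inj fm(1)] t1(2) unfolding T by simp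
qed

end

section \<open>Almost sure behaviour along dyadic scales\<close>

text \<open>Limits between two moving points are included because distances between arbitrary points
  of the ball enter the Frechet functional. \<open>N\<close> is constrained at lattice points
  only.\<close>

locale good_weights =
  fixes w :: "(real^'n) set \<Rightarrow> real" and N :: "real^'n \<Rightarrow> real" and C \<delta> :: real
  assumes w_nonneg: "\<forall>e\<in>edges. 0 \<le> w e" and C_pos: "0 < C" and \<delta>_pos: "0 < \<delta>"
    and dyadic_limit: "\<And>z z'. z \<in> lattice \<Longrightarrow> z' \<in> lattice \<Longrightarrow>
      (\<lambda>j. passage_time w (2 ^ j *\<^sub>R z) (2 ^ j *\<^sub>R z') / 2 ^ j) \<longlonglongrightarrow> N (z' - z)"
    and dyadic_upper: "\<And>z R. z \<in> lattice \<Longrightarrow> 0 < R \<Longrightarrow> \<forall>\<^sub>F j in sequentially. \<forall>x\<in>lattice.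
      l1 (x - 2 ^ j *\<^sub>R z) \<le> real R * 2 ^ j \<longrightarrow> passage_time w (2 ^ j *\<^sub>R z) x \<le> C * (real R * 2 ^ j)"
    and lower: "\<forall>\<^sub>F m in sequentially. \<forall>y\<in>lattice. real m \<le> l1 y \<longrightarrow> \<delta> * real m \<le> passage_time w 0 y"

lemma countable_lattice: "countable (lattice :: (real^'n) set)"
proof -
  have "lattice \<subseteq> (\<Union>m::nat. {x::real^'n. x \<in> lattice \<and> l1 x \<le> real m})"
    using real_arch_simple by blast
  then show ?thesis
    by (rule countable_subset) (intro countable_UN countable_finite finite_lattice_l1 countableI_type)
qed

lemma le_mult_pow2: "0 < K \<Longrightarrow> j \<le> K * (2::nat) ^ j"
  using less_exp[of j] by (metis One_nat_def Suc_leI less_imp_le mult_1 mult_le_mono1 order_trans)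

lemma convergent_of_antimono_nonneg:
  fixes X :: "nat \<Rightarrow> real"
  assumes "\<And>n. X (Suc n) \<le> X n" "\<And>n. 0 \<le> X n"
  shows "convergent X"
proof -
  have "decseq X" by (rule decseq_SucI) (rule assms(1))
  then show ?thesis
    using assms(2) by (intro Bseq_monoseq_convergent decseq_bounded[of X 0] decseq_imp_monoseq) auto
qed

lemma pow2_Suc_scaleR: "2 ^ Suc j *\<^sub>R u = 2 ^ j *\<^sub>R u + 2 ^ j *\<^sub>R (u :: 'a::real_vector)"
  unfolding scaleR_add_left[symmetric] by simp

lemma lattice_pow2: "z \<in> lattice \<Longrightarrow> 2 ^ j *\<^sub>R z \<in> lattice"
  by (rule lattice_scaleR) simp_all

context first_passage
begin

abbreviation W :: "'w \<Rightarrow> (real^'n) set \<Rightarrow> real" where "W \<omega> \<equiv> (\<lambda>e. \<tau> e \<omega>)"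

lemma W_nonneg: "\<forall>e\<in>edges. 0 \<le> W \<omega> e"
  using nonneg by simp

lemma AE_eventually_not:
  assumes "\<And>j. A j \<in> events" "\<And>j. prob (A j) \<le> c * (1/2) ^ j"
  shows "AE \<omega> in M. \<forall>\<^sub>F j in sequentially. \<omega> \<notin> A j"
proof -
  have "summable (\<lambda>j. c * (1/2::real) ^ j)" by (intro summable_mult summable_geometric) simp
  then have "summable (\<lambda>j. prob (A j))"
    by (rule summable_comparison_test') (use assms(2) in auto)
  then have "AE \<omega> in M. \<forall>\<^sub>F j in sequentially. \<omega> \<in> space M - A j"
    by (intro borel_cantelli_AE1 assms(1)) (simp add: emeasure_eq_measure)
  then show ?thesis by eventually_elim (auto elim: eventually_mono)
qed

lemma fast_event:
  assumes p: "p \<in> lattice"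
  shows "{\<omega>\<in>space M. \<exists>x\<in>lattice. l1 (x - p) \<le> real m \<and> a < T_upto m p x \<omega>} \<in> events"
proof -
  let ?B = "{x::real^'n. x \<in> lattice \<and> l1 x \<le> real m}"
  have "{\<omega>\<in>space M. a < T_upto m p (x + p) \<omega>} \<in> events" if "x \<in> ?B" for x
  proof -
    have [measurable]: "T_upto m p (x + p) \<in> borel_measurable M"
      using that p by (intro measurable_T_upto) (auto intro: lattice_add simp: l1_minus_commute[of p])
    show ?thesis by measurable
  qed
  then have "(\<Union>x\<in>?B. {\<omega>\<in>space M. a < T_upto m p (x + p) \<omega>}) \<in> events"
    by (intro sets.finite_UN finite_lattice_l1)
  also have "(\<Union>x\<in>?B. {\<omega>\<in>space M. a < T_upto m p (x + p) \<omega>}) =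
    {\<omega>\<in>space M. \<exists>x\<in>lattice. l1 (x - p) \<le> real m \<and> a < T_upto m p x \<omega>}" (is "?L = ?R")
  proof
    show "?L \<subseteq> ?R" using p by (auto intro!: lattice_add bexI[of _ "_ + p"])
    show "?R \<subseteq> ?L"
    proof
      fix \<omega> assume "\<omega> \<in> ?R"
      then obtain x where x: "\<omega> \<in> space M" "x \<in> lattice" "l1 (x - p) \<le> real m" "a < T_upto m p x \<omega>" by blast
      then show "\<omega> \<in> ?L" using lattice_diff[OF x(2) p] by (intro UN_I[of "x - p"]) auto
    qed
  qed
  finally show ?thesis .
qed

text \<open>The variance is at most a constant times \<open>2 ^ j\<close>, so a deviation of
  \<open>2 ^ j / (n + 1)\<close> has probability at most a constant times
  \<open>(n + 1)^2 / 2 ^ j\<close>, summable in \<open>j\<close>. Countably many tolerances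
  \<open>1 / (n + 1)\<close> give convergence to 0.\<close>

lemma deviation:
  assumes "\<And>j. p j \<in> lattice" "\<And>j. q j \<in> lattice" "\<And>j. l1 (p j - q j) \<le> real (K * 2 ^ j)"
  shows "AE \<omega> in M. (\<lambda>j. (T_upto (K * 2 ^ j) (p j) (q j) \<omega> - expectation (T_upto (K * 2 ^ j) (p j) (q j))) / 2 ^ j) \<longlonglongrightarrow> 0"
proof -
  let ?X = "\<lambda>j \<omega>. T_upto (K * 2 ^ j) (p j) (q j) \<omega>"
  have m[measurable]: "?X j \<in> borel_measurable M" for j
    by (rule measurable_T_upto) (rule assms)+
  define s where "s = (\<integral>x. x^2 \<partial>\<nu>)"
  have "AE \<omega> in M. \<forall>\<^sub>F j in sequentially. \<omega> \<notin> {\<omega>\<in>space M. \<bar>?X j \<omega> - expectation (?X j)\<bar> \<ge> 2 ^ j / real (Suc n)}" for n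
  proof (rule AE_eventually_not[where c="real K * s * (real (Suc n))^2"])
    fix j
    show "{\<omega>\<in>space M. \<bar>?X j \<omega> - expectation (?X j)\<bar> \<ge> 2 ^ j / real (Suc n)} \<in> events" by measurable
    note mom = T_upto_moments[OF assms(1,2,3)[of j]]
    have "prob {\<omega>\<in>space M. \<bar>?X j \<omega> - expectation (?X j)\<bar> \<ge> 2 ^ j / real (Suc n)} \<le> variance (?X j) / (2 ^ j / real (Suc n))^2"
      by (rule Chebyshev_inequality[OF m mom(2)]) simp
    also have "\<dots> \<le> (real (K * 2 ^ j) * s) / (2 ^ j / real (Suc n))^2"
      unfolding s_def by (rule divide_right_mono[OF mom(3)]) simp
    also have "\<dots> = real K * s * (real (Suc n))^2 * (1/2) ^ j"
      by (simp add: field_simps power2_eq_square)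
    finally show "prob {\<omega>\<in>space M. \<bar>?X j \<omega> - expectation (?X j)\<bar> \<ge> 2 ^ j / real (Suc n)} \<le> real K * s * (real (Suc n))^2 * (1/2) ^ j" .
  qed
  then have "AE \<omega> in M. \<forall>n. \<forall>\<^sub>F j in sequentially. \<omega> \<notin> {\<omega>\<in>space M. \<bar>?X j \<omega> - expectation (?X j)\<bar> \<ge> 2 ^ j / real (Suc n)}"
    by (subst AE_all_countable) blast
  then show ?thesis using AE_space
  proof eventually_elim
    case (elim \<omega>)
    show ?case
    proof (rule LIMSEQ_I)
      fix r :: real assume "0 < r"
      then obtain n where n: "1 / real (Suc n) < r" using nat_approx_posE by (metis)
      have "\<forall>\<^sub>F j in sequentially. norm ((?X j \<omega> - expectation (?X j)) / 2 ^ j - 0) < r"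
        using elim(1)[rule_format, of n]
      proof eventually_elim
        case (elim j)
        then have "\<bar>?X j \<omega> - expectation (?X j)\<bar> < 2 ^ j / real (Suc n)" using \<open>\<omega> \<in> space M\<close> by auto
        then have "\<bar>?X j \<omega> - expectation (?X j)\<bar> / 2 ^ j < 1 / real (Suc n)" by (simp add: field_simps)
        then show ?case using n by simp
      qed
      then show "\<exists>no. \<forall>j\<ge>no. norm ((?X j \<omega> - expectation (?X j)) / 2 ^ j - 0) < r"
        by (simp add: eventually_sequentially)
    qed
  qed
qed

text \<open>Joining paths for two adjacent copies of the problem at scale \<open>j\<close> gives a
  path at scale \<open>j + 1\<close> within twice the edge budget. By translation invariance both
  copies have mean \<open>e j\<close>, so \<open>e j / 2 ^ j\<close> is nonincreasing.\<close>

lemma expectation_limit: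
  assumes u: "u \<in> lattice" "l1 u \<le> real K"
  shows "convergent (\<lambda>j. expectation (T_upto (K * 2 ^ j) 0 (2 ^ j *\<^sub>R u)) / 2 ^ j)"
proof -
  define e where "e j = expectation (T_upto (K * 2 ^ j) 0 (2 ^ j *\<^sub>R u))" for j
  have lat: "2 ^ j *\<^sub>R u \<in> lattice" for j by (rule lattice_pow2[OF u(1)])
  have dist: "l1 (0 - 2 ^ j *\<^sub>R u) \<le> real (K * 2 ^ j)" for j
    using u(2) by (simp add: mult.commute)
  note mom = T_upto_moments[OF lattice_0 lat dist]
  have dist': "l1 (2 ^ j *\<^sub>R u - (2 ^ j *\<^sub>R u + 2 ^ j *\<^sub>R u)) \<le> real (K * 2 ^ j)" for j
    using dist[of j] by (simp only: diff_add_eq_diff_diff_swap diff_self)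
  note mom' = T_upto_moments[OF lat lattice_add[OF lat lat] dist']
  have e0: "e j \<ge> 0" for j
    unfolding e_def by (rule Bochner_Integration.integral_nonneg) (rule passage_time_upto_nonneg[OF W_nonneg lattice_0 lat dist])
  have eS: "e (Suc j) \<le> 2 * e j" for j
  proof -
    have "e (Suc j) \<le> (\<integral>\<omega>. T_upto (K * 2 ^ j) 0 (2 ^ j *\<^sub>R u) \<omega> + T_upto (K * 2 ^ j) (2 ^ j *\<^sub>R u) (2 ^ j *\<^sub>R u + 2 ^ j *\<^sub>R u) \<omega> \<partial>M)"
      unfolding e_def
    proof (rule integral_mono)
      fix \<omega>
      have K: "K * 2 ^ Suc j = K * 2 ^ j + K * 2 ^ j" by simp
      show "T_upto (K * 2 ^ Suc j) 0 (2 ^ Suc j *\<^sub>R u) \<omega> \<le>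
        T_upto (K * 2 ^ j) 0 (2 ^ j *\<^sub>R u) \<omega> + T_upto (K * 2 ^ j) (2 ^ j *\<^sub>R u) (2 ^ j *\<^sub>R u + 2 ^ j *\<^sub>R u) \<omega>"
        unfolding pow2_Suc_scaleR K
        by (rule passage_time_upto_triangle[OF W_nonneg lattice_0 lat lattice_add[OF lat lat] dist dist'])
      show "integrable M (T_upto (K * 2 ^ Suc j) 0 (2 ^ Suc j *\<^sub>R u))" by (rule mom(1))
    qed (intro Bochner_Integration.integrable_add mom(1) mom'(1))
    also have "\<dots> = e j + expectation (T_upto (K * 2 ^ j) (2 ^ j *\<^sub>R u) (2 ^ j *\<^sub>R u + 2 ^ j *\<^sub>R u))"
      unfolding e_def by (rule Bochner_Integration.integral_add[OF mom(1) mom'(1)])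
    also have "expectation (T_upto (K * 2 ^ j) (2 ^ j *\<^sub>R u) (2 ^ j *\<^sub>R u + 2 ^ j *\<^sub>R u)) = e j"
      unfolding e_def using mom(4)[OF lat, of j j] by simp
    finally show ?thesis by simp
  qed
  have "e (Suc j) / 2 ^ Suc j \<le> e j / 2 ^ j" for j
    using eS[of j] by (simp add: field_simps)
  then show ?thesis
    using e0 unfolding e_def[symmetric] by (intro convergent_of_antimono_nonneg) auto
qed

theorem AE_good_weights: "\<exists>N C \<delta>. AE \<omega> in M. good_weights (W \<omega>) N C \<delta>"
proof -
  obtain \<delta> where \<delta>: "\<delta> > 0"
    "prob {\<omega>\<in>space M. \<exists>xs\<in>paths_from m p. path_time (W \<omega>) xs < \<delta> * real m} \<le> (1/2) ^ m" for p m
    using long_paths_slow by blast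
  obtain C where C: "C > 0"
    "p \<in> lattice \<Longrightarrow> prob {\<omega>\<in>space M. \<exists>x\<in>lattice. l1 (x - p) \<le> real m \<and> C * real m < T_upto m p x \<omega>} \<le> (1/2) ^ m" for p m
    using short_paths_fast by blast
  \<comment> \<open>With \<open>j \<le> k j\<close> the tail bound at \<open>k j\<close> is at most
    \<open>(1/2) ^ j\<close>, hence summable for any starting points \<open>p j\<close>.\<close>
  have slow: "AE \<omega> in M. \<forall>\<^sub>F j in sequentially. \<forall>xs\<in>paths_from (k j) (p j). \<delta> * real (k j) \<le> path_time (W \<omega>) xs"
    if k: "\<And>j. j \<le> k j" for k p
  proof -
    have "AE \<omega> in M. \<forall>\<^sub>F j in sequentially. \<omega> \<notin> {\<omega>\<in>space M. \<exists>xs\<in>paths_from (k j) (p j). path_time (W \<omega>) xs < \<delta> * real (k j)}"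
    proof (rule AE_eventually_not[where c=1, OF slow_event])
      fix j
      have "(1/2::real) ^ k j \<le> (1/2) ^ j" by (rule power_decreasing[OF k]) auto
      then show "prob {\<omega>\<in>space M. \<exists>xs\<in>paths_from (k j) (p j). path_time (W \<omega>) xs < \<delta> * real (k j)} \<le> 1 * (1/2) ^ j"
        using \<delta>(2)[of "k j" "p j"] by linarith
    qed
    then show ?thesis using AE_space
    proof eventually_elim
      case (elim \<omega>)
      from elim(1) show ?case by eventually_elim (use elim(2) in force)
    qed
  qed
  have fast: "AE \<omega> in M. \<forall>\<^sub>F j in sequentially. \<forall>x\<in>lattice. l1 (x - p j) \<le> real (k j) \<longrightarrow> T_upto (k j) (p j) x \<omega> \<le> C * real (k j)"
    if k: "\<And>j. j \<le> k j" and p: "\<And>j. p j \<in> lattice" for k p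
  proof -
    have "AE \<omega> in M. \<forall>\<^sub>F j in sequentially. \<omega> \<notin> {\<omega>\<in>space M. \<exists>x\<in>lattice. l1 (x - p j) \<le> real (k j) \<and> C * real (k j) < T_upto (k j) (p j) x \<omega>}"
    proof (rule AE_eventually_not[where c=1, OF fast_event[OF p]])
      fix j
      have "(1/2::real) ^ k j \<le> (1/2) ^ j" by (rule power_decreasing[OF k]) auto
      then show "prob {\<omega>\<in>space M. \<exists>x\<in>lattice. l1 (x - p j) \<le> real (k j) \<and> C * real (k j) < T_upto (k j) (p j) x \<omega>} \<le> 1 * (1/2) ^ j"
        using C(2)[of "p j" "k j", OF p] by linarith
    qed
    then show ?thesis using AE_space
    proof eventually_elim
      case (elim \<omega>)
      from elim(1) show ?case by eventually_elim (use elim(2) in force)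
    qed
  qed
  \<comment> \<open>Since \<open>C \<le> \<delta> * L\<close>, paths with more than
    \<open>L * R * 2 ^ j\<close> edges cost at least the upper bound \<open>C * R * 2 ^ j\<close>,
    so the restricted and the full passage time coincide.\<close>
  define L where "L = nat \<lceil>max 1 (C / \<delta>)\<rceil>"
  have L: "0 < L" "C \<le> \<delta> * real L"
  proof -
    have "max 1 (C / \<delta>) \<le> real L" unfolding L_def by (rule real_nat_ceiling_ge)
    then show "0 < L" "C \<le> \<delta> * real L" using \<delta>(1) by (auto simp: field_simps intro: Nat.gr0I)
  qed
  \<comment> \<open>At least 1 even for \<open>u = 0\<close>, so that \<open>R u * 2 ^ j\<close>
    grows with \<open>j\<close>, as the tail bounds require.\<close>
  define R where "R u = max 1 (nat \<lceil>l1 u\<rceil>)" for u :: "real^'n"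
  have R: "0 < R u" "l1 u \<le> real (R u)" for u
  proof -
    have "l1 u \<le> real (nat \<lceil>l1 u\<rceil>)" by (rule real_nat_ceiling_ge)
    also have "\<dots> \<le> real (R u)" unfolding R_def by (rule of_nat_mono) simp
    finally show "l1 u \<le> real (R u)" .
  qed (simp add: R_def)
  \<comment> \<open>A limit of expectations, hence independent of the outcome; stationarity makes it
    depend on the difference of the endpoints only.\<close>
  define N where "N u = lim (\<lambda>j. expectation (T_upto ((L * R u) * 2 ^ j) 0 (2 ^ j *\<^sub>R u)) / 2 ^ j)" for u
  have lim: "AE \<omega> in M. (\<lambda>j. passage_time (W \<omega>) (2 ^ j *\<^sub>R z) (2 ^ j *\<^sub>R z') / 2 ^ j) \<longlonglongrightarrow> N (z' - z)"
    if z: "z \<in> lattice" "z' \<in> lattice" for z z'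
  proof -
    let ?u = "z' - z"
    let ?K = "L * R ?u"
    let ?p = "\<lambda>j. 2 ^ j *\<^sub>R z" and ?q = "\<lambda>j. 2 ^ j *\<^sub>R z'"
    have u: "?u \<in> lattice" using z by (simp add: lattice_diff)
    have RK: "R ?u \<le> ?K" using L(1) by simp
    have K: "0 < ?K" "l1 ?u \<le> real ?K"
      using L(1) R[of ?u] RK by (simp, meson order_trans of_nat_mono)
    have lat: "?p j \<in> lattice" "?q j \<in> lattice" for j using z by (simp_all add: lattice_pow2)
    have dpq: "l1 (?p j - ?q j) = 2 ^ j * l1 ?u" for j
      by (simp add: l1_minus_commute[of z' z] flip: scaleR_diff_right)
    have dK: "l1 (?p j - ?q j) \<le> real (?K * 2 ^ j)" for j
      using mult_left_mono[OF K(2), of "2 ^ j"] unfolding dpq by (simp add: mult.commute)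
    have dR: "l1 (?p j - ?q j) \<le> real (R ?u * 2 ^ j)" for j
      using mult_left_mono[OF R(2)[of ?u], of "2 ^ j"] unfolding dpq by (simp add: mult.commute)
    have "expectation (T_upto (?K * 2 ^ j) (?p j) (?q j)) = expectation (T_upto (?K * 2 ^ j) 0 (2 ^ j *\<^sub>R ?u))" for j
    proof -
      have "l1 (0 - 2 ^ j *\<^sub>R ?u) \<le> real (?K * 2 ^ j)" using dK[of j] unfolding dpq by simp
      from T_upto_moments(4)[OF lattice_0 lattice_pow2[OF u] this lat(1)[of j]]
      show ?thesis by (simp add: scaleR_diff_right)
    qed
    then have e: "(\<lambda>j. expectation (T_upto (?K * 2 ^ j) (?p j) (?q j)) / 2 ^ j) \<longlonglongrightarrow> N ?u"
      using expectation_limit[OF u K(2)] unfolding N_def by (simp add: convergent_LIMSEQ_iff)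
    have kj: "j \<le> ?K * 2 ^ j" "j \<le> R ?u * 2 ^ j" for j
      using le_mult_pow2[OF K(1)] le_mult_pow2[OF R(1)] by auto
    from slow[of "\<lambda>j. ?K * 2 ^ j" ?p, OF kj(1)] fast[of "\<lambda>j. R ?u * 2 ^ j" ?p, OF kj(2) lat(1)] deviation[of ?p ?q ?K, OF lat dK]
    show ?thesis
    proof eventually_elim
      case (elim \<omega>)
      have "(\<lambda>j. (T_upto (?K * 2 ^ j) (?p j) (?q j) \<omega> - expectation (T_upto (?K * 2 ^ j) (?p j) (?q j))) / 2 ^ j
        + expectation (T_upto (?K * 2 ^ j) (?p j) (?q j)) / 2 ^ j) \<longlonglongrightarrow> 0 + N ?u"
        by (rule tendsto_add[OF elim(3) e])
      then have t: "(\<lambda>j. T_upto (?K * 2 ^ j) (?p j) (?q j) \<omega> / 2 ^ j) \<longlonglongrightarrow> N ?u"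
        by (simp add: diff_divide_distrib)
      have ev: "\<forall>\<^sub>F j in sequentially. T_upto (?K * 2 ^ j) (?p j) (?q j) \<omega> / 2 ^ j = passage_time (W \<omega>) (?p j) (?q j) / 2 ^ j"
        using elim(1,2)
      proof eventually_elim
        case (elim j)
        have "R ?u * 2 ^ j \<le> ?K * 2 ^ j" using RK by simp
        then have "T_upto (?K * 2 ^ j) (?p j) (?q j) \<omega> \<le> T_upto (R ?u * 2 ^ j) (?p j) (?q j) \<omega>"
          by (rule passage_time_upto_antimono[OF lat dR])
        also have "\<dots> \<le> C * real (R ?u * 2 ^ j)"
          using elim(2) lat(2) dR[of j] by (simp add: l1_minus_commute)
        also have "\<dots> \<le> (\<delta> * real L) * real (R ?u * 2 ^ j)" by (rule mult_right_mono[OF L(2)]) simp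
        also have "\<dots> = \<delta> * real (?K * 2 ^ j)" by simp
        finally have "T_upto (?K * 2 ^ j) (?p j) (?q j) \<omega> \<le> \<delta> * real (?K * 2 ^ j)" .
        from passage_time_eq_upto[OF W_nonneg lat dK _ this] elim(1)
        show ?case by simp
      qed
      show ?case by (rule Lim_transform_eventually[OF t ev])
    qed
  qed
  have up: "AE \<omega> in M. \<forall>\<^sub>F j in sequentially. \<forall>x\<in>lattice.
      l1 (x - 2 ^ j *\<^sub>R z) \<le> real R * 2 ^ j \<longrightarrow> passage_time (W \<omega>) (2 ^ j *\<^sub>R z) x \<le> C * (real R * 2 ^ j)"
    if z: "z \<in> lattice" and R: "0 < R" for z and R :: nat
    using fast[of "\<lambda>j. R * 2 ^ j" "\<lambda>j. 2 ^ j *\<^sub>R z", OF le_mult_pow2[OF R] lattice_pow2[OF z]]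
  proof eventually_elim
    case (elim \<omega>)
    then show ?case
    proof eventually_elim
      case (elim j)
      show ?case
      proof (intro ballI impI)
        fix x :: "real^'n" assume x: "x \<in> lattice" "l1 (x - 2 ^ j *\<^sub>R z) \<le> real R * 2 ^ j"
        have "passage_time (W \<omega>) (2 ^ j *\<^sub>R z) x \<le> T_upto (R * 2 ^ j) (2 ^ j *\<^sub>R z) x \<omega>"
          by (rule passage_time_le_upto[OF W_nonneg lattice_pow2[OF z] x(1)]) (use x(2) in \<open>simp add: l1_minus_commute\<close>)
        also have "\<dots> \<le> C * (real R * 2 ^ j)" using elim x by simp
        finally show "passage_time (W \<omega>) (2 ^ j *\<^sub>R z) x \<le> C * (real R * 2 ^ j)" .
      qed
    qed
  qed
  have "AE \<omega> in M. \<forall>z\<in>lattice. \<forall>z'\<in>lattice. (\<lambda>j. passage_time (W \<omega>) (2 ^ j *\<^sub>R z) (2 ^ j *\<^sub>R z') / 2 ^ j) \<longlonglongrightarrow> N (z' - z)"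
    by (intro AE_ball_countable' countable_lattice lim)
  moreover have "AE \<omega> in M. \<forall>z\<in>lattice. \<forall>R\<in>{0<..}. \<forall>\<^sub>F j in sequentially. \<forall>x\<in>lattice.
      l1 (x - 2 ^ j *\<^sub>R z) \<le> real R * 2 ^ j \<longrightarrow> passage_time (W \<omega>) (2 ^ j *\<^sub>R z) x \<le> C * (real R * 2 ^ j)"
    by (intro AE_ball_countable' countable_lattice countableI_type up) auto
  moreover have "AE \<omega> in M. \<forall>\<^sub>F m in sequentially. \<forall>y\<in>lattice. real m \<le> l1 y \<longrightarrow> \<delta> * real m \<le> passage_time (W \<omega>) 0 y"
    using slow[of "\<lambda>j. j" "\<lambda>_. 0", OF order_refl]
  proof eventually_elim
    case (elim \<omega>)
    then show ?case
    proof eventually_elim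
      case (elim m)
      show ?case
      proof (intro ballI impI)
        fix y :: "real^'n" assume y: "y \<in> lattice" "real m \<le> l1 y"
        show "\<delta> * real m \<le> passage_time (W \<omega>) 0 y"
          by (rule passage_time_ge_of_far[OF W_nonneg lattice_0 y(1), of m]) (use y(2) elim in auto)
      qed
    qed
  qed
  ultimately have "AE \<omega> in M. good_weights (W \<omega>) N C \<delta>"
  proof eventually_elim
    case (elim \<omega>)
    then show ?case using W_nonneg C(1) \<delta>(1) by unfold_locales auto
  qed
  then show ?thesis by blast
qed

end

section \<open>The limit norm and uniform convergence\<close>

definition lattice_floor :: "real^'n \<Rightarrow> real^'n" where
  "lattice_floor v = (\<chi> i. of_int \<lfloor>v $ i\<rfloor>)"

lemma lattice_floor_in_lattice [simp]: "lattice_floor v \<in> lattice"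
  by (simp add: lattice_floor_def lattice_def)

lemma l1_lattice_floor: "l1 (lattice_floor v - v) \<le> real CARD('n)" for v :: "real^'n"
proof -
  have "l1 (lattice_floor v - v) \<le> (\<Sum>i\<in>(UNIV::'n set). 1)"
    unfolding l1_def by (intro sum_mono) (simp add: lattice_floor_def, linarith)
  then show ?thesis by simp
qed

text \<open>The floor of \<open>2 * a\<close> is twice the floor of \<open>a\<close> or one more.
  This error does not grow with the scale, so it becomes summable after division by
  \<open>2 ^ j\<close>.\<close>

lemma l1_lattice_floor_double: "l1 (lattice_floor (2 *\<^sub>R v) - 2 *\<^sub>R lattice_floor v) \<le> real CARD('n)" for v :: "real^'n"
proof -
  have "l1 (lattice_floor (2 *\<^sub>R v) - 2 *\<^sub>R lattice_floor v) \<le> (\<Sum>i\<in>(UNIV::'n set). 1)"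
    unfolding l1_def
  proof (rule sum_mono)
    fix i
    have "2 * \<lfloor>v $ i\<rfloor> \<le> \<lfloor>2 * v $ i\<rfloor>" "\<lfloor>2 * v $ i\<rfloor> \<le> 2 * \<lfloor>v $ i\<rfloor> + 1" by linarith+
    then have "real_of_int (2 * \<lfloor>v $ i\<rfloor>) \<le> real_of_int \<lfloor>2 * v $ i\<rfloor>"
      "real_of_int \<lfloor>2 * v $ i\<rfloor> \<le> real_of_int (2 * \<lfloor>v $ i\<rfloor> + 1)" by (simp_all only: of_int_le_iff)
    then have "\<bar>real_of_int \<lfloor>2 * v $ i\<rfloor> - 2 * real_of_int \<lfloor>v $ i\<rfloor>\<bar> \<le> 1" by simp
    then show "\<bar>(lattice_floor (2 *\<^sub>R v) - 2 *\<^sub>R lattice_floor v) $ i\<bar> \<le> 1" unfolding lattice_floor_def by simp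
  qed
  then show ?thesis by simp
qed

text \<open>Extends a function from lattice points by rounding at dyadic scales. Powers of two fit
  the limits at hand, which give doubling before any other homogeneity.\<close>

definition norm_ext :: "(real^'n \<Rightarrow> real) \<Rightarrow> real^'n \<Rightarrow> real" where
  "norm_ext N v = lim (\<lambda>j. N (lattice_floor (2 ^ j *\<^sub>R v)) / 2 ^ j)"

lemma tendsto_div_pow2: "(\<lambda>j. c / 2 ^ j :: real) \<longlonglongrightarrow> 0"
  by (rule LIMSEQ_divide_realpow_zero) simp

lemma tendsto_of_pow2_bound:
  fixes a :: "nat \<Rightarrow> real"
  assumes "\<And>j. \<bar>a j - 2 ^ j * l\<bar> \<le> c"
  shows "(\<lambda>j. a j / 2 ^ j) \<longlonglongrightarrow> l"
proof (rule Lim_null_comparison[THEN LIM_zero_cancel])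
  show "\<forall>\<^sub>F j in sequentially. norm (a j / 2 ^ j - l) \<le> c / 2 ^ j"
  proof (rule always_eventually, rule allI)
    fix j
    have "a j / 2 ^ j - l = (a j - 2 ^ j * l) / 2 ^ j" by (simp add: field_simps)
    then show "norm (a j / 2 ^ j - l) \<le> c / 2 ^ j"
      using divide_right_mono[OF assms[of j], of "2 ^ j"] by simp
  qed
qed (rule tendsto_div_pow2)

text \<open>Writing \<open>2^k c = n + r\<close> with \<open>n\<close> natural and \<open>0 \<le> r < 1\<close> turns subadditivity and dyadic
  homogeneity into \<open>f (c x) \<le> c f x\<close> up to an error \<open>O(2^-k)\<close>.\<close>

lemma homogeneous_of_subadditive:
  fixes f :: "'a::real_vector \<Rightarrow> real"
  assumes tri: "\<And>x y. f (x + y) \<le> f x + f y" and even: "\<And>x. f (- x) = f x"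
    and dbl: "\<And>x. f (2 *\<^sub>R x) = 2 * f x" and nonneg: "\<And>x. 0 \<le> f x"
    and bdd: "\<And>x. \<exists>B. \<forall>r\<in>{0..1}. f (r *\<^sub>R x) \<le> B"
  shows "f (c *\<^sub>R x) = \<bar>c\<bar> * f x"
proof -
  have f0: "f 0 = 0" using dbl[of 0] by simp
  have fn: "f (real n *\<^sub>R x) \<le> real n * f x" for n x
  proof (induction n)
    case (Suc n)
    have "f (real (Suc n) *\<^sub>R x) = f (real n *\<^sub>R x + x)" by (simp add: algebra_simps)
    also have "\<dots> \<le> f (real n *\<^sub>R x) + f x" by (rule tri)
    finally show ?case using Suc.IH by (simp add: algebra_simps)
  qed (simp add: f0)
  have fp: "f (2 ^ k *\<^sub>R x) = 2 ^ k * f x" for k x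
    by (induction k) (simp_all add: dbl flip: scaleR_scaleR)
  have le: "f (c *\<^sub>R x) \<le> c * f x" if c: "0 \<le> c" for c x
  proof -
    obtain B where B: "\<And>r. r \<in> {0..1} \<Longrightarrow> f (r *\<^sub>R x) \<le> B" using bdd[of x] by blast
    have "f (c *\<^sub>R x) \<le> c * f x + B / 2 ^ k" for k
    proof -
      define n where "n = nat \<lfloor>2 ^ k * c\<rfloor>"
      define r where "r = 2 ^ k * c - real n"
      have fr: "0 \<le> r" "r \<le> 1" "real n \<le> 2 ^ k * c"
        using c by (simp_all add: r_def n_def) linarith+
      have "2 ^ k * f (c *\<^sub>R x) = f (2 ^ k *\<^sub>R (c *\<^sub>R x))" by (rule fp[symmetric])
      also have "2 ^ k *\<^sub>R (c *\<^sub>R x) = real n *\<^sub>R x + r *\<^sub>R x"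
        unfolding scaleR_add_left[symmetric] by (simp add: r_def)
      also have "f \<dots> \<le> real n * f x + B"
        using tri[of "real n *\<^sub>R x" "r *\<^sub>R x"] fn[of n x] B[of r] fr by auto
      also have "\<dots> \<le> (2 ^ k * c) * f x + B"
        using mult_right_mono[OF fr(3) nonneg[of x]] by simp
      finally show ?thesis by (simp add: field_simps)
    qed
    moreover have "(\<lambda>k. c * f x + B / 2 ^ k) \<longlonglongrightarrow> c * f x + 0"
      by (intro tendsto_add tendsto_const tendsto_div_pow2)
    ultimately show ?thesis using LIMSEQ_le_const[of _ "c * f x + 0" "f (c *\<^sub>R x)"] by simp
  qed
  have eq: "f (c *\<^sub>R x) = c * f x" if c: "0 < c" for c x
  proof (rule antisym)
    have "f x \<le> (1 / c) * f (c *\<^sub>R x)" using le[of "1/c" "c *\<^sub>R x"] c by simp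
    then show "c * f x \<le> f (c *\<^sub>R x)" using c by (simp add: field_simps)
  qed (use le c in simp)
  consider "c = 0" | "0 < c" | "c < 0" by linarith
  then show ?thesis
  proof cases
    case 3
    then show ?thesis using eq[of "-c" x] even[of "c *\<^sub>R x"] by simp
  qed (simp_all add: f0 eq)
qed

lemma is_norm_le_l1:
  assumes "is_norm (f :: real^'n \<Rightarrow> real)"
  shows "\<exists>K\<ge>0. \<forall>x. f x \<le> K * l1 x"
proof -
  have f: "f 0 = 0" "\<And>x y. f (x + y) \<le> f x + f y" "\<And>c x. f (c *\<^sub>R x) = \<bar>c\<bar> * f x"
    using assms unfolding is_norm_def by blast+
  have nn: "0 \<le> f x" for x using f(2)[of x "-x"] f(3)[of "-1" x] f(1) by simp
  define K where "K = (\<Sum>i\<in>UNIV. f (axis i 1))"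
  have sum_le: "f (\<Sum>i\<in>S. g i) \<le> (\<Sum>i\<in>S. f (g i))" if "finite S" for S and g :: "'n \<Rightarrow> real^'n"
    using that
  proof (induction S rule: finite_induct)
    case (insert a S)
    then show ?case using f(2)[of "g a" "sum g S"] by simp
  qed (simp add: f)
  have "f x \<le> K * l1 x" for x
  proof -
    have "x = (\<Sum>i\<in>UNIV. (x $ i) *\<^sub>R axis i 1)"
      by (simp add: vec_eq_iff axis_def if_distrib cong: if_cong)
    then have "f x \<le> (\<Sum>i\<in>UNIV. f ((x $ i) *\<^sub>R axis i 1))"
      using sum_le[of UNIV "\<lambda>i. (x $ i) *\<^sub>R axis i 1"] by simp
    also have "\<dots> = (\<Sum>i\<in>UNIV. \<bar>x $ i\<bar> * f (axis i 1))" by (simp add: f(3))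
    also have "\<dots> \<le> (\<Sum>i\<in>UNIV. \<bar>x $ i\<bar> * K)"
      unfolding K_def by (intro sum_mono mult_left_mono member_le_sum) (auto simp: nn)
    also have "\<dots> = K * l1 x" by (simp add: l1_def sum_distrib_left mult.commute)
    finally show ?thesis .
  qed
  moreover have "0 \<le> K" unfolding K_def by (intro sum_nonneg nn)
  ultimately show ?thesis by blast
qed

lemma is_norm_diff:
  assumes "is_norm f"
  shows "\<bar>f x - f y\<bar> \<le> f (x - y)" "f (- x) = f x" "0 \<le> f x"
proof -
  have f: "f 0 = 0" "\<And>x y. f (x + y) \<le> f x + f y" "\<And>c x. f (c *\<^sub>R x) = \<bar>c\<bar> * f x"
    using assms unfolding is_norm_def by blast+
  show m: "f (- x) = f x" for x using f(3)[of "-1" x] by simp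
  show "0 \<le> f x" using f(2)[of x "-x"] m[of x] f(1) by simp
  show "\<bar>f x - f y\<bar> \<le> f (x - y)"
    using f(2)[of "x - y" y] f(2)[of "y - x" x] m[of "x - y"] by simp
qed

text \<open>Rounding changes a norm by a bounded amount, which vanishes after division by
  \<open>2 ^ j\<close>. This is the uniqueness behind the \<open>THE\<close> in
  \<open>time_norm\<close>.\<close>

lemma norm_ext_is_norm_eq:
  fixes f g :: "real^'n \<Rightarrow> real"
  assumes "is_norm f" "\<And>x. x \<in> lattice \<Longrightarrow> f x = g x"
  shows "f = norm_ext g"
proof
  fix v
  obtain K where K: "\<And>x. f x \<le> K * l1 x" "0 \<le> K" using is_norm_le_l1[OF assms(1)] by blast
  have "(\<lambda>j. f (lattice_floor (2 ^ j *\<^sub>R v)) / 2 ^ j) \<longlonglongrightarrow> f v"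
  proof (rule tendsto_of_pow2_bound)
    fix j
    have "f (2 ^ j *\<^sub>R v) = 2 ^ j * f v" using assms(1) by (simp add: is_norm_def)
    moreover have "\<bar>f (lattice_floor (2 ^ j *\<^sub>R v)) - f (2 ^ j *\<^sub>R v)\<bar> \<le> K * real CARD('n)"
      by (rule order_trans[OF is_norm_diff(1)[OF assms(1)] order_trans[OF K(1) mult_left_mono[OF l1_lattice_floor K(2)]]])
    ultimately show "\<bar>f (lattice_floor (2 ^ j *\<^sub>R v)) - 2 ^ j * f v\<bar> \<le> K * real CARD('n)" by simp
  qed
  then show "f v = norm_ext g v"
    using assms(2) by (simp add: norm_ext_def limI)
qed

section \<open>Extending the lattice limits to a norm\<close>

context good_weights
begin

abbreviation T :: "real^'n \<Rightarrow> real^'n \<Rightarrow> real" where "T \<equiv> passage_time w"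
abbreviation N' :: "real^'n \<Rightarrow> real" where "N' \<equiv> norm_ext N"

lemma N_limit: "u \<in> lattice \<Longrightarrow> (\<lambda>j. T 0 (2 ^ j *\<^sub>R u) / 2 ^ j) \<longlonglongrightarrow> N u"
  using dyadic_limit[OF lattice_0, of u] by simp

lemma N_zero: "N 0 = 0"
proof -
  have "T 0 0 \<le> 0"
    using passage_time_le[OF w_nonneg, of "[0]"] by simp
  then have "T 0 0 = 0" using passage_time_nonneg[OF w_nonneg lattice_0 lattice_0] by simp
  then show ?thesis using LIMSEQ_unique[OF N_limit[OF lattice_0]] by simp
qed

text \<open>The second leg starts at \<open>2 ^ j *\<^sub>R u\<close>; its limit comes from the
  two-point form of \<open>dyadic_limit\<close>.\<close>

lemma N_triangle:
  assumes "u \<in> lattice" "v \<in> lattice"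
  shows "N (u + v) \<le> N u + N v"
proof (rule LIMSEQ_le)
  have uv: "u + v \<in> lattice" using assms by (rule lattice_add)
  show "(\<lambda>j. T 0 (2 ^ j *\<^sub>R (u + v)) / 2 ^ j) \<longlonglongrightarrow> N (u + v)" by (rule N_limit[OF uv])
  have "(\<lambda>j. T (2 ^ j *\<^sub>R u) (2 ^ j *\<^sub>R (u + v)) / 2 ^ j) \<longlonglongrightarrow> N (u + v - u)" by (rule dyadic_limit[OF assms(1) uv])
  then show "(\<lambda>j. T 0 (2 ^ j *\<^sub>R u) / 2 ^ j + T (2 ^ j *\<^sub>R u) (2 ^ j *\<^sub>R (u + v)) / 2 ^ j) \<longlonglongrightarrow> N u + N v"
    by (intro tendsto_add N_limit assms) simp
  show "\<exists>j0. \<forall>j\<ge>j0. T 0 (2 ^ j *\<^sub>R (u + v)) / 2 ^ j \<le> T 0 (2 ^ j *\<^sub>R u) / 2 ^ j + T (2 ^ j *\<^sub>R u) (2 ^ j *\<^sub>R (u + v)) / 2 ^ j"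
    unfolding add_divide_distrib[symmetric]
    by (intro exI allI impI divide_right_mono passage_time_triangle[OF w_nonneg] lattice_pow2 assms uv) auto
qed

lemma N_minus:
  assumes "u \<in> lattice"
  shows "N (- u) = N u"
proof (rule LIMSEQ_unique)
  have "(\<lambda>j. T (2 ^ j *\<^sub>R u) (2 ^ j *\<^sub>R 0) / 2 ^ j) \<longlonglongrightarrow> N (0 - u)" by (rule dyadic_limit[OF assms lattice_0])
  then show "(\<lambda>j. T (2 ^ j *\<^sub>R u) 0 / 2 ^ j) \<longlonglongrightarrow> N (- u)" by simp
  show "(\<lambda>j. T (2 ^ j *\<^sub>R u) 0 / 2 ^ j) \<longlonglongrightarrow> N u"
    using N_limit[OF assms] by (simp add: passage_time_commute[of w 0])
qed

lemma N_double:
  assumes "u \<in> lattice"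
  shows "N (2 *\<^sub>R u) = 2 * N u"
proof (rule LIMSEQ_unique)
  show "(\<lambda>j. T 0 (2 ^ j *\<^sub>R (2 *\<^sub>R u)) / 2 ^ j) \<longlonglongrightarrow> N (2 *\<^sub>R u)"
    by (rule N_limit) (use lattice_pow2[OF assms, of 1] in simp)
  have "(\<lambda>j. 2 * (T 0 (2 ^ Suc j *\<^sub>R u) / 2 ^ Suc j)) \<longlonglongrightarrow> 2 * N u"
    by (rule tendsto_mult_left[OF LIMSEQ_Suc[OF N_limit[OF assms]]])
  then show "(\<lambda>j. T 0 (2 ^ j *\<^sub>R (2 *\<^sub>R u)) / 2 ^ j) \<longlonglongrightarrow> 2 * N u"
    by (simp add: mult.commute[of 2])
qed

lemma N_pow2: "u \<in> lattice \<Longrightarrow> N (2 ^ j *\<^sub>R u) = 2 ^ j * N u"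
proof (induction j)
  case (Suc j)
  have "N (2 ^ Suc j *\<^sub>R u) = N (2 *\<^sub>R (2 ^ j *\<^sub>R u))" by simp
  also have "\<dots> = 2 * N (2 ^ j *\<^sub>R u)" by (rule N_double[OF lattice_pow2[OF Suc.prems]])
  finally show ?case using Suc by simp
qed simp

lemma N_bounds:
  assumes u: "u \<in> lattice"
  shows "N u \<le> C * l1 u" "\<delta> * l1 u \<le> N u"
proof -
  obtain d where d: "l1 u = real d" using l1_lattice[OF u] by blast
  have "N u \<le> C * l1 u \<and> \<delta> * l1 u \<le> N u"
  proof (cases "d = 0")
    case True
    then show ?thesis using d N_zero by auto
  next
    case False
    have "\<forall>\<^sub>F j in sequentially. \<forall>x\<in>lattice. l1 x \<le> real d * 2 ^ j \<longrightarrow> T 0 x \<le> C * (real d * 2 ^ j)"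
      using dyadic_upper[OF lattice_0, of d] False by simp
    then have "\<forall>\<^sub>F j in sequentially. T 0 (2 ^ j *\<^sub>R u) / 2 ^ j \<le> C * l1 u"
    proof eventually_elim
      case (elim j)
      then have "T 0 (2 ^ j *\<^sub>R u) \<le> C * (real d * 2 ^ j)"
        using lattice_pow2[OF u, of j] d by simp
      then show ?case unfolding d by (simp add: field_simps)
    qed
    then have 1: "N u \<le> C * l1 u" by (intro tendsto_upperbound[OF N_limit[OF u]]) auto
    obtain m0 where m0: "\<And>m y. m0 \<le> m \<Longrightarrow> y \<in> lattice \<Longrightarrow> real m \<le> l1 y \<Longrightarrow> \<delta> * real m \<le> T 0 y"
      using lower by (auto simp: eventually_sequentially)
    have "\<forall>\<^sub>F j in sequentially. \<delta> * l1 u \<le> T 0 (2 ^ j *\<^sub>R u) / 2 ^ j"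
      using eventually_ge_at_top[of m0]
    proof eventually_elim
      case (elim j)
      have "m0 \<le> d * 2 ^ j" using le_mult_pow2[of d j] False elim by simp
      then have "\<delta> * real (d * 2 ^ j) \<le> T 0 (2 ^ j *\<^sub>R u)"
        by (rule m0[OF _ lattice_pow2[OF u]]) (simp add: d)
      then show ?case unfolding d by (simp add: field_simps)
    qed
    then have "\<delta> * l1 u \<le> N u" by (intro tendsto_lowerbound[OF N_limit[OF u]]) auto
    with 1 show ?thesis by simp
  qed
  then show "N u \<le> C * l1 u" "\<delta> * l1 u \<le> N u" by auto
qed

lemma N_lipschitz:
  assumes "x \<in> lattice" "y \<in> lattice"
  shows "\<bar>N x - N y\<bar> \<le> C * l1 (x - y)"
  using N_triangle[OF lattice_diff[OF assms] assms(2)] N_triangle[OF lattice_diff[OF assms(2,1)] assms(1)]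
    N_bounds(1)[OF lattice_diff[OF assms]] N_bounds(1)[OF lattice_diff[OF assms(2,1)]] l1_minus_commute[of x y]
  by simp

text \<open>The values \<open>a j\<close> of \<open>N\<close> at the rounded points satisfy
  \<open>a (j + 1) \<le> 2 * a j + c\<close> with a fixed \<open>c\<close>. Adding \<open>c\<close>
  to both sides shows that \<open>(a j + c) / 2 ^ j\<close> decreases, and the added term vanishes
  in the limit.\<close>

lemma norm_ext_limit: "(\<lambda>j. N (lattice_floor (2 ^ j *\<^sub>R v)) / 2 ^ j) \<longlonglongrightarrow> N' v"
proof -
  let ?c = "C * real CARD('n)"
  let ?a = "\<lambda>j. (N (lattice_floor (2 ^ j *\<^sub>R v)) + ?c) / 2 ^ j"
  have "convergent ?a"
  proof (rule convergent_of_antimono_nonneg)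
    fix j
    let ?x = "lattice_floor (2 ^ j *\<^sub>R v)"
    have "2 *\<^sub>R ?x \<in> lattice" by (rule lattice_scaleR) simp_all
    then have "N (lattice_floor (2 ^ Suc j *\<^sub>R v)) \<le> N (2 *\<^sub>R ?x) + C * l1 (lattice_floor (2 ^ Suc j *\<^sub>R v) - 2 *\<^sub>R ?x)"
      using N_lipschitz[of "lattice_floor (2 ^ Suc j *\<^sub>R v)" "2 *\<^sub>R ?x"] by simp
    also have "\<dots> \<le> 2 * N ?x + ?c"
      using mult_left_mono[OF l1_lattice_floor_double[of "2 ^ j *\<^sub>R v"], of C] C_pos N_double[OF lattice_floor_in_lattice, of "2 ^ j *\<^sub>R v"] by simp
    finally have "N (lattice_floor (2 ^ Suc j *\<^sub>R v)) + ?c \<le> 2 * (N ?x + ?c)" unfolding ring_distribs by linarith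
    then have "?a (Suc j) \<le> 2 * (N ?x + ?c) / 2 ^ Suc j" by (rule divide_right_mono) simp
    then show "?a (Suc j) \<le> ?a j" by (simp only: power_Suc mult_divide_mult_cancel_left_if) simp
    have "0 \<le> \<delta> * l1 ?x" using \<delta>_pos by simp
    then have "0 \<le> N ?x" using N_bounds(2)[OF lattice_floor_in_lattice, of "2 ^ j *\<^sub>R v"] by linarith
    then show "0 \<le> ?a j" using C_pos by simp
  qed
  then have "convergent (\<lambda>j. ?a j - ?c / 2 ^ j)"
    using tendsto_div_pow2 by (intro convergent_diff) (auto simp: convergent_def)
  then have "convergent (\<lambda>j. N (lattice_floor (2 ^ j *\<^sub>R v)) / 2 ^ j)" by (simp add: add_divide_distrib)
  then show ?thesis by (simp add: norm_ext_def convergent_LIMSEQ_iff)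
qed

text \<open>Any lattice points within bounded distance of \<open>2 ^ j *\<^sub>R v\<close> give the
  same limit. So sums and negatives of rounded points may be used, although rounding is neither
  additive nor odd.\<close>

lemma norm_ext_limit':
  assumes "\<And>j. x j \<in> lattice" "\<And>j. l1 (x j - 2 ^ j *\<^sub>R v) \<le> c"
  shows "(\<lambda>j. N (x j) / 2 ^ j) \<longlonglongrightarrow> N' v"
proof -
  have "(\<lambda>j. (N (x j) - N (lattice_floor (2 ^ j *\<^sub>R v))) / 2 ^ j) \<longlonglongrightarrow> 0"
  proof (rule tendsto_of_pow2_bound)
    fix j
    have "l1 (x j - lattice_floor (2 ^ j *\<^sub>R v)) \<le> c + real CARD('n)"
      using l1_triangle_diff[of "x j" "lattice_floor (2 ^ j *\<^sub>R v)" "2 ^ j *\<^sub>R v"] assms(2)[of j] l1_lattice_floor[of "2 ^ j *\<^sub>R v"]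
      by (simp add: l1_minus_commute)
    then show "\<bar>N (x j) - N (lattice_floor (2 ^ j *\<^sub>R v)) - 2 ^ j * 0\<bar> \<le> C * (c + real CARD('n))"
      using order_trans[OF N_lipschitz[OF assms(1) lattice_floor_in_lattice] mult_left_mono] C_pos by simp
  qed
  from tendsto_add[OF this norm_ext_limit[of v]] show ?thesis by (simp add: diff_divide_distrib)
qed

lemma norm_ext_lattice: "z \<in> lattice \<Longrightarrow> N' z = N z"
  using norm_ext_limit'[of "\<lambda>j. 2 ^ j *\<^sub>R z" z 0] by (simp add: lattice_pow2 N_pow2 LIMSEQ_const_iff)

lemma norm_ext_triangle: "N' (u + v) \<le> N' u + N' v"
proof (rule LIMSEQ_le)
  let ?x = "\<lambda>j. lattice_floor (2 ^ j *\<^sub>R u)" and ?y = "\<lambda>j. lattice_floor (2 ^ j *\<^sub>R v)"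
  show "(\<lambda>j. N (?x j + ?y j) / 2 ^ j) \<longlonglongrightarrow> N' (u + v)"
  proof (rule norm_ext_limit'[where c="2 * real CARD('n)"])
    fix j
    have eq: "?x j + ?y j - 2 ^ j *\<^sub>R (u + v) = (?x j - 2 ^ j *\<^sub>R u) + (?y j - 2 ^ j *\<^sub>R v)"
      by (simp add: algebra_simps)
    show "l1 (?x j + ?y j - 2 ^ j *\<^sub>R (u + v)) \<le> 2 * real CARD('n)"
      unfolding eq using l1_triangle[of "?x j - 2 ^ j *\<^sub>R u" "?y j - 2 ^ j *\<^sub>R v"] l1_lattice_floor[of "2 ^ j *\<^sub>R u"] l1_lattice_floor[of "2 ^ j *\<^sub>R v"] by linarith
  qed (simp add: lattice_add)
  show "(\<lambda>j. N (?x j) / 2 ^ j + N (?y j) / 2 ^ j) \<longlonglongrightarrow> N' u + N' v"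
    by (intro tendsto_add norm_ext_limit)
  show "\<exists>j0. \<forall>j\<ge>j0. N (?x j + ?y j) / 2 ^ j \<le> N (?x j) / 2 ^ j + N (?y j) / 2 ^ j"
    unfolding add_divide_distrib[symmetric] by (intro exI allI impI divide_right_mono N_triangle) auto
qed

lemma norm_ext_minus: "N' (- v) = N' v"
proof (rule LIMSEQ_unique)
  show "(\<lambda>j. N (- lattice_floor (2 ^ j *\<^sub>R v)) / 2 ^ j) \<longlonglongrightarrow> N' (- v)"
  proof (rule norm_ext_limit')
    fix j
    have "- lattice_floor (2 ^ j *\<^sub>R v) - 2 ^ j *\<^sub>R (- v) = - (lattice_floor (2 ^ j *\<^sub>R v) - 2 ^ j *\<^sub>R v)" by simp
    then show "l1 (- lattice_floor (2 ^ j *\<^sub>R v) - 2 ^ j *\<^sub>R (- v)) \<le> real CARD('n)"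
      using l1_lattice_floor[of "2 ^ j *\<^sub>R v"] by (simp only: l1_uminus)
  qed (simp add: lattice_uminus)
  show "(\<lambda>j. N (- lattice_floor (2 ^ j *\<^sub>R v)) / 2 ^ j) \<longlonglongrightarrow> N' v"
    using norm_ext_limit[of v] by (simp add: N_minus)
qed

lemma norm_ext_double: "N' (2 *\<^sub>R v) = 2 * N' v"
proof (rule LIMSEQ_unique)
  show "(\<lambda>j. N (lattice_floor (2 ^ j *\<^sub>R (2 *\<^sub>R v))) / 2 ^ j) \<longlonglongrightarrow> N' (2 *\<^sub>R v)" by (rule norm_ext_limit)
  have "(\<lambda>j. 2 * (N (lattice_floor (2 ^ Suc j *\<^sub>R v)) / 2 ^ Suc j)) \<longlonglongrightarrow> 2 * N' v"
    by (rule tendsto_mult_left[OF LIMSEQ_Suc[OF norm_ext_limit]])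
  then show "(\<lambda>j. N (lattice_floor (2 ^ j *\<^sub>R (2 *\<^sub>R v))) / 2 ^ j) \<longlonglongrightarrow> 2 * N' v"
    by (simp add: mult.commute[of 2])
qed

lemma norm_ext_bounds: "N' v \<le> C * l1 v" "\<delta> * l1 v \<le> N' v"
proof -
  have l: "(\<lambda>j. l1 (lattice_floor (2 ^ j *\<^sub>R v)) / 2 ^ j) \<longlonglongrightarrow> l1 v"
  proof (rule tendsto_of_pow2_bound)
    fix j
    show "\<bar>l1 (lattice_floor (2 ^ j *\<^sub>R v)) - 2 ^ j * l1 v\<bar> \<le> real CARD('n)"
      using l1_triangle_diff[of "lattice_floor (2 ^ j *\<^sub>R v)" 0 "2 ^ j *\<^sub>R v"] l1_triangle_diff[of "2 ^ j *\<^sub>R v" 0 "lattice_floor (2 ^ j *\<^sub>R v)"]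
        l1_lattice_floor[of "2 ^ j *\<^sub>R v"] l1_minus_commute[of "lattice_floor (2 ^ j *\<^sub>R v)" "2 ^ j *\<^sub>R v"] by simp
  qed
  show "N' v \<le> C * l1 v"
    by (rule LIMSEQ_le[OF norm_ext_limit tendsto_mult_left[OF l, of C]], unfold times_divide_eq_right)
      (intro exI allI impI divide_right_mono N_bounds(1) lattice_floor_in_lattice, simp)
  show "\<delta> * l1 v \<le> N' v"
    by (rule LIMSEQ_le[OF tendsto_mult_left[OF l, of \<delta>] norm_ext_limit], unfold times_divide_eq_right)
      (intro exI allI impI divide_right_mono N_bounds(2) lattice_floor_in_lattice, simp)
qed

lemma is_norm_norm_ext: "is_norm N'"
proof -
  have nn: "0 \<le> N' v" for v
  proof -
    have "0 \<le> \<delta> * l1 v" using \<delta>_pos by simp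
    then show ?thesis using norm_ext_bounds(2)[of v] by linarith
  qed
  have hom: "N' (c *\<^sub>R v) = \<bar>c\<bar> * N' v" for c v
  proof (rule homogeneous_of_subadditive[OF norm_ext_triangle norm_ext_minus norm_ext_double nn])
    fix x :: "real^'n"
    have "N' (r *\<^sub>R x) \<le> C * l1 x" if "r \<in> {0..1}" for r
    proof -
      have "N' (r *\<^sub>R x) \<le> C * (r * l1 x)" using norm_ext_bounds(1)[of "r *\<^sub>R x"] that by simp
      also have "\<dots> \<le> C * l1 x"
        using that C_pos by (intro mult_left_mono mult_left_le_one_le) auto
      finally show ?thesis .
    qed
    then show "\<exists>B. \<forall>r\<in>{0..1}. N' (r *\<^sub>R x) \<le> B" by blast
  qed
  have "N' x = 0 \<longleftrightarrow> x = 0" for x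
  proof
    assume "N' x = 0"
    then have "\<delta> * l1 x \<le> 0" using norm_ext_bounds(2)[of x] by simp
    then have "l1 x \<le> 0" using \<delta>_pos by (simp add: mult_le_0_iff)
    then show "x = 0" using l1_nonneg[of x] l1_eq_0_iff[of x] by linarith
  qed (use hom[of 0 0] in simp)
  then show ?thesis unfolding is_norm_def using norm_ext_triangle hom by blast
qed

text \<open>At scale \<open>2^j \<approx> t / r\<close> every point of size \<open>A t\<close> is within \<open>O(2^j)\<close> of some \<open>2^j z\<close> with \<open>z\<close> in a finite
  set independent of \<open>t\<close>, so the dyadic limits are uniform and the rounding costs \<open>O(t / r)\<close>.\<close>

lemma passage_time_uniform:
  assumes A: "0 < A" and \<epsilon>: "0 < \<epsilon>"
  shows "\<forall>\<^sub>F t in at_top. \<forall>x\<in>lattice. \<forall>y\<in>lattice. l1 x \<le> A * t \<longrightarrow> l1 y \<le> A * t \<longrightarrow> \<bar>T x y - N' (x - y)\<bar> \<le> \<epsilon> * t"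
proof -
  let ?l = "real CARD('n)"
  \<comment> \<open>Rounding the two endpoints is paid for twice, in \<open>T\<close> and in the
    norm, each time by at most \<open>C * CARD('n) * 2 ^ j\<close>; the final 1 is the tolerance of
    the dyadic limits on \<open>Z\<close>. The total \<open>c * 2 ^ j\<close> is then at most
    \<open>\<epsilon> * r * 2 ^ j \<le> \<epsilon> * t\<close>.\<close>
  define c where "c = 4 * (C * ?l) + 1"
  have c: "0 < c" using C_pos by (simp add: c_def add_nonneg_pos)
  obtain r :: nat where r: "c / \<epsilon> < real r" using reals_Archimedean2 by blast
  have r0: "0 < real r" using r c \<epsilon> by (meson divide_pos_pos less_trans)
  \<comment> \<open>Because \<open>t < 2 ^ (j + 1) * r\<close>, points of size \<open>A * t\<close>
    divided by \<open>2 ^ j\<close> have size at most \<open>2 * A * r\<close>; rounding adds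
    \<open>CARD('n)\<close>.\<close>
  define Z where "Z = {z::real^'n. z \<in> lattice \<and> l1 z \<le> 2 * A * real r + ?l}"
  have fZ: "finite Z" unfolding Z_def by (rule finite_lattice_l1)
  have Zl: "z \<in> lattice" if "z \<in> Z" for z using that by (simp add: Z_def)
  have 1: "\<forall>\<^sub>F j in sequentially. \<forall>z\<in>Z. \<forall>z'\<in>Z. \<bar>T (2 ^ j *\<^sub>R z) (2 ^ j *\<^sub>R z') - 2 ^ j * N (z' - z)\<bar> \<le> 2 ^ j"
  proof (intro eventually_ball_finite fZ ballI)
    fix z z' assume z: "z \<in> Z" "z' \<in> Z"
    have "\<forall>\<^sub>F j in sequentially. dist (T (2 ^ j *\<^sub>R z) (2 ^ j *\<^sub>R z') / 2 ^ j) (N (z' - z)) < 1"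
      by (rule tendstoD[OF dyadic_limit[OF Zl[OF z(1)] Zl[OF z(2)]]]) simp
    then show "\<forall>\<^sub>F j in sequentially. \<bar>T (2 ^ j *\<^sub>R z) (2 ^ j *\<^sub>R z') - 2 ^ j * N (z' - z)\<bar> \<le> 2 ^ j"
    proof eventually_elim
      case (elim j)
      have "T (2 ^ j *\<^sub>R z) (2 ^ j *\<^sub>R z') - 2 ^ j * N (z' - z) = 2 ^ j * (T (2 ^ j *\<^sub>R z) (2 ^ j *\<^sub>R z') / 2 ^ j - N (z' - z))"
        by (simp add: field_simps)
      then show ?case using elim by (simp add: dist_real_def abs_mult)
    qed
  qed
  have 2: "\<forall>\<^sub>F j in sequentially. \<forall>z\<in>Z. \<forall>x\<in>lattice. l1 (x - 2 ^ j *\<^sub>R z) \<le> ?l * 2 ^ j \<longrightarrow> T (2 ^ j *\<^sub>R z) x \<le> C * (?l * 2 ^ j)"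
    by (intro eventually_ball_finite fZ ballI dyadic_upper Zl) auto
  obtain J where J0: "\<And>j. J \<le> j \<Longrightarrow> (\<forall>z\<in>Z. \<forall>z'\<in>Z. \<bar>T (2 ^ j *\<^sub>R z) (2 ^ j *\<^sub>R z') - 2 ^ j * N (z' - z)\<bar> \<le> 2 ^ j) \<and>
     (\<forall>z\<in>Z. \<forall>x\<in>lattice. l1 (x - 2 ^ j *\<^sub>R z) \<le> ?l * 2 ^ j \<longrightarrow> T (2 ^ j *\<^sub>R z) x \<le> C * (?l * 2 ^ j))"
    using eventually_conj[OF 1 2] unfolding eventually_sequentially by blast
  note J = J0[THEN conjunct1, rule_format] J0[THEN conjunct2, rule_format]
  show ?thesis
  proof (rule eventually_mono[OF eventually_ge_at_top[of "2 ^ J * real r"]], intro ballI impI)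
    fix t :: real and x y :: "real^'n" assume t: "2 ^ J * real r \<le> t" and xy: "x \<in> lattice" "y \<in> lattice" "l1 x \<le> A * t" "l1 y \<le> A * t"
    have t0: "0 < t" using t r0 by (meson less_le_trans mult_pos_pos zero_less_numeral zero_less_power)
    have "\<exists>k. t < 2 ^ k * real r"
      using real_arch_pow[of 2 "t / real r"] r0 by (auto simp: field_simps)
    \<comment> \<open>\<open>j + 1\<close> is the least exponent with
      \<open>t < 2 ^ (j + 1) * r\<close>; it is not 0 because \<open>t\<close> is at least
      \<open>r\<close>.\<close>
    then obtain j where j: "t < 2 ^ Suc j * real r" "2 ^ j * real r \<le> t"
    proof -
      let ?k = "LEAST k. t < 2 ^ k * real r"
      assume *: "\<exists>k. t < 2 ^ k * real r" and **: "\<And>j. t < 2 ^ Suc j * real r \<Longrightarrow> 2 ^ j * real r \<le> t \<Longrightarrow> thesis"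
      have k: "t < 2 ^ ?k * real r" using * by (rule LeastI_ex)
      have "?k \<noteq> 0"
      proof
        assume "?k = 0"
        then have "t < real r" using k by simp
        moreover have "1 * real r \<le> 2 ^ J * real r" by (rule mult_right_mono) (use r0 in auto)
        ultimately show False using t by linarith
      qed
      then obtain j where j: "?k = Suc j" using not0_implies_Suc by blast
      have "\<not> t < 2 ^ j * real r" by (rule not_less_Least) (simp add: j)
      then show thesis using ** k unfolding j by simp
    qed
    have "(2::real) ^ J < 2 ^ Suc j"
      using j(1) t r0 by (meson le_less_trans mult_less_cancel_right_pos)
    then have Jj: "J \<le> j" by (simp add: power_strict_increasing_iff del: power_Suc)
    define p where "p x = lattice_floor ((1 / 2 ^ j) *\<^sub>R x)" for x :: "real^'n"
    have near: "l1 (x - 2 ^ j *\<^sub>R p x) \<le> ?l * 2 ^ j" for x :: "real^'n"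
    proof -
      have "x - 2 ^ j *\<^sub>R p x = - (2 ^ j *\<^sub>R (p x - (1 / 2 ^ j) *\<^sub>R x))" by (simp add: algebra_simps)
      then have "l1 (x - 2 ^ j *\<^sub>R p x) = 2 ^ j * l1 (p x - (1 / 2 ^ j) *\<^sub>R x)" by (simp only: l1_uminus l1_scaleR) simp
      also have "\<dots> \<le> 2 ^ j * ?l" unfolding p_def by (intro mult_left_mono l1_lattice_floor) simp
      finally show ?thesis by (simp add: mult.commute)
    qed
    have pZ: "p x \<in> Z" if "l1 x \<le> A * t" for x :: "real^'n"
    proof -
      have "l1 x \<le> A * (2 ^ Suc j * real r)" using that j(1) A by (meson less_imp_le mult_left_mono order_trans)
      then have "l1 ((1 / 2 ^ j) *\<^sub>R x) \<le> 2 * A * real r" by (simp add: field_simps)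
      then show ?thesis
        using l1_lattice_floor[of "(1 / 2 ^ j) *\<^sub>R x"] l1_triangle[of "p x - (1 / 2 ^ j) *\<^sub>R x" "(1 / 2 ^ j) *\<^sub>R x"]
        by (simp add: Z_def p_def)
    qed
    let ?X = "2 ^ j *\<^sub>R p x" and ?Y = "2 ^ j *\<^sub>R p y" and ?e = "C * (?l * 2 ^ j)"
    have lat: "?X \<in> lattice" "?Y \<in> lattice" by (simp_all add: p_def lattice_pow2)
    have a: "T ?X x \<le> ?e" by (rule J(2)[OF Jj pZ[OF xy(3)] xy(1) near])
    have b: "T ?Y y \<le> ?e" by (rule J(2)[OF Jj pZ[OF xy(4)] xy(2) near])
    have m: "\<bar>T ?X ?Y - N' (?Y - ?X)\<bar> \<le> 2 ^ j"
    proof -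
      have "p y - p x \<in> lattice" by (simp add: p_def lattice_diff)
      moreover have "?Y - ?X = 2 ^ j *\<^sub>R (p y - p x)" by (simp add: algebra_simps)
      ultimately have "N' (?Y - ?X) = 2 ^ j * N (p y - p x)"
        using norm_ext_lattice[OF lattice_pow2] N_pow2 by metis
      then show ?thesis using J(1)[OF Jj pZ[OF xy(3)] pZ[OF xy(4)]] by simp
    qed
    have tr: "\<bar>T x y - T ?X ?Y\<bar> \<le> 2 * ?e"
    proof -
      note tri = passage_time_triangle[OF w_nonneg]
      have "T x y \<le> T x ?X + (T ?X ?Y + T ?Y y)"
        using tri[OF xy(1) lat(1) xy(2)] tri[OF lat(1) lat(2) xy(2)] by simp
      moreover have "T ?X ?Y \<le> T ?X x + (T x y + T y ?Y)"
        using tri[OF lat(1) xy(1) lat(2)] tri[OF xy(1) xy(2) lat(2)] by simp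
      ultimately show ?thesis using a b passage_time_commute[of w x ?X] passage_time_commute[of w y ?Y] by linarith
    qed
    have nr: "\<bar>N' (x - y) - N' (?Y - ?X)\<bar> \<le> 2 * ?e"
    proof -
      have e1: "N' (?Y - ?X) = N' (?X - ?Y)" using norm_ext_minus[of "?X - ?Y"] by simp
      have e2: "(x - y) - (?X - ?Y) = (x - ?X) + - (y - ?Y)" by simp
      have e3: "\<bar>N' (x - y) - N' (?X - ?Y)\<bar> \<le> N' ((x - ?X) + - (y - ?Y))"
        using is_norm_diff(1)[OF is_norm_norm_ext, of "x - y" "?X - ?Y"] unfolding e2 .
      have e4: "N' ((x - ?X) + - (y - ?Y)) \<le> N' (x - ?X) + N' (y - ?Y)"
        using norm_ext_triangle[of "x - ?X" "- (y - ?Y)"] unfolding norm_ext_minus .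
      have e5: "N' (z - 2 ^ j *\<^sub>R p z) \<le> ?e" for z
        by (rule order_trans[OF norm_ext_bounds(1) mult_left_mono[OF near]]) (use C_pos in simp)
      show ?thesis unfolding e1 using e3 e4 e5[of x] e5[of y] by linarith
    qed
    have "\<bar>T x y - N' (x - y)\<bar> \<le> 4 * ?e + 2 ^ j" using m tr nr by linarith
    also have "\<dots> = c * 2 ^ j" by (simp add: c_def algebra_simps)
    also have "\<dots> \<le> (\<epsilon> * real r) * 2 ^ j"
      using r \<epsilon> by (intro mult_right_mono) (auto simp: field_simps)
    also have "\<dots> \<le> \<epsilon> * t" using mult_left_mono[OF j(2), of \<epsilon>] \<epsilon> by (simp add: mult_ac)
    finally show "\<bar>T x y - N' (x - y)\<bar> \<le> \<epsilon> * t" .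
  qed
qed

text \<open>The uniform estimate holds at all large real scales, which removes the restriction to
  powers of two and yields the limits that \<open>time_norm\<close> asks for.\<close>

lemma linear_limit:
  assumes x: "x \<in> lattice"
  shows "(\<lambda>n::nat. T 0 (real n *\<^sub>R x) / real n) \<longlonglongrightarrow> N' x"
proof (rule tendstoI)
  fix e :: real assume e: "0 < e"
  have "\<forall>\<^sub>F n in sequentially. \<forall>y\<in>lattice. \<forall>z\<in>lattice. l1 y \<le> (l1 x + 1) * real n \<longrightarrow> l1 z \<le> (l1 x + 1) * real n \<longrightarrow> \<bar>T y z - N' (y - z)\<bar> \<le> e / 2 * real n"
    using eventually_compose_filterlim[OF passage_time_uniform filterlim_real_sequentially, of "l1 x + 1" "e/2"] e
    by (simp add: add_nonneg_pos)
  with eventually_gt_at_top[of 0]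
  show "\<forall>\<^sub>F n in sequentially. dist (T 0 (real n *\<^sub>R x) / real n) (N' x) < e"
  proof eventually_elim
    case (elim n)
    have nx: "real n *\<^sub>R x \<in> lattice" by (rule lattice_scaleR[OF x]) simp
    have "l1 0 \<le> (l1 x + 1) * real n" "l1 (real n *\<^sub>R x) \<le> (l1 x + 1) * real n"
      by (simp_all add: algebra_simps)
    then have "\<bar>T 0 (real n *\<^sub>R x) - N' (0 - real n *\<^sub>R x)\<bar> \<le> e / 2 * real n"
      by (rule elim(2)[rule_format, OF lattice_0 nx])
    also have "N' (0 - real n *\<^sub>R x) = real n * N' x"
      using is_norm_norm_ext norm_ext_minus[of "real n *\<^sub>R x"] by (simp add: is_norm_def)
    finally have "\<bar>T 0 (real n *\<^sub>R x) / real n - N' x\<bar> \<le> e / 2"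
      using elim(1) by (simp add: field_simps abs_le_iff)
    then show ?case using e by (simp add: dist_real_def)
  qed
qed

end

lemma time_norm_eq:
  fixes \<tau> :: "(real^'n) set \<Rightarrow> 'w \<Rightarrow> real"
  assumes "prob_space M" "AE \<omega> in M. good_weights (\<lambda>e. \<tau> e \<omega>) N C \<delta>"
  shows "time_norm M \<tau> = norm_ext N"
proof -
  interpret prob_space M by fact
  \<comment> \<open>The statement does not depend on the outcome, so holding almost surely on a
    probability space it holds outright.\<close>
  have "AE \<omega> in M. is_norm (norm_ext N)"
    using assms(2) by eventually_elim (rule good_weights.is_norm_norm_ext)
  then have nrm: "is_norm (norm_ext N)" by simp
  have lim: "AE \<omega> in M. (\<lambda>n::nat. passage_time (\<lambda>e. \<tau> e \<omega>) 0 (real n *\<^sub>R x) / real n) \<longlonglongrightarrow> norm_ext N x"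
    if "x \<in> lattice" for x
    using assms(2) by eventually_elim (rule good_weights.linear_limit[OF _ that])
  have latt: "AE \<omega> in M. \<forall>x\<in>lattice. norm_ext N x = N x"
    using assms(2) by eventually_elim (simp add: good_weights.norm_ext_lattice)
  then have latt: "norm_ext N x = N x" if "x \<in> lattice" for x using that by simp
  show ?thesis
    unfolding time_norm_def
  proof (rule the_equality)
    fix f assume f: "is_norm f \<and> (\<forall>x\<in>lattice. AE \<omega> in M. (\<lambda>n::nat. passage_time (\<lambda>e. \<tau> e \<omega>) 0 (real n *\<^sub>R x) / real n) \<longlonglongrightarrow> f x)"
    have "f x = N x" if "x \<in> lattice" for x
    proof -
      have "AE \<omega> in M. f x = norm_ext N x"
        using lim[OF that] f[THEN conjunct2, rule_format, OF that]
        by eventually_elim (rule LIMSEQ_unique)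
      then show ?thesis using latt[OF that] by simp
    qed
    then show "f = norm_ext N" using f by (intro norm_ext_is_norm_eq) auto
  qed (use nrm lim in auto)
qed

section \<open>Convergence of the Frechet means\<close>

lemma norm_le_l1: "norm x \<le> l1 x"
  unfolding l1_def by (rule norm_le_l1_cart)

lemma tendsto_l1_zero: "((\<lambda>n. l1 (a n - b n)) \<longlongrightarrow> 0) F \<Longrightarrow> ((\<lambda>n. a n - b n) \<longlongrightarrow> 0) F"
  by (rule Lim_null_comparison[of _ "\<lambda>n. l1 (a n - b n)"]) (simp_all add: norm_le_l1)

lemma tendsto_l1 [tendsto_intros]: "(f \<longlongrightarrow> a) F \<Longrightarrow> ((\<lambda>x. l1 (f x)) \<longlongrightarrow> l1 a) F"
  unfolding l1_def by (intro tendsto_intros)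

lemma bounded_l1: "bounded {x. l1 x \<le> r}"
  unfolding bounded_iff by (rule exI[of _ r]) (use norm_le_l1 order_trans in blast)

lemma compact_l1: "compact {x. l1 x \<le> r}"
  unfolding compact_eq_bounded_closed
  by (intro conjI bounded_l1 closed_Collect_le continuous_intros)

section \<open>Rounding to the scaled lattice and its cells\<close>

definition lattice_round :: "real \<Rightarrow> real^'n \<Rightarrow> real^'n" where
  "lattice_round t x = lattice_floor (t *\<^sub>R x) /\<^sub>R t"

lemma l1_lattice_round: "0 < t \<Longrightarrow> l1 (lattice_round t x - x) \<le> real CARD('n) / t" for x :: "real^'n"
proof -
  assume t: "0 < t"
  have "lattice_round t x - x = (1 / t) *\<^sub>R (lattice_floor (t *\<^sub>R x) - t *\<^sub>R x)"
    using t by (simp add: lattice_round_def scaleR_diff_right divide_inverse_commute)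
  then have "l1 (lattice_round t x - x) = (1 / t) * l1 (lattice_floor (t *\<^sub>R x) - t *\<^sub>R x)" using t by (simp only: l1_scaleR) simp
  also have "\<dots> \<le> (1 / t) * real CARD('n)" by (rule mult_left_mono[OF l1_lattice_floor]) (use t in simp)
  finally show ?thesis by simp
qed

lemma scaleR_lattice_round: "0 < t \<Longrightarrow> t *\<^sub>R lattice_round t x = lattice_floor (t *\<^sub>R x)"
  by (simp add: lattice_round_def)

lemma lattice_round_limit:
  fixes x :: "real^'n"
  assumes "filterlim t at_top sequentially"
  shows "(\<lambda>n. lattice_round (t n) x) \<longlonglongrightarrow> x"
proof -
  have 0: "(\<lambda>n. real CARD('n) / t n) \<longlonglongrightarrow> 0"
    by (rule tendsto_divide_0[OF tendsto_const filterlim_at_top_imp_at_infinity[OF assms]])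
  have "(\<lambda>n. l1 (lattice_round (t n) x - x)) \<longlonglongrightarrow> 0"
  proof (rule Lim_null_comparison[OF _ 0])
    have "\<forall>\<^sub>F n in sequentially. 0 < t n" using assms by (simp add: filterlim_at_top_dense)
    then show "\<forall>\<^sub>F n in sequentially. norm (l1 (lattice_round (t n) x - x)) \<le> real CARD('n) / t n"
      by eventually_elim (simp add: l1_lattice_round)
  qed
  then show ?thesis by (rule LIM_zero_cancel[OF tendsto_l1_zero])
qed

text \<open>All cells have the same volume. It is never computed, since it appears as a common factor
  on both sides of the minimality inequality.\<close>

definition cell :: "real \<Rightarrow> real^'n \<Rightarrow> (real^'n) set" where
  "cell t y = {x. lattice_floor (t *\<^sub>R x) = t *\<^sub>R y}"

lemma cell_sets [measurable]: "cell t y \<in> sets borel"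
proof -
  have "cell t y = {x\<in>space borel. \<forall>i. real_of_int \<lfloor>t * x $ i\<rfloor> = t * y $ i}"
    by (auto simp: cell_def lattice_floor_def vec_eq_iff)
  also have "\<dots> \<in> sets borel" by measurable
  finally show ?thesis .
qed

lemma measure_cell:
  fixes y :: "real^'n"
  assumes "t *\<^sub>R y \<in> lattice"
  shows "measure lborel (cell t y) = measure lborel (cell t (0 :: real^'n))"
proof -
  have lattice_floor: "real_of_int \<lfloor>t * x $ i - t * y $ i\<rfloor> = real_of_int \<lfloor>t * x $ i\<rfloor> - t * y $ i" for x i
  proof -
    have "t * y $ i \<in> \<int>" using assms by (simp add: lattice_def)
    then obtain k where "t * y $ i = of_int k" by (auto elim: Ints_cases)
    then show ?thesis by simp
  qed
  have "measure lborel (cell t (0 :: real^'n)) = measure (distr lborel borel ((+) (- y))) (cell t 0)"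
    by (simp add: lborel_distr_plus)
  also have "\<dots> = measure lborel ((+) (- y) -` cell t 0 \<inter> space lborel)"
    by (rule measure_distr) auto
  also have "(+) (- y) -` cell t 0 \<inter> space lborel = cell t y"
  proof -
    have "\<lfloor>t * x $ i - t * y $ i\<rfloor> = 0 \<longleftrightarrow> real_of_int \<lfloor>t * x $ i\<rfloor> = t * y $ i" for x i
    proof -
      have z: "\<lfloor>t * x $ i - t * y $ i\<rfloor> = 0 \<longleftrightarrow> real_of_int \<lfloor>t * x $ i - t * y $ i\<rfloor> = 0" by simp
      show ?thesis by (subst z, subst lattice_floor) simp
    qed
    then show ?thesis by (simp add: cell_def lattice_floor_def vec_eq_iff algebra_simps set_eq_iff)
  qed
  finally show ?thesis ..
qed

lemma finite_measure_cell:
  fixes y :: "real^'n"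
  assumes "0 < t"
  shows "emeasure lborel (cell t y) < \<infinity>"
proof (rule emeasure_bounded_finite)
  have "cell t y \<subseteq> {x. l1 x \<le> (real CARD('n) + t * l1 y) / t}"
  proof
    fix x assume "x \<in> cell t y"
    then have "t *\<^sub>R y = lattice_floor (t *\<^sub>R x)" by (simp add: cell_def)
    then have "l1 (t *\<^sub>R y - t *\<^sub>R x) \<le> real CARD('n)" using l1_lattice_floor[of "t *\<^sub>R x"] by simp
    then have "l1 (t *\<^sub>R x) \<le> real CARD('n) + l1 (t *\<^sub>R y)"
      using l1_triangle_diff[of "t *\<^sub>R x" 0 "t *\<^sub>R y"] l1_minus_commute[of "t *\<^sub>R y"] by simp
    then show "x \<in> {x. l1 x \<le> (real CARD('n) + t * l1 y) / t}" using assms by (simp add: field_simps)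
  qed
  then show "bounded (cell t y)" by (rule bounded_subset[OF bounded_l1])
qed

section \<open>Scaled balls, Riemann sums and Frechet energies\<close>

context good_weights
begin

lemma norm_ext_diff: "\<bar>N' x - N' y\<bar> \<le> N' (x - y)" and norm_ext_nonneg: "0 \<le> N' x"
  and norm_ext_scaleR: "N' (c *\<^sub>R x) = \<bar>c\<bar> * N' x" and norm_ext_zero [simp]: "N' 0 = 0"
  using is_norm_diff[OF is_norm_norm_ext] is_norm_norm_ext unfolding is_norm_def by blast+

lemma continuous_on_norm_ext [continuous_intros]:
  assumes "continuous_on S g"
  shows "continuous_on S (\<lambda>x. N' (g x))"
proof -
  have "continuous_on UNIV N'"
    unfolding continuous_on
  proof
    fix a :: "real^'n"
    have l: "((\<lambda>x. C * l1 (x - a)) \<longlongrightarrow> C * l1 (a - a)) (at a)"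
      by (intro tendsto_intros)
    have "((\<lambda>x. N' x - N' a) \<longlongrightarrow> 0) (at a)"
      by (rule Lim_null_comparison[of _ "\<lambda>x. C * l1 (x - a)"])
        (use l order_trans[OF norm_ext_diff norm_ext_bounds(1)] in auto)
    then show "(N' \<longlongrightarrow> N' a) (at a within UNIV)" by (simp add: LIM_zero_cancel)
  qed
  from continuous_on_compose2[OF this assms] show ?thesis by simp
qed

lemma tendsto_norm_ext [tendsto_intros]: "(g \<longlongrightarrow> a) F \<Longrightarrow> ((\<lambda>x. N' (g x)) \<longlongrightarrow> N' a) F"
  by (rule continuous_on_tendsto_compose[OF continuous_on_norm_ext[OF continuous_on_id[of UNIV]]]) auto

lemma measurable_norm_ext [measurable]: "N' \<in> borel_measurable borel"
  by (rule borel_measurable_continuous_onI) (intro continuous_intros)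

text \<open>Uniformity of the approximation lets both points move with \<open>n\<close>.
  \<open>A\<close> exceeds both limits in \<open>l1\<close>, so the points eventually stay where the
  uniform estimate applies.\<close>

lemma passage_time_scaled_limit:
  assumes t: "filterlim t at_top sequentially"
    and lat: "\<forall>\<^sub>F n in sequentially. t n *\<^sub>R x n \<in> lattice" "\<forall>\<^sub>F n in sequentially. t n *\<^sub>R y n \<in> lattice"
    and lim: "x \<longlonglongrightarrow> u" "y \<longlonglongrightarrow> v"
  shows "(\<lambda>n. T (t n *\<^sub>R x n) (t n *\<^sub>R y n) / t n) \<longlonglongrightarrow> N' (u - v)"
proof -
  define A where "A = l1 u + l1 v + 1"
  have A: "0 < A" "l1 u < A" "l1 v < A" by (simp_all add: A_def add_nonneg_pos add.commute add_pos_nonneg)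
  have pos: "\<forall>\<^sub>F n in sequentially. 0 < t n" using t by (simp add: filterlim_at_top_dense)
  have "(\<lambda>n. T (t n *\<^sub>R x n) (t n *\<^sub>R y n) / t n - N' (x n - y n)) \<longlonglongrightarrow> 0"
  proof (rule tendstoI)
    fix e :: real assume e: "0 < e"
    from eventually_compose_filterlim[OF passage_time_uniform[OF A(1) half_gt_zero[OF e]] t]
      order_tendstoD(2)[OF tendsto_l1[OF lim(1)] A(2)] order_tendstoD(2)[OF tendsto_l1[OF lim(2)] A(3)] lat pos
    show "\<forall>\<^sub>F n in sequentially. dist (T (t n *\<^sub>R x n) (t n *\<^sub>R y n) / t n - N' (x n - y n)) 0 < e"
    proof eventually_elim
      case (elim n)
      have "l1 (t n *\<^sub>R x n) \<le> A * t n" "l1 (t n *\<^sub>R y n) \<le> A * t n"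
        using elim(2,3,6) by (simp_all add: mult.commute[of A])
      with elim(1,4,5) have *: "\<bar>T (t n *\<^sub>R x n) (t n *\<^sub>R y n) - N' (t n *\<^sub>R x n - t n *\<^sub>R y n)\<bar> \<le> e / 2 * t n"
        by blast
      have "N' (t n *\<^sub>R x n - t n *\<^sub>R y n) = t n * N' (x n - y n)"
        using norm_ext_scaleR[of "t n" "x n - y n"] elim(6) by (simp add: scaleR_diff_right)
      then have "T (t n *\<^sub>R x n) (t n *\<^sub>R y n) / t n - N' (x n - y n) =
          (T (t n *\<^sub>R x n) (t n *\<^sub>R y n) - N' (t n *\<^sub>R x n - t n *\<^sub>R y n)) / t n"
        using elim(6) by (simp add: field_simps)
      moreover have "\<bar>(T (t n *\<^sub>R x n) (t n *\<^sub>R y n) - N' (t n *\<^sub>R x n - t n *\<^sub>R y n)) / t n\<bar> \<le> e / 2"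
        using * elim(6) by (simp add: pos_divide_le_eq)
      ultimately show ?case using e unfolding dist_real_def by linarith
    qed
  qed
  from tendsto_add[OF this tendsto_norm_ext[OF tendsto_diff[OF lim]]] show ?thesis by simp
qed

lemma scaled_ball_iff: "0 < t \<Longrightarrow> y \<in> scaled_ball w t \<longleftrightarrow> t *\<^sub>R y \<in> lattice \<and> T 0 (t *\<^sub>R y) < t"
proof
  assume t: "0 < t" and "t *\<^sub>R y \<in> lattice \<and> T 0 (t *\<^sub>R y) < t"
  then show "y \<in> scaled_ball w t"
    unfolding scaled_ball_def passage_ball_def by (intro image_eqI[of _ _ "t *\<^sub>R y"]) auto
qed (auto simp: scaled_ball_def passage_ball_def)

lemma scaled_ball_bounded: "\<forall>\<^sub>F t in at_top. \<forall>y\<in>scaled_ball w t. l1 y \<le> 1 / \<delta>"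
proof -
  obtain m0 where m0: "\<And>m y. m0 \<le> m \<Longrightarrow> y \<in> lattice \<Longrightarrow> real m \<le> l1 y \<Longrightarrow> \<delta> * real m \<le> T 0 y"
    using lower unfolding eventually_sequentially by blast
  show ?thesis
  \<comment> \<open>The lower bound speaks of points at distance at least \<open>m0\<close>; for
    nearer ones \<open>\<delta> * m0 \<le> t\<close> gives the same conclusion.\<close>
  proof (rule eventually_mono[OF eventually_conj[OF eventually_gt_at_top[of 0] eventually_ge_at_top[of "\<delta> * real m0"]]], intro ballI)
    fix t y assume t: "0 < t \<and> \<delta> * real m0 \<le> t" and y: "y \<in> scaled_ball w t"
    have y': "t *\<^sub>R y \<in> lattice" "T 0 (t *\<^sub>R y) < t" using y t by (simp_all add: scaled_ball_iff)
    obtain d where d: "l1 (t *\<^sub>R y) = real d" using l1_lattice[OF y'(1)] by blast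
    have "\<delta> * real d \<le> t"
    proof (cases "m0 \<le> d")
      case True
      from m0[OF this y'(1)] d y'(2) show ?thesis by simp
    next
      case False
      then have "\<delta> * real d \<le> \<delta> * real m0" using \<delta>_pos by simp
      then show ?thesis using t by simp
    qed
    then have "\<delta> * (t * l1 y) \<le> t" using d t by simp
    then have "t * (\<delta> * l1 y) \<le> t * 1" by (simp add: mult_ac)
    then have "\<delta> * l1 y \<le> 1" using t by (simp only: mult_le_cancel_left_pos)
    then show "l1 y \<le> 1 / \<delta>" using \<delta>_pos by (simp add: field_simps)
  qed
qed

lemma finite_scaled_ball:
  assumes "0 < t" "\<And>y. y \<in> scaled_ball w t \<Longrightarrow> l1 y \<le> r"
  shows "finite (scaled_ball w t)"
proof -
  have "scaled_ball w t \<subseteq> (\<lambda>z. z /\<^sub>R t) ` {z. z \<in> lattice \<and> l1 z \<le> t * r}"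
  proof
    fix y assume y: "y \<in> scaled_ball w t"
    have "l1 (t *\<^sub>R y) \<le> t * r" using assms(2)[OF y] assms(1) by simp
    then show "y \<in> (\<lambda>z. z /\<^sub>R t) ` {z. z \<in> lattice \<and> l1 z \<le> t * r}"
      using y assms(1) by (intro image_eqI[of _ _ "t *\<^sub>R y"]) (auto simp: scaled_ball_iff)
  qed
  then show ?thesis by (rule finite_subset) (intro finite_imageI finite_lattice_l1)
qed

definition limit_ball :: "(real^'n) set" where "limit_ball = {x. N' x \<le> 1}"

lemma limit_ball_bounded: "x \<in> limit_ball \<Longrightarrow> l1 x \<le> 1 / \<delta>"
  using norm_ext_bounds(2)[of x] \<delta>_pos by (simp add: limit_ball_def field_simps)

lemma closed_limit_ball: "closed limit_ball"
  unfolding limit_ball_def by (intro closed_Collect_le continuous_intros)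

lemma sets_limit_ball [measurable]: "limit_ball \<in> sets borel"
  using closed_limit_ball by (rule borel_closed)

lemma bounded_limit_ball: "bounded limit_ball"
  using bounded_subset[OF bounded_l1] limit_ball_bounded by blast

text \<open>The sphere lies in the frontier of a convex set, since slight dilations of its points
  leave the ball, and such a frontier is negligible. On the sphere the limit does not decide whether
  rounded points lie in the scaled ball.\<close>

lemma sphere_null: "AE x in lborel. N' x \<noteq> 1"
proof -
  have "convex limit_ball"
    unfolding convex_def limit_ball_def
  proof clarify
    fix x y :: "real^'n" and u v :: real
    assume *: "N' x \<le> 1" "N' y \<le> 1" "0 \<le> u" "0 \<le> v" "u + v = 1"
    have "N' (u *\<^sub>R x + v *\<^sub>R y) \<le> u * N' x + v * N' y"
      using norm_ext_triangle[of "u *\<^sub>R x" "v *\<^sub>R y"] * by (simp add: norm_ext_scaleR)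
    also have "\<dots> \<le> 1" using * by (rule convex_bound_le)
    finally show "N' (u *\<^sub>R x + v *\<^sub>R y) \<le> 1" .
  qed
  then have neg: "negligible (frontier limit_ball)" by (rule negligible_convex_frontier)
  have sub: "{x. N' x = 1} \<subseteq> frontier limit_ball"
  proof
    fix x assume "x \<in> {x. N' x = 1}"
    then have x: "N' x = 1" by simp
    have "x \<notin> interior limit_ball"
    proof
      assume "x \<in> interior limit_ball"
      then have "\<forall>\<^sub>F y in nhds x. y \<in> interior limit_ball" by (rule eventually_nhds_in_open[OF open_interior])
      then have "\<forall>\<^sub>F y in nhds x. y \<in> limit_ball" by (rule eventually_mono) (rule subsetD[OF interior_subset])
      moreover have "(\<lambda>n. (1 + 1 / real (Suc n)) *\<^sub>R x) \<longlonglongrightarrow> x"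
      proof -
        have "(\<lambda>n. (1 + 1 / real (Suc n)) *\<^sub>R x) \<longlonglongrightarrow> (1 + 0) *\<^sub>R x"
          by (intro tendsto_intros) (use LIMSEQ_inverse_real_of_nat in \<open>simp add: inverse_eq_divide\<close>)
        then show ?thesis by simp
      qed
      ultimately have "\<forall>\<^sub>F n in sequentially. (1 + 1 / real (Suc n)) *\<^sub>R x \<in> limit_ball"
        by (rule eventually_compose_filterlim)
      then obtain n where "(1 + 1 / real (Suc n)) *\<^sub>R x \<in> limit_ball" by (auto simp: eventually_sequentially)
      then have "1 + 1 / real (Suc n) \<le> 1" unfolding limit_ball_def mem_Collect_eq norm_ext_scaleR x by simp
      then show False by simp
    qed
    then show "x \<in> frontier limit_ball" using x closed_limit_ball by (simp add: frontier_def limit_ball_def)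
  qed
  have "{x. N' x = 1} \<in> null_sets lborel"
    using negligible_subset[OF neg sub]
    by (simp add: negligible_iff_null_sets null_sets_completion_iff)
  then show ?thesis by (rule AE_I') auto
qed

text \<open>The weighted sum is the integral of a function constant on cells: at \<open>x\<close> it
  is the summand at the rounding of \<open>x\<close>, or 0 if that falls outside the scaled ball.
  Off the unit sphere it converges pointwise, and dominated convergence applies.\<close>

lemma riemann_limit:
  assumes t: "filterlim t at_top sequentially"
    and g: "\<And>x. (\<lambda>n. g n (lattice_round (t n) x)) \<longlonglongrightarrow> G x" and G[measurable]: "G \<in> borel_measurable borel"
    and K: "\<forall>\<^sub>F n in sequentially. \<forall>y\<in>scaled_ball w (t n). \<bar>g n y\<bar> \<le> K"
  shows "(\<lambda>n. measure lborel (cell (t n) (0 :: real^'n)) * (\<Sum>y\<in>scaled_ball w (t n). g n y)) \<longlonglongrightarrow> (\<integral>x. indicator limit_ball x * G x \<partial>lborel)"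
proof -
  let ?Y = "\<lambda>n. scaled_ball w (t n)"
  \<comment> \<open>These bounds hold for large \<open>n\<close> only; putting
    \<open>h n = 0\<close> for the other \<open>n\<close> makes the domination valid for every
    \<open>n\<close>.\<close>
  define good where "good n \<longleftrightarrow> 1 \<le> t n \<and> (\<forall>y\<in>?Y n. l1 y \<le> 1 / \<delta>) \<and> (\<forall>y\<in>?Y n. \<bar>g n y\<bar> \<le> K)" for n
  have ev_good: "\<forall>\<^sub>F n in sequentially. good n"
    unfolding good_def using t
    by (intro eventually_conj K eventually_compose_filterlim[OF scaled_ball_bounded t]) (simp add: filterlim_at_top)
  have goodD: "0 < t n" "finite (?Y n)" "y \<in> ?Y n \<Longrightarrow> t n *\<^sub>R y \<in> lattice" if "good n" for n y
  proof -
    show "0 < t n" using that by (simp add: good_def)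
    then show "finite (?Y n)" using that by (intro finite_scaled_ball) (auto simp: good_def)
    show "y \<in> ?Y n \<Longrightarrow> t n *\<^sub>R y \<in> lattice" using \<open>0 < t n\<close> by (simp add: scaled_ball_iff)
  qed
  define h where "h n x = (if good n then \<Sum>y\<in>?Y n. g n y * indicator (cell (t n) y) x else 0)" for n x
  have h_eq: "h n x = (if lattice_round (t n) x \<in> ?Y n then g n (lattice_round (t n) x) else 0)" if "good n" for n x
  proof -
    have "x \<in> cell (t n) y \<longleftrightarrow> y = lattice_round (t n) x" for y
      using goodD(1)[OF that] by (auto simp: cell_def lattice_round_def)
    then have "h n x = (\<Sum>y\<in>?Y n. if y = lattice_round (t n) x then g n y else 0)"
      using that by (auto simp: h_def indicator_def intro!: sum.cong)
    then show ?thesis using goodD(2)[OF that] by (simp add: sum.delta)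
  qed
  have h_int: "(\<integral>x. h n x \<partial>lborel) = measure lborel (cell (t n) (0 :: real^'n)) * (\<Sum>y\<in>?Y n. g n y)" if "good n" for n
  proof -
    have i: "integrable lborel (\<lambda>x. g n y * indicator (cell (t n) y) x)" for y
      using finite_measure_cell[OF goodD(1)[OF that], of y] by (intro integrable_mult_right integrable_real_indicator) auto
    have "(\<integral>x. h n x \<partial>lborel) = (\<Sum>y\<in>?Y n. \<integral>x. g n y * indicator (cell (t n) y) x \<partial>lborel)"
    proof -
      have "(\<integral>x. h n x \<partial>lborel) = (\<integral>x. (\<Sum>y\<in>?Y n. g n y * indicator (cell (t n) y) x) \<partial>lborel)"
        by (rule Bochner_Integration.integral_cong) (simp_all only: h_def that if_True)
      also have "\<dots> = (\<Sum>y\<in>?Y n. \<integral>x. g n y * indicator (cell (t n) y) x \<partial>lborel)"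
        by (rule Bochner_Integration.integral_sum) (rule i)
      finally show ?thesis .
    qed
    also have "\<dots> = (\<Sum>y\<in>?Y n. measure lborel (cell (t n) (0 :: real^'n)) * g n y)"
    proof (rule sum.cong[OF refl])
      fix y assume "y \<in> ?Y n"
      have "(\<integral>x. g n y * indicator (cell (t n) y) x \<partial>lborel) = g n y * measure lborel (cell (t n) y)" by simp
      also have "measure lborel (cell (t n) y) = measure lborel (cell (t n) (0 :: real^'n))" by (rule measure_cell[OF goodD(3)[OF that \<open>y \<in> ?Y n\<close>]])
      finally show "(\<integral>x. g n y * indicator (cell (t n) y) x \<partial>lborel) = measure lborel (cell (t n) (0 :: real^'n)) * g n y" by (simp only: mult.commute)
    qed
    finally show ?thesis by (simp only: sum_distrib_left)
  qed
  \<comment> \<open>Points of the scaled ball have size at most \<open>1 / \<delta>\<close>, and for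
    \<open>t n \<ge> 1\<close> rounding moves a point by at most \<open>CARD('n)\<close>.\<close>
  let ?S = "{x::real^'n. l1 x \<le> 1 / \<delta> + real CARD('n)}"
  have S[measurable]: "?S \<in> sets borel" using compact_l1 by (intro borel_closed compact_imp_closed)
  have "(\<lambda>n. \<integral>x. h n x \<partial>lborel) \<longlonglongrightarrow> (\<integral>x. indicator limit_ball x * G x \<partial>lborel)"
  proof (rule integral_dominated_convergence[where w="\<lambda>x. \<bar>K\<bar> * indicator ?S x"])
    show "integrable lborel (\<lambda>x. \<bar>K\<bar> * indicator ?S x)"
      using emeasure_bounded_finite[OF bounded_l1] by (intro integrable_mult_right integrable_real_indicator) auto
    show "h n \<in> borel_measurable lborel" for n
      unfolding h_def by (cases "good n") simp_all
    show "AE x in lborel. norm (h n x) \<le> \<bar>K\<bar> * indicator ?S x" for n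
    proof (rule AE_I2)
      fix x
      show "norm (h n x) \<le> \<bar>K\<bar> * indicator ?S x"
      proof (cases "good n \<and> lattice_round (t n) x \<in> ?Y n")
        case True
        then have g: "good n" and r: "lattice_round (t n) x \<in> ?Y n" by auto
        have "real CARD('n) / t n \<le> real CARD('n)" using g by (simp add: good_def divide_le_eq mult_le_cancel_left1)
        then have "l1 (x - lattice_round (t n) x) \<le> real CARD('n)"
          using l1_lattice_round[OF goodD(1)[OF g], of x] l1_minus_commute[of x] by simp
        moreover have "l1 (lattice_round (t n) x) \<le> 1 / \<delta>" using g r by (auto simp: good_def)
        ultimately have "x \<in> ?S" using l1_triangle[of "x - lattice_round (t n) x" "lattice_round (t n) x"] by simp
        moreover have "\<bar>g n (lattice_round (t n) x)\<bar> \<le> K" using g r by (auto simp: good_def)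
        ultimately show ?thesis using h_eq[OF g] r by simp
      next
        case False
        then have "h n x = 0" using h_eq[of n x] by (auto simp: h_def)
        then show ?thesis by simp
      qed
    qed
    show "AE x in lborel. (\<lambda>n. h n x) \<longlonglongrightarrow> indicator limit_ball x * G x"
      using sphere_null
    proof eventually_elim
      case (elim x)
      have pos: "\<forall>\<^sub>F n in sequentially. 0 < t n" using t by (simp add: filterlim_at_top_dense)
      then have lat: "\<forall>\<^sub>F n in sequentially. t n *\<^sub>R lattice_round (t n) x \<in> lattice" by eventually_elim (simp add: scaleR_lattice_round)
      have "(\<lambda>n. T (t n *\<^sub>R 0) (t n *\<^sub>R lattice_round (t n) x) / t n) \<longlonglongrightarrow> N' (0 - x)"
        by (rule passage_time_scaled_limit[OF t _ lat _ lattice_round_limit[OF t]]) auto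
      then have T: "(\<lambda>n. T 0 (t n *\<^sub>R lattice_round (t n) x) / t n) \<longlonglongrightarrow> N' x" by (simp add: norm_ext_minus)
      show ?case
      proof (cases "N' x < 1")
        case True
        have "\<forall>\<^sub>F n in sequentially. g n (lattice_round (t n) x) = h n x"
          using order_tendstoD(2)[OF T True] ev_good lat pos
        proof eventually_elim
          case (elim n)
          then have "lattice_round (t n) x \<in> ?Y n" by (simp add: scaled_ball_iff divide_less_eq)
          then show ?case using h_eq[OF elim(2)] by simp
        qed
        from Lim_transform_eventually[OF g this] show ?thesis using True by (simp add: limit_ball_def)
      next
        case False
        then have "1 < N' x" using elim by simp
        have "\<forall>\<^sub>F n in sequentially. h n x = 0"
          using order_tendstoD(1)[OF T \<open>1 < N' x\<close>] ev_good pos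
        proof eventually_elim
          case (elim n)
          then have "lattice_round (t n) x \<notin> ?Y n" by (simp add: scaled_ball_iff less_divide_eq)
          then show ?case using h_eq[OF elim(2)] by simp
        qed
        then show ?thesis using \<open>1 < N' x\<close> by (simp add: limit_ball_def tendsto_eventually)
      qed
    qed
  qed simp
  moreover have "\<forall>\<^sub>F n in sequentially. (\<integral>x. h n x \<partial>lborel) = measure lborel (cell (t n) (0 :: real^'n)) * (\<Sum>y\<in>?Y n. g n y)"
    using ev_good by eventually_elim (rule h_int)
  ultimately show ?thesis by (rule Lim_transform_eventually)
qed

text \<open>The Frechet functional of the limit shape before division by the volume, a positive
  constant that does not affect minimizers.\<close>

definition energy :: "real^'n \<Rightarrow> real" where
  "energy u = (\<integral>x. indicator limit_ball x * (N' (u - x))^2 \<partial>lborel)"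

lemma energy_limit:
  assumes t: "filterlim t at_top sequentially" and u: "u \<longlonglongrightarrow> a"
    and lat: "\<forall>\<^sub>F n in sequentially. t n *\<^sub>R u n \<in> lattice"
  shows "(\<lambda>n. measure lborel (cell (t n) (0 :: real^'n)) * (\<Sum>y\<in>scaled_ball w (t n). (scaled_dist w (t n) (u n) y)^2)) \<longlonglongrightarrow> energy a"
  unfolding energy_def
proof (rule riemann_limit[OF t])
  have pos: "\<forall>\<^sub>F n in sequentially. 0 < t n" using t by (simp add: filterlim_at_top_dense)
  fix x :: "real^'n"
  have latx: "\<forall>\<^sub>F n in sequentially. t n *\<^sub>R lattice_round (t n) x \<in> lattice" using pos by eventually_elim (simp add: scaleR_lattice_round)
  show "(\<lambda>n. (scaled_dist w (t n) (u n) (lattice_round (t n) x))\<^sup>2) \<longlonglongrightarrow> (N' (a - x))\<^sup>2"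
    unfolding scaled_dist_def
    by (intro tendsto_power passage_time_scaled_limit[OF t lat latx u lattice_round_limit[OF t]])
next
  show "(\<lambda>x. (N' (a - x))\<^sup>2) \<in> borel_measurable borel" by measurable
next
  \<comment> \<open>\<open>A\<close> bounds the moving base points and the scaled balls at once.
    Norm distances are then at most \<open>C * (2 * A)\<close>, and tolerance 1 in the uniform
    estimate adds 1.\<close>
  define A where "A = l1 a + 1 + 1 / \<delta>"
  have A: "0 < A" "l1 a < A" "1 / \<delta> \<le> A" using \<delta>_pos by (simp_all add: A_def add_nonneg_pos add_pos_pos)
  have pos: "\<forall>\<^sub>F n in sequentially. 0 < t n" using t by (simp add: filterlim_at_top_dense)
  have "(\<lambda>n. l1 (u n)) \<longlonglongrightarrow> l1 a" by (rule tendsto_l1[OF u])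
  from eventually_compose_filterlim[OF passage_time_uniform[OF A(1) zero_less_one] t] order_tendstoD(2)[OF this A(2)]
    eventually_compose_filterlim[OF scaled_ball_bounded t] pos lat
  show "\<forall>\<^sub>F n in sequentially. \<forall>y\<in>scaled_ball w (t n). \<bar>(scaled_dist w (t n) (u n) y)\<^sup>2\<bar> \<le> (C * (2 * A) + 1)^2"
  proof eventually_elim
    case (elim n)
    show ?case
    proof
      fix y assume y: "y \<in> scaled_ball w (t n)"
      have ly: "l1 y \<le> A" using elim(3) y A(3) by fastforce
      have yl: "t n *\<^sub>R y \<in> lattice" using y elim(4) by (simp add: scaled_ball_iff)
      let ?x = "t n *\<^sub>R u n" and ?y = "t n *\<^sub>R y"
      have "l1 ?x \<le> A * t n" "l1 ?y \<le> A * t n" using elim(2,4) ly by (simp_all add: mult.commute[of A])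
      then have "\<bar>T ?x ?y - N' (?x - ?y)\<bar> \<le> 1 * t n" using elim(1,5) yl by blast
      moreover have "N' (?x - ?y) \<le> C * (t n * (2 * A))"
      proof -
        have "N' (?x - ?y) \<le> C * l1 (?x - ?y)" by (rule norm_ext_bounds(1))
        also have "\<dots> = C * (t n * l1 (u n - y))"
          unfolding scaleR_diff_right[symmetric] using elim(4) by simp
        also have "\<dots> \<le> C * (t n * (2 * A))"
          using C_pos elim(2,4) ly l1_triangle_diff[of "u n" y 0] by (intro mult_left_mono) simp_all
        finally show ?thesis .
      qed
      ultimately have "T ?x ?y \<le> (C * (2 * A) + 1) * t n" by (simp add: algebra_simps)
      then have "scaled_dist w (t n) (u n) y \<le> C * (2 * A) + 1" using elim(4) by (simp add: scaled_dist_def divide_le_eq)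
      moreover have "0 \<le> scaled_dist w (t n) (u n) y"
        using passage_time_nonneg[OF w_nonneg elim(5) yl] elim(4) by (simp add: scaled_dist_def)
      ultimately show "\<bar>(scaled_dist w (t n) (u n) y)\<^sup>2\<bar> \<le> (C * (2 * A) + 1)^2"
        by (simp add: power_mono)
    qed
  qed
qed

text \<open>Carries minimality from competitors of norm less than 1 to those on the
  boundary.\<close>

lemma energy_continuous:
  assumes "u \<longlonglongrightarrow> a"
  shows "(\<lambda>n. energy (u n)) \<longlonglongrightarrow> energy a"
proof -
  obtain B where B: "\<And>n. norm (u n) \<le> B" using convergent_imp_Bseq[of u] assms by (auto simp: convergent_def Bseq_def)
  have l1B: "l1 x \<le> real CARD('n) * norm x" for x :: "real^'n"
    unfolding l1_def using sum_bounded_above[of UNIV "\<lambda>i. \<bar>x $ i\<bar>" "norm x"] by (simp add: component_le_norm_cart)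
  define K where "K = C * (real CARD('n) * B + 1 / \<delta>)"
  show ?thesis
    unfolding energy_def
  proof (rule integral_dominated_convergence[where w="\<lambda>x. K^2 * indicator limit_ball x"])
    show "integrable lborel (\<lambda>x. K^2 * indicator limit_ball x)"
      using emeasure_bounded_finite[OF bounded_limit_ball] by (intro integrable_mult_right integrable_real_indicator) auto
    show "AE x in lborel. (\<lambda>n. indicator limit_ball x * (N' (u n - x))\<^sup>2) \<longlonglongrightarrow> indicator limit_ball x * (N' (a - x))\<^sup>2"
      by (intro AE_I2 tendsto_intros assms)
    show "AE x in lborel. norm (indicator limit_ball x * (N' (u n - x))\<^sup>2) \<le> K^2 * indicator limit_ball x" for n
    proof (rule AE_I2)
      fix x
      show "norm (indicator limit_ball x * (N' (u n - x))\<^sup>2) \<le> K^2 * indicator limit_ball x"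
      proof (cases "x \<in> limit_ball")
        case True
        have "l1 (u n - x) \<le> l1 (u n) + l1 x" using l1_triangle_diff[of "u n" x 0] by simp
        also have "\<dots> \<le> real CARD('n) * B + 1 / \<delta>"
        proof -
          have "real CARD('n) * norm (u n) \<le> real CARD('n) * B" by (rule mult_left_mono[OF B]) simp
          then show ?thesis using l1B[of "u n"] limit_ball_bounded[OF True] by linarith
        qed
        finally have "N' (u n - x) \<le> K"
          unfolding K_def using C_pos by (intro order_trans[OF norm_ext_bounds(1) mult_left_mono]) auto
        then show ?thesis using True norm_ext_nonneg by (simp add: power_mono)
      qed simp
    qed
  qed measurable
qed

text \<open>The volume is positive because the ball contains the nonempty open set where
  \<open>N' x < 1\<close>. The indicator occurs twice, from the uniform measure and from the set
  integral, and is idempotent.\<close>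

lemma limit_frechet_integral:
  "(LINT y:limit_ball|uniform_measure lborel limit_ball. (N' (u - y))^2) = energy u / measure lborel limit_ball"
proof -
  have "open {x. N' x < 1}" by (intro open_Collect_less continuous_intros)
  moreover have "0 \<in> {x. N' x < 1}" by simp
  ultimately have "\<not> negligible {x. N' x < 1}" using open_not_negligible by blast
  moreover have "negligible {x. N' x < 1}" if "negligible limit_ball"
    by (rule negligible_subset[OF that]) (auto simp: limit_ball_def)
  ultimately have "\<not> negligible limit_ball" by blast
  then have "emeasure lborel limit_ball \<noteq> 0"
    by (auto simp: negligible_iff_null_sets null_sets_completion_iff null_sets_def)
  moreover have fin: "emeasure lborel limit_ball \<noteq> \<infinity>" using emeasure_bounded_finite[OF bounded_limit_ball] by auto
  ultimately have m: "0 < measure lborel limit_ball" by (simp add: measure_def enn2real_positive_iff less_top zero_less_iff_neq_zero)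
  have em: "emeasure lborel limit_ball = ennreal (measure lborel limit_ball)" by (rule emeasure_eq_ennreal_measure) (use fin in auto)
  have "(\<lambda>x. indicator limit_ball x / emeasure lborel limit_ball) = (\<lambda>x. ennreal (indicator limit_ball x / measure lborel limit_ball))"
    using m by (auto simp: em indicator_def divide_ennreal simp flip: ennreal_1)
  then have u: "uniform_measure lborel limit_ball = density lborel (\<lambda>x. ennreal (indicator limit_ball x / measure lborel limit_ball))"
    by (simp add: uniform_measure_def)
  have "(LINT y:limit_ball|uniform_measure lborel limit_ball. (N' (u - y))^2) =
      (\<integral>x. (indicator limit_ball x / measure lborel limit_ball) *\<^sub>R (indicator limit_ball x *\<^sub>R (N' (u - x))^2) \<partial>lborel)"
    unfolding u set_lebesgue_integral_def by (rule integral_density) auto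
  also have "\<dots> = (\<integral>x. indicator limit_ball x * (N' (u - x))^2 / measure lborel limit_ball \<partial>lborel)"
    by (rule Bochner_Integration.integral_cong) (auto simp: indicator_def)
  also have "\<dots> = energy u / measure lborel limit_ball" by (simp add: energy_def)
  finally show ?thesis .
qed

definition limit_means :: "(real^'n) set" where
  "limit_means = frechet_means limit_ball (\<lambda>s s'. N' (s - s')) (uniform_measure lborel limit_ball)"

lemma mem_limit_meansI:
  assumes "a \<in> limit_ball" "\<And>z. z \<in> limit_ball \<Longrightarrow> energy a \<le> energy z"
  shows "a \<in> limit_means"
  unfolding limit_means_def frechet_means_def limit_frechet_integral
  using assms by (auto intro: divide_right_mono)

text \<open>The factor \<open>k\<close> stands for the cell volume, with which both sums converge to
  energies; the normalization by the number of points cancels.\<close>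

lemma ball_frechet_mean_le:
  assumes "finite (scaled_ball w t)" "b \<in> ball_frechet_means w t" "z \<in> scaled_ball w t" "0 \<le> k"
  shows "k * (\<Sum>y\<in>scaled_ball w t. (scaled_dist w t b y)^2) \<le> k * (\<Sum>y\<in>scaled_ball w t. (scaled_dist w t z y)^2)"
proof -
  let ?Y = "scaled_ball w t"
  have I: "(LINT y:?Y|uniform_count_measure ?Y. g y) = (\<Sum>y\<in>?Y. g y) / real (card ?Y)" for g :: "_ \<Rightarrow> real"
    unfolding set_lebesgue_integral_def integral_uniform_count_measure[OF assms(1)] by simp
  have "(\<Sum>y\<in>?Y. (scaled_dist w t b y)^2) / real (card ?Y) \<le> (\<Sum>y\<in>?Y. (scaled_dist w t z y)^2) / real (card ?Y)"
    using assms(2,3) unfolding ball_frechet_means_def frechet_means_def I by blast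
  moreover have "0 < card ?Y" using assms(1,3) card_gt_0_iff by blast
  ultimately have "(\<Sum>y\<in>?Y. (scaled_dist w t b y)^2) \<le> (\<Sum>y\<in>?Y. (scaled_dist w t z y)^2)"
    by (simp add: divide_le_cancel)
  then show ?thesis using assms(4) by (rule mult_left_mono)
qed

lemma limit_of_means:
  assumes t: "filterlim t at_top sequentially"
    and b: "\<forall>\<^sub>F n in sequentially. b n \<in> ball_frechet_means w (t n)" and lim: "b \<longlonglongrightarrow> a"
  shows "a \<in> limit_means"
proof (rule mem_limit_meansI)
  have pos: "\<forall>\<^sub>F n in sequentially. 0 < t n" using t by (simp add: filterlim_at_top_dense)
  have bY: "\<forall>\<^sub>F n in sequentially. b n \<in> scaled_ball w (t n)"
    using b by eventually_elim (simp add: ball_frechet_means_def frechet_means_def)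
  then have blat: "\<forall>\<^sub>F n in sequentially. t n *\<^sub>R b n \<in> lattice"
    using pos by eventually_elim (simp add: scaled_ball_iff)
  have lim0: "(\<lambda>n. T 0 (t n *\<^sub>R z n) / t n) \<longlonglongrightarrow> N' c"
    if "z \<longlonglongrightarrow> c" "\<forall>\<^sub>F n in sequentially. t n *\<^sub>R z n \<in> lattice" for z c
    using passage_time_scaled_limit[OF t, of "\<lambda>_. 0" z 0 c] that by (simp add: norm_ext_minus)
  have "N' a \<le> 1"
  proof (rule tendsto_upperbound[OF lim0[OF lim blat]])
    show "\<forall>\<^sub>F n in sequentially. T 0 (t n *\<^sub>R b n) / t n \<le> 1"
      using bY pos by eventually_elim (simp add: scaled_ball_iff)
  qed simp
  then show "a \<in> limit_ball" by (simp add: limit_ball_def)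
  have fin: "\<forall>\<^sub>F n in sequentially. finite (scaled_ball w (t n))"
    using eventually_compose_filterlim[OF scaled_ball_bounded t] pos
    by eventually_elim (rule finite_scaled_ball, auto)
  \<comment> \<open>Strictness puts the rounding of \<open>z\<close> into the scaled ball for large
    \<open>n\<close>, so that it competes with \<open>b n\<close>; a boundary point might be rounded
    out of the ball.\<close>
  have interior: "energy a \<le> energy z" if z: "N' z < 1" for z
  proof -
    have zlat: "\<forall>\<^sub>F n in sequentially. t n *\<^sub>R lattice_round (t n) z \<in> lattice" using pos by eventually_elim (simp add: scaleR_lattice_round)
    have "\<forall>\<^sub>F n in sequentially. measure lborel (cell (t n) (0 :: real^'n)) * (\<Sum>y\<in>scaled_ball w (t n). (scaled_dist w (t n) (b n) y)^2)
      \<le> measure lborel (cell (t n) (0 :: real^'n)) * (\<Sum>y\<in>scaled_ball w (t n). (scaled_dist w (t n) (lattice_round (t n) z) y)^2)"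
      using order_tendstoD(2)[OF lim0[OF lattice_round_limit[OF t] zlat] z] zlat pos fin b
    proof eventually_elim
      case (elim n)
      have "lattice_round (t n) z \<in> scaled_ball w (t n)" using elim(1-3) by (simp add: scaled_ball_iff divide_less_eq)
      then show ?case by (rule ball_frechet_mean_le[OF elim(4,5)]) simp
    qed
    then show ?thesis
      by (rule tendsto_le[OF _ energy_limit[OF t lattice_round_limit[OF t] zlat] energy_limit[OF t lim blat], rotated]) simp
  qed
  fix z assume z: "z \<in> limit_ball"
  \<comment> \<open>Contracting \<open>z\<close> slightly makes its norm less than 1, and the energy
    converges along the ray.\<close>
  let ?s = "\<lambda>n. 1 - 1 / real (Suc n)"
  have "(\<lambda>n. ?s n *\<^sub>R z) \<longlonglongrightarrow> (1 - 0) *\<^sub>R z"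
    by (intro tendsto_intros) (use LIMSEQ_inverse_real_of_nat in \<open>simp add: inverse_eq_divide\<close>)
  then have e: "(\<lambda>n. energy (?s n *\<^sub>R z)) \<longlonglongrightarrow> energy z" using energy_continuous by simp
  have "energy a \<le> energy (?s n *\<^sub>R z)" for n
  proof (rule interior)
    have s: "0 \<le> ?s n" "?s n < 1" by (auto simp: divide_le_eq)
    have "N' (?s n *\<^sub>R z) = ?s n * N' z" using s by (simp only: norm_ext_scaleR abs_of_nonneg)
    also have "\<dots> \<le> ?s n * 1" by (rule mult_left_mono) (use z s in \<open>auto simp: limit_ball_def\<close>)
    also have "\<dots> < 1" unfolding mult_1_right by (rule s(2))
    finally show "N' (?s n *\<^sub>R z) < 1" .
  qed
  then show "energy a \<le> energy z" by (intro LIMSEQ_le_const[OF e]) auto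
qed

text \<open>Failure yields times tending to infinity at which the distance stays at least
  \<open>e\<close>. The means are bounded there, so a subsequence converges; its limit lies in
  \<open>limit_means\<close> by \<open>limit_of_means\<close>, a contradiction.\<close>

theorem frechet_means_converge:
  assumes b: "\<forall>t>0. b t \<in> ball_frechet_means w t"
  shows "((\<lambda>t. INF s\<in>limit_means. N' (b t - s)) \<longlongrightarrow> 0) at_top"
proof (rule ccontr)
  assume "\<not> ?thesis"
  then obtain e where e: "0 < e" "\<not> (\<forall>\<^sub>F t in at_top. dist (INF s\<in>limit_means. N' (b t - s)) 0 < e)"
    unfolding tendsto_iff by blast
  obtain t0 where t0: "\<And>t. t0 \<le> t \<Longrightarrow> \<forall>y\<in>scaled_ball w t. l1 y \<le> 1 / \<delta>"
    using scaled_ball_bounded by (auto simp: eventually_at_top_linorder)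
  have "\<exists>t\<ge>max t0 (real n + 1). \<not> dist (INF s\<in>limit_means. N' (b t - s)) 0 < e" for n :: nat
    using e(2) unfolding eventually_at_top_linorder by blast
  then obtain t where t: "\<And>n. max t0 (real n + 1) \<le> t n" "\<And>n. \<not> dist (INF s\<in>limit_means. N' (b (t n) - s)) 0 < e"
    by metis
  have tpos: "0 < t n" for n using t(1)[of n] by simp
  have bm: "b (t n) \<in> ball_frechet_means w (t n)" for n using b tpos by blast
  then have bY: "b (t n) \<in> scaled_ball w (t n)" for n by (simp add: ball_frechet_means_def frechet_means_def)
  have "b (t n) \<in> {x. l1 x \<le> 1 / \<delta>}" for n using t0[of "t n"] t(1)[of n] bY by simp
  then have "\<forall>n. b (t n) \<in> {x. l1 x \<le> 1 / \<delta>}" by blast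
  then obtain a r where "strict_mono r" "((\<lambda>n. b (t n)) \<circ> r) \<longlonglongrightarrow> a"
    by (rule seq_compactE[OF compact_imp_seq_compact[OF compact_l1]])
  then have r: "strict_mono r" "(\<lambda>n. b (t (r n))) \<longlonglongrightarrow> a" by (simp_all add: comp_def)
  have "filterlim t at_top sequentially"
  proof (rule filterlim_at_top_mono[OF filterlim_real_sequentially always_eventually], rule allI)
    show "real n \<le> t n" for n using t(1)[of n] by simp
  qed
  then have tr: "filterlim (\<lambda>n. t (r n)) at_top sequentially"
    by (rule filterlim_compose[OF _ filterlim_subseq[OF r(1)]])
  have a: "a \<in> limit_means" by (rule limit_of_means[OF tr _ r(2)]) (use bm in simp)
  have "(\<lambda>n. N' (b (t (r n)) - a)) \<longlonglongrightarrow> N' (a - a)" by (intro tendsto_intros r(2))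
  then have "\<forall>\<^sub>F n in sequentially. N' (b (t (r n)) - a) < e" using e(1) by (intro order_tendstoD(2)) auto
  then obtain n where n: "N' (b (t (r n)) - a) < e" by (auto simp: eventually_sequentially)
  \<comment> \<open>The cluster point \<open>a\<close> also shows that \<open>limit_means\<close> is
    nonempty, without which the infimum would be unspecified.\<close>
  have "(INF s\<in>limit_means. N' (b (t (r n)) - s)) \<le> N' (b (t (r n)) - a)"
    by (rule cINF_lower[OF _ a]) (auto intro!: bdd_belowI[of _ 0] simp: norm_ext_nonneg)
  moreover have "0 \<le> (INF s\<in>limit_means. N' (b (t (r n)) - s))"
    by (rule cINF_greatest) (use a norm_ext_nonneg in auto)
  ultimately show False using t(2)[of "r n"] n by (simp add: dist_real_def)
qed

end

section \<open>Exchanging the passage times for their positive parts\<close>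

lemma path_time_cong:
  assumes "\<forall>e\<in>edges. w e = w' e" "lattice_path xs"
  shows "path_time w xs = path_time w' xs"
  unfolding path_time_def
proof (rule sum.cong[OF refl])
  fix i assume "i \<in> {..<length xs - 1}"
  then have "{xs ! i, xs ! Suc i} \<in> edges"
    using assms(2) unfolding lattice_path_def
    by (auto intro: successively_nth[where P="\<lambda>x y. {x, y} \<in> edges"])
  then show "w {xs ! i, xs ! Suc i} = w' {xs ! i, xs ! Suc i}" using assms(1) by blast
qed

lemma passage_time_cong:
  assumes "\<forall>e\<in>edges. w e = w' e"
  shows "passage_time w x y = passage_time w' x y"
  unfolding passage_time_def
  by (intro arg_cong[where f=Inf] Collect_cong ex_cong1 rev_conj_cong refl) (simp_all add: path_time_cong[OF assms])

lemma good_weights_cong: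
  assumes "good_weights w N C \<delta>" and eq: "\<forall>e\<in>edges. w e = w' e"
  shows "good_weights w' N C \<delta>"
proof -
  have "passage_time w = passage_time w'" by (intro ext passage_time_cong[OF eq])
  moreover have "\<forall>e\<in>edges. 0 \<le> w' e" using good_weights.w_nonneg[OF assms(1)] eq by simp
  ultimately show ?thesis using assms(1) unfolding good_weights_def by simp
qed

theorem corollary3p18:
  fixes M :: "'w measure"
    and \<tau> :: "(real^'n) set \<Rightarrow> 'w \<Rightarrow> real"
    and b :: "real \<Rightarrow> 'w \<Rightarrow> real^'n"
  assumes "prob_space M"
    and indep: "prob_space.indep_vars M (\<lambda>_. borel) \<tau> edges"
    and ident_density: "\<exists>f. \<forall>e\<in>edges. distributed M lborel (\<tau> e) f"
    and nonneg: "\<forall>e\<in>edges. AE \<omega> in M. 0 \<le> \<tau> e \<omega>"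
    and exp_moment: "\<exists>\<alpha>>0. \<forall>e\<in>edges. integrable M (\<lambda>\<omega>. exp (\<alpha> * \<tau> e \<omega>))"
    and b: "AE \<omega> in M. \<forall>t>0. b t \<omega> \<in> ball_frechet_means (\<lambda>e. \<tau> e \<omega>) t"
  shows "AE \<omega> in M.
    ((\<lambda>t. INF s\<in>limit_frechet_means M \<tau>. limit_dist M \<tau> (b t \<omega>) s) \<longlongrightarrow> 0) at_top"
proof -
  interpret prob_space M by fact
  obtain f where f: "\<And>e. e \<in> edges \<Longrightarrow> distributed M lborel (\<tau> e) f" using ident_density by blast
  obtain \<alpha> where \<alpha>: "\<alpha> > 0" "\<And>e. e \<in> edges \<Longrightarrow> integrable M (\<lambda>\<omega>. exp (\<alpha> * \<tau> e \<omega>))"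
    using exp_moment by blast
  have meas: "\<tau> e \<in> borel_measurable M" if "e \<in> edges" for e
    using indep that by (auto simp: indep_vars_def)
  \<comment> \<open>The locale asks for nonnegativity at every outcome and every argument, while it
    is given almost surely and on edges. Positive parts remain independent and keep the law on
    edges.\<close>
  define \<sigma> where "\<sigma> e \<omega> = max 0 (\<tau> e \<omega>)" for e \<omega>
  obtain e0 :: "(real^'n) set" where e0: "e0 \<in> edges" using edge_exists by blast
  have eq: "AE \<omega> in M. \<sigma> e \<omega> = \<tau> e \<omega>" if "e \<in> edges" for e
    using nonneg[rule_format, OF that] by eventually_elim (simp add: \<sigma>_def)
  have meas': "\<sigma> e \<in> borel_measurable M" if "e \<in> edges" for e
    unfolding \<sigma>_def using meas[OF that] by measurable
  have law: "distr M borel (\<sigma> e) = density lborel f" if "e \<in> edges" for e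
  proof -
    have "distr M borel (\<sigma> e) = distr M borel (\<tau> e)"
      by (rule distr_cong_AE[OF refl refl eq[OF that] meas'[OF that] meas[OF that]])
    also have "\<dots> = distr M lborel (\<tau> e)" by (rule distr_cong) simp_all
    also have "\<dots> = density lborel f" using f[OF that] by (simp add: distributed_def)
    finally show ?thesis .
  qed
  have fm: "f \<in> borel_measurable lborel" using f[OF e0] by (simp add: distributed_def)
  interpret first_passage M \<sigma> "density lborel f"
  proof unfold_locales
    show "indep_vars (\<lambda>_. borel) \<sigma> edges"
      unfolding \<sigma>_def by (rule indep_vars_compose2[OF indep]) simp
    show "measure (density lborel f) {0} = 0"
    proof -
      have "{0} \<in> null_sets (density lborel f)"
        unfolding null_sets_density_iff[OF fm]
      proof
        show "AE x in lborel. x \<in> {0} \<longrightarrow> f x = 0"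
          using AE_lborel_singleton[of "0::real"] by eventually_elim simp
      qed simp
      then show ?thesis by (simp add: measure_eq_0_null_sets)
    qed
    have "AE \<omega> in M. \<tau> e0 \<omega> = \<sigma> e0 \<omega>" using eq[OF e0] by eventually_elim simp
    then have "integrable M (\<lambda>\<omega>. exp (\<alpha> * \<sigma> e0 \<omega>))"
      by (intro integrable_cong_AE_imp[OF \<alpha>(2)[OF e0]]) (use meas'[OF e0] in auto)
    then have "integrable (density lborel f) (\<lambda>x. exp (\<alpha> * x))"
      unfolding law[OF e0, symmetric] by (subst integrable_distr_eq) (use meas'[OF e0] in auto)
    then show "\<exists>\<alpha>>0. integrable (density lborel f) (\<lambda>x. exp (\<alpha> * x))" using \<alpha>(1) by blast
  qed (use law in \<open>auto simp: \<sigma>_def\<close>)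
  obtain N C \<delta> where good: "AE \<omega> in M. good_weights (\<lambda>e. \<sigma> e \<omega>) N C \<delta>" using AE_good_weights by blast
  have countable_edges: "countable (edges :: (real^'n) set set)"
  proof -
    have "edges \<subseteq> (\<lambda>(x, y). {x, y}) ` ((lattice :: (real^'n) set) \<times> lattice)"
      by (auto simp: edges_def)
    then show ?thesis by (rule countable_subset) (intro countable_image countable_SIGMA countable_lattice)
  qed
  \<comment> \<open>Countability merges the exceptional null sets of the single edges. The
    properties must return to \<open>\<tau>\<close>, through which \<open>time_norm\<close> and the
    means are defined.\<close>
  then have "AE \<omega> in M. \<forall>e\<in>edges. \<sigma> e \<omega> = \<tau> e \<omega>" by (intro AE_ball_countable' eq)
  with good have good': "AE \<omega> in M. good_weights (\<lambda>e. \<tau> e \<omega>) N C \<delta>"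
  proof eventually_elim
    case (elim \<omega>)
    show ?case by (rule good_weights_cong[OF elim(1)]) (use elim(2) in simp)
  qed
  have tn: "time_norm M \<tau> = norm_ext N" by (rule time_norm_eq[OF prob_space_axioms good'])
  from good' b show ?thesis
  proof eventually_elim
    case (elim \<omega>)
    interpret good_weights "\<lambda>e. \<tau> e \<omega>" N C \<delta> by fact
    have "limit_shape M \<tau> = limit_ball" unfolding limit_shape_def tn limit_ball_def ..
    moreover have "limit_dist M \<tau> = (\<lambda>s s'. norm_ext N (s - s'))" unfolding limit_dist_def tn ..
    ultimately have "limit_frechet_means M \<tau> = limit_means" by (simp only: limit_frechet_means_def limit_means_def)
    then show ?case using frechet_means_converge[OF elim(2)] unfolding limit_dist_def tn by simp
  qed
qed

end
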